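(* Let $k$ be an infinite field, $R=k[x_1,\ldots,x_m]$, $I\subset R$ a homogeneous ideal, $A=R/I$ and $d=\dim A\ge1$. Let $\{\mathcal V_n\}_{n\ge0}$ be the projective varieties in $\mathbb P_k^{md-1}$ associated with $A$ as defined in the context. Then $br(A)$ is the largest integer $n\ge0$ such that $\mathcal V_{n+1}\neq\mathcal V_n$.
   Context: $A=R/I$ is a standard graded $k$-algebra (so $I$ is proper). A reduction of $A$ is an ideal $Q$ generated by linear forms (elements of $A_1$) such that $Q_n=A_n$ for all large $n$. The reduction number $r_Q(A)$ of $A$ with respect to $Q$ is the least $n\ge0$ with $Q_{n+1}=A_{n+1}$. A reduction is minimal if it contains no other reduction (equivalently, it is a reduction generated by $d$ linear forms). The big reduction number is $br(A)=\max\{r_Q(A)\mid Q\text{ a minimal reduction of }A\}$. Let $u=\{u_{ij}\mid 1\le i\le d,\ 1\le j\le m\}$ be indeterminates and $z_i=\sum_{j=1}^m u_{ij}x_j$. Fix generators $I=(f_1,\ldots,f_v)$ with $f_j$ a form of degree $d_j$. For $n\ge0$, $M_n(u)$ is the matrix with entries in $k[u]$ of the coefficients of the elements $z_ig$ ($g$ a monomial of $R$ of degree $n-1$) and $f_jh$ ($h$ a monomial of $R$ of degree $n-d_j$), written as linear combinations of the monomials of degree $n$ in $x_1,\ldots,x_m$. With $N=\binom{n+m-1}{m-1}$, $J_n$ is the ideal of $k[u]$ generated by the $N\times N$ minors of $M_n(u)$ ($J_n=0$ if one of the sizes of $M_n(u)$ is less than $N$; in particular $J_0=0$). $\mathcal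 V_n\subseteq\mathbb P_k^{md-1}$ is the zero locus of $J_n$, i.e. the set of points with coordinates in $k$ at which all elements of $J_n$ vanish. *)

theory Defs
  imports
    "HOL-Algebra.QuotRing"
    "HOL-Library.Poly_Mapping"
    "HOL-Library.Extended_Nat"
    "Jordan_Normal_Form.Determinant"
    "Jordan_Normal_Form.DL_Submatrix"
begin

section \<open>Polynomial rings\<close>

text \<open>
  A polynomial with coefficients in \<^typ>\<open>'a\<close> and indeterminates indexed by \<^typ>\<open>'x\<close>
  is a finitely supported map from monomials (finitely supported exponent vectors) to coefficients.
\<close>

type_synonym 'x monom = "'x \<Rightarrow>\<^sub>0 nat"
type_synonym ('x, 'a) mpol = "'x monom \<Rightarrow>\<^sub>0 'a"

definition mono_deg :: "'x monom \<Rightarrow> nat"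
  where "mono_deg t = (\<Sum>x\<in>Poly_Mapping.keys t. Poly_Mapping.lookup t x)"

definition mpol_ring :: "'x set \<Rightarrow> ('x, 'a::comm_ring_1) mpol ring"
  where "mpol_ring X =
    \<lparr>carrier = {p. \<forall>t\<in>Poly_Mapping.keys p. Poly_Mapping.keys t \<subseteq> X},
     monoid.mult = (*), one = 1, ring.zero = 0, add = (+)\<rparr>"

lemma cring_mpol_ring: "cring (mpol_ring X :: ('x, 'a::comm_ring_1) mpol ring)"
proof -
  let ?R = "mpol_ring X :: ('x, 'a) mpol ring"
  let ?C = "{p :: ('x, 'a) mpol. \<forall>t\<in>Poly_Mapping.keys p. Poly_Mapping.keys t \<subseteq> X}"
  have mult: "p * q \<in> ?C" if "p \<in> ?C" "q \<in> ?C" for p q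
  proof -
    have "Poly_Mapping.keys t \<subseteq> X" if t: "t \<in> Poly_Mapping.keys (p * q)" for t
    proof -
      obtain a b where "a \<in> Poly_Mapping.keys p" "b \<in> Poly_Mapping.keys q" "t = a + b"
        using t keys_mult[of p q] by blast
      then show ?thesis
        using Poly_Mapping.keys_add[of a b] \<open>p \<in> ?C\<close> \<open>q \<in> ?C\<close> by blast
    qed
    then show ?thesis by blast
  qed
  have add: "p + q \<in> ?C" if "p \<in> ?C" "q \<in> ?C" for p q
    using that Poly_Mapping.keys_add[of p q] by blast
  have neg: "- p \<in> ?C" if "p \<in> ?C" for p
    using that by simp
  have sel: "carrier ?R = ?C" "\<zero>\<^bsub>?R\<^esub> = 0" "\<one>\<^bsub>?R\<^esub> = 1"
      "p \<oplus>\<^bsub>?R\<^esub> q = p + q" "p \<otimes>\<^bsub>?R\<^esub> q = p * q" for p q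
    by (simp_all add: mpol_ring_def)
  have zero: "0 \<in> ?C" and one: "1 \<in> ?C"
    by (simp_all add: keys_one)
  have "abelian_group ?R"
  proof (rule abelian_groupI)
    fix p q s assume "p \<in> carrier ?R" "q \<in> carrier ?R" "s \<in> carrier ?R"
    show "p \<oplus>\<^bsub>?R\<^esub> q \<oplus>\<^bsub>?R\<^esub> s = p \<oplus>\<^bsub>?R\<^esub> (q \<oplus>\<^bsub>?R\<^esub> s)"
      unfolding sel by (rule add.assoc)
  next
    fix p q assume "p \<in> carrier ?R" "q \<in> carrier ?R"
    then show "p \<oplus>\<^bsub>?R\<^esub> q \<in> carrier ?R"
      unfolding sel by (rule add)
    show "p \<oplus>\<^bsub>?R\<^esub> q = q \<oplus>\<^bsub>?R\<^esub> p"
      unfolding sel by (rule add.commute)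
  next
    fix p assume "p \<in> carrier ?R"
    then have "- p \<in> carrier ?R"
      unfolding sel by (rule neg)
    then show "\<exists>q\<in>carrier ?R. q \<oplus>\<^bsub>?R\<^esub> p = \<zero>\<^bsub>?R\<^esub>"
      by (rule bexI[rotated]) (unfold sel, rule left_minus)
    show "\<zero>\<^bsub>?R\<^esub> \<oplus>\<^bsub>?R\<^esub> p = p"
      unfolding sel by (rule add_0_left)
  next
    show "\<zero>\<^bsub>?R\<^esub> \<in> carrier ?R"
      unfolding sel by (rule zero)
  qed
  moreover have "comm_monoid ?R"
  proof (rule comm_monoidI)
    fix p q s assume "p \<in> carrier ?R" "q \<in> carrier ?R" "s \<in> carrier ?R"
    show "p \<otimes>\<^bsub>?R\<^esub> q \<otimes>\<^bsub>?R\<^esub> s = p \<otimes>\<^bsub>?R\<^esub> (q \<otimes>\<^bsub>?R\<^esub> s)"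
      unfolding sel by (rule mult.assoc)
  next
    fix p q assume "p \<in> carrier ?R" "q \<in> carrier ?R"
    then show "p \<otimes>\<^bsub>?R\<^esub> q \<in> carrier ?R"
      unfolding sel by (rule mult)
    show "p \<otimes>\<^bsub>?R\<^esub> q = q \<otimes>\<^bsub>?R\<^esub> p"
      unfolding sel by (rule mult.commute)
  next
    fix p assume "p \<in> carrier ?R"
    show "\<one>\<^bsub>?R\<^esub> \<otimes>\<^bsub>?R\<^esub> p = p"
      unfolding sel by (rule mult_1_left)
  next
    show "\<one>\<^bsub>?R\<^esub> \<in> carrier ?R"
      unfolding sel by (rule one)
  qed
  ultimately show ?thesis
  proof (rule cringI)
    fix p q s assume "p \<in> carrier ?R" "q \<in> carrier ?R" "s \<in> carrier ?R"
    show "(p \<oplus>\<^bsub>?R\<^esub> q) \<otimes>\<^bsub>?R\<^esub> s = p \<otimes>\<^bsub>?R\<^esub> s \<oplus>\<^bsub>?R\<^esub> q \<otimes>\<^bsub>?R\<^esub> s"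
      unfolding sel by (rule distrib_right)
  qed
qed

definition mpol_eval :: "('x \<Rightarrow> 'a) \<Rightarrow> ('x, 'a::comm_ring_1) mpol \<Rightarrow> 'a"
  where "mpol_eval a p = (\<Sum>t\<in>Poly_Mapping.keys p. Poly_Mapping.lookup p t *
           (\<Prod>x\<in>Poly_Mapping.keys t. a x ^ Poly_Mapping.lookup t x))"

text \<open>The ring \<open>k[x\<^sub>1, \<dots>, x\<^sub>m]\<close>; the variables are numbered from \<open>0\<close>.\<close>

definition poly_ring :: "nat \<Rightarrow> (nat, 'k::field) mpol ring"
  where "poly_ring m = mpol_ring {..<m}"

definition forms :: "nat \<Rightarrow> nat \<Rightarrow> (nat, 'k::field) mpol set"
  where "forms m n =
    {p \<in> carrier (poly_ring m). \<forall>t\<in>Poly_Mapping.keys p. mono_deg t = n}"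

definition hom_component :: "nat \<Rightarrow> (nat, 'k::field) mpol \<Rightarrow> (nat, 'k) mpol"
  where "hom_component n p = (\<Sum>t\<in>{t \<in> Poly_Mapping.keys p. mono_deg t = n}.
           Poly_Mapping.single t (Poly_Mapping.lookup p t))"

definition homogeneous_ideal :: "nat \<Rightarrow> (nat, 'k::field) mpol set \<Rightarrow> bool"
  where "homogeneous_ideal m I \<longleftrightarrow>
    ideal I (poly_ring m) \<and> (\<forall>p\<in>I. \<forall>n. hom_component n p \<in> I)"

text \<open>The graded pieces of \<open>A = R/I\<close>, as sets of cosets.\<close>

definition quot_piece :: "nat \<Rightarrow> (nat, 'k::field) mpol set \<Rightarrow> nat \<Rightarrow> (nat, 'k) mpol set set"
  where "quot_piece m I n = (\<lambda>p. I +>\<^bsub>poly_ring m\<^esub> p) ` forms m n"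


section \<open>Krull dimension\<close>

text \<open>The zero ring, which has no prime ideals, is given dimension \<open>0\<close> here.\<close>

definition krull_dim :: "('a, 'b) ring_scheme \<Rightarrow> enat"
  where "krull_dim A = Sup {enat n | n.
    \<exists>P. (\<forall>i\<le>n. primeideal (P i) A) \<and> (\<forall>i<n. P i \<subset> P (Suc i))}"


section \<open>Reductions\<close>

text \<open>In this section \<open>G n\<close> is the graded piece of degree \<open>n\<close> of the ring \<open>A\<close>.\<close>

definition is_reduction :: "('a, 'b) ring_scheme \<Rightarrow> (nat \<Rightarrow> 'a set) \<Rightarrow> 'a set \<Rightarrow> bool"
  where "is_reduction A G Q \<longleftrightarrow>
    (\<exists>S. S \<subseteq> G 1 \<and> Q = genideal A S) \<and> (\<exists>n0. \<forall>n\<ge>n0. Q \<inter> G n = G n)"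

definition is_minimal_reduction :: "('a, 'b) ring_scheme \<Rightarrow> (nat \<Rightarrow> 'a set) \<Rightarrow> 'a set \<Rightarrow> bool"
  where "is_minimal_reduction A G Q \<longleftrightarrow>
    is_reduction A G Q \<and> (\<forall>Q'. is_reduction A G Q' \<and> Q' \<subseteq> Q \<longrightarrow> Q' = Q)"

definition reduction_number :: "(nat \<Rightarrow> 'a set) \<Rightarrow> 'a set \<Rightarrow> nat"
  where "reduction_number G Q = (LEAST n. Q \<inter> G (n + 1) = G (n + 1))"

definition minimal_reduction_numbers :: "('a, 'b) ring_scheme \<Rightarrow> (nat \<Rightarrow> 'a set) \<Rightarrow> nat set"
  where "minimal_reduction_numbers A G = {reduction_number G Q | Q. is_minimal_reduction A G Q}"

definition big_reduction_number :: "('a, 'b) ring_scheme \<Rightarrow> (nat \<Rightarrow> 'a set) \<Rightarrow> nat"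
  where "big_reduction_number A G = Max (minimal_reduction_numbers A G)"


section \<open>The matrices, ideals and varieties associated with the generic linear forms\<close>

text \<open>
  The indeterminate \<open>u\<^sub>i\<^sub>j\<close> has index \<open>(i, j)\<close>, where \<open>i < d\<close> and \<open>j < m\<close>. Elements of \<open>k[u][x]\<close>
  are polynomials whose coefficients are themselves polynomials.
\<close>

type_synonym 'k upol = "(nat \<times> nat, 'k) mpol"

definition u_indices :: "nat \<Rightarrow> nat \<Rightarrow> (nat \<times> nat) set"
  where "u_indices m d = {..<d} \<times> {..<m}"

definition generic_form :: "nat \<Rightarrow> nat \<Rightarrow> (nat, 'k::field upol) mpol"
  where "generic_form m i = (\<Sum>j<m.
    Poly_Mapping.single (Poly_Mapping.single j 1)
      (Poly_Mapping.single (Poly_Mapping.single (i, j) 1) 1))"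

definition lift_coeffs :: "(nat, 'k::field) mpol \<Rightarrow> (nat, 'k upol) mpol"
  where "lift_coeffs = Poly_Mapping.map (\<lambda>c. Poly_Mapping.single 0 c)"

definition monomials :: "nat \<Rightarrow> nat \<Rightarrow> nat monom set"
  where "monomials m n = {t. Poly_Mapping.keys t \<subseteq> {..<m} \<and> mono_deg t = n}"

text \<open>
  The generators of \<open>I\<close> are \<open>f j\<close> for \<open>j < v\<close>, and \<open>e j\<close> is the degree of \<open>f j\<close>.
  There are no monomials of negative degree, so the multipliers of \<open>z\<^sub>i\<close> (and of \<open>f\<^sub>j\<close>) are
  absent for \<open>n < 1\<close> (for \<open>n < e j\<close>); truncated subtraction must not apply here.
\<close>

definition generic_elements ::
    "nat \<Rightarrow> nat \<Rightarrow> nat \<Rightarrow> (nat \<Rightarrow> (nat, 'k::field) mpol) \<Rightarrow> (nat \<Rightarrow> nat) \<Rightarrow> nat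
      \<Rightarrow> (nat, 'k upol) mpol list"
  where "generic_elements m d v f e n =
    [generic_form m i * Poly_Mapping.single g 1.
       i \<leftarrow> [0..<d], g \<leftarrow> (if 1 \<le> n then sorted_list_of_set (monomials m (n - 1)) else [])] @
    [lift_coeffs (f j) * Poly_Mapping.single h 1.
       j \<leftarrow> [0..<v], h \<leftarrow> (if e j \<le> n then sorted_list_of_set (monomials m (n - e j)) else [])]"

text \<open>
  The matrix \<open>M\<^sub>n(u)\<close>: one row for each element of the list above, one column for each monomial of
  degree \<open>n\<close>. The order of rows and columns only affects the signs of the minors.
\<close>

definition generic_matrix ::
    "nat \<Rightarrow> nat \<Rightarrow> nat \<Rightarrow> (nat \<Rightarrow> (nat, 'k::field) mpol) \<Rightarrow> (nat \<Rightarrow> nat) \<Rightarrow> nat \<Rightarrow> 'k upol mat"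
  where "generic_matrix m d v f e n =
    (let es = generic_elements m d v f e n; ts = sorted_list_of_set (monomials m n)
     in mat (length es) (length ts) (\<lambda>(r, c). Poly_Mapping.lookup (es ! r) (ts ! c)))"

definition minors :: "nat \<Rightarrow> 'a::comm_ring_1 mat \<Rightarrow> 'a set"
  where "minors N M = {det (submatrix M I J) | I J.
    I \<subseteq> {..<dim_row M} \<and> J \<subseteq> {..<dim_col M} \<and> card I = N \<and> card J = N}"

definition minors_ideal ::
    "nat \<Rightarrow> nat \<Rightarrow> nat \<Rightarrow> (nat \<Rightarrow> (nat, 'k::field) mpol) \<Rightarrow> (nat \<Rightarrow> nat) \<Rightarrow> nat \<Rightarrow> 'k upol set"
  where "minors_ideal m d v f e n =
    genideal (mpol_ring (u_indices m d))
      (minors ((n + m - 1) choose (m - 1)) (generic_matrix m d v f e n))"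

text \<open>
  A point of the projective space with homogeneous coordinates indexed by \<open>X\<close> is the set of all its
  coordinate vectors; these are extended by \<open>0\<close> outside \<open>X\<close>.
\<close>

definition proj_space :: "'x set \<Rightarrow> ('x \<Rightarrow> 'k::field) set set"
  where "proj_space X =
    {{(\<lambda>x. c * a x) | c. c \<noteq> 0} | a. (\<forall>x. x \<notin> X \<longrightarrow> a x = 0) \<and> (\<exists>x. a x \<noteq> 0)}"

definition proj_zeros :: "'x set \<Rightarrow> ('x, 'k::field) mpol set \<Rightarrow> ('x \<Rightarrow> 'k) set set"
  where "proj_zeros X J = {P \<in> proj_space X. \<forall>a\<in>P. \<forall>p\<in>J. mpol_eval a p = 0}"

definition variety ::
    "nat \<Rightarrow> nat \<Rightarrow> nat \<Rightarrow> (nat \<Rightarrow> (nat, 'k::field) mpol) \<Rightarrow> (nat \<Rightarrow> nat) \<Rightarrow> nat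
      \<Rightarrow> (nat \<times> nat \<Rightarrow> 'k) set set"
  where "variety m d v f e n = proj_zeros (u_indices m d) (minors_ideal m d v f e n)"

end

theory Submission
  imports Defs "HOL-Library.Product_Lexorder"
begin

text \<open>
  A point \<open>a\<close> with coordinates \<open>a\<^sub>i\<^sub>j\<close> gives \<open>d\<close> linear forms
  \<open>z\<^sub>i = \<Sum>\<^sub>j a\<^sub>i\<^sub>j x\<^sub>j\<close>, and the rows of the matrix at \<open>a\<close> span the degree \<open>n\<close> part of
  \<open>I + (z\<^sub>1, \<dots>, z\<^sub>d)\<close>. So \<open>a\<close> lies outside the \<open>n\<close>-th variety iff \<open>Q\<^sub>n = A\<^sub>n\<close> for the ideal
  \<open>Q\<close> of \<open>A\<close> generated by the \<open>z\<^sub>i\<close>. The varieties therefore decrease, and the step from \<open>n\<close> to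
  \<open>n + 1\<close> is strict iff some reduction generated by \<open>d\<close> linear forms has reduction number \<open>n\<close>; by
  noetherianity of \<open>k[u]\<close> this happens only finitely often.

  The reductions generated by \<open>d\<close> linear forms are the minimal ones. On the one hand a reduction
  generated by \<open>s\<close> linear forms forces \<open>d \<le> s\<close>: the dimension of the part of \<open>A\<close> of degree at most
  \<open>N\<close> is \<open>O(N\<^sup>s)\<close>, while a chain of \<open>n + 1\<close> primes yields \<open>n\<close> elements that are algebraically
  independent. On the other hand every reduction contains one generated by \<open>d\<close> linear forms,
  obtained by avoiding minimal primes one form at a time.
\<close>

section \<open>Polynomials and homogeneous ideals\<close>

text \<open>Ideals of A are replaced by their preimages in R, so that Q_n = A_n becomes a
  containment of all forms of degree n. Such a containment passes to higher degrees; hence "for all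
  large n" turns into "for some n", and a reduction has exactly one degree at which it becomes full.

  Dimension enters only through lengths of prime chains, and in two ways. The bound d \<le> s uses a
  single chain of length d of arbitrary primes, so the independent elements it yields need not be
  homogeneous and the growth is measured on all polynomials of bounded degree. The construction of d
  forms uses that chains of homogeneous primes have length at most d.

  That k is infinite serves to find a linear form outside finitely many proper subspaces. The
  noetherian property is used twice: in R, for a finite list of primes over a homogeneous ideal, and
  in k[u], for the finiteness of the jumps, where it is applied to the vanishing ideals of the
  varieties and not to the ideals of minors. The assumption d \<ge> 1 keeps the zero tuple, which
  represents no projective point, from generating a reduction.\<close>

abbreviation cst :: "'a \<Rightarrow> ('x, 'a::comm_ring_1) mpol"
  where "cst \<equiv> Poly_Mapping.single 0"

abbreviation mon :: "'x monom \<Rightarrow> ('x, 'a::comm_ring_1) mpol"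
  where "mon t \<equiv> Poly_Mapping.single t 1"

lemma lookup_cst_mult: "Poly_Mapping.lookup (cst c * p) t = c * Poly_Mapping.lookup p t"
  by (simp add: mult_map_scale_conv_mult[symmetric] Poly_Mapping.map.rep_eq when_def)

lemma cst_mult_mono: "cst c * mon t = Poly_Mapping.single t c"
  by (simp add: mult_single)

text \<open>Scalars act as constant polynomials, so linear algebra and ideal theory share one type
  and every ideal is a subspace.\<close>

interpretation mpol: vector_space "\<lambda>(c::'k::field) (p::('x, 'k) mpol). cst c * p"
  by unfold_locales (simp_all add: algebra_simps single_add mult_single)

lemma mpol_expand:
  assumes "finite T" "Poly_Mapping.keys p \<subseteq> T"
  shows "p = (\<Sum>t\<in>T. Poly_Mapping.single t (Poly_Mapping.lookup p t))"
proof (rule poly_mapping_eqI)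
  fix s
  have "(\<Sum>t\<in>T. Poly_Mapping.lookup (Poly_Mapping.single t (Poly_Mapping.lookup p t)) s)
      = (\<Sum>t\<in>T. if t = s then Poly_Mapping.lookup p s else 0)"
    by (rule sum.cong) (auto simp: lookup_single when_def)
  also have "\<dots> = Poly_Mapping.lookup p s"
    using assms by (auto simp: in_keys_iff)
  finally show "Poly_Mapping.lookup p s =
      Poly_Mapping.lookup (\<Sum>t\<in>T. Poly_Mapping.single t (Poly_Mapping.lookup p t)) s"
    by (simp add: lookup_sum)
qed

lemma mono_deg_superset:
  assumes "finite X" "Poly_Mapping.keys t \<subseteq> X"
  shows "mono_deg t = (\<Sum>x\<in>X. Poly_Mapping.lookup t x)"
  unfolding mono_deg_def using assms
  by (intro sum.mono_neutral_left) (auto simp: in_keys_iff)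

lemma keys_add_nat: "Poly_Mapping.keys (s + t) = Poly_Mapping.keys s \<union> Poly_Mapping.keys (t :: 'x monom)"
  by (auto simp: in_keys_iff lookup_add)

lemma mono_deg_add: "mono_deg (s + t) = mono_deg s + mono_deg t"
proof -
  have "mono_deg u = (\<Sum>x\<in>Poly_Mapping.keys s \<union> Poly_Mapping.keys t. Poly_Mapping.lookup u x)"
    if "u \<in> {s, t, s + t}" for u
    using that by (intro mono_deg_superset) (auto simp: keys_add_nat)
  then show ?thesis by (simp add: lookup_add sum.distrib)
qed

lemma mono_deg_zero [simp]: "mono_deg 0 = 0"
  by (simp add: mono_deg_def)

lemma mono_deg_single [simp]: "mono_deg (Poly_Mapping.single x n) = n"
  by (simp add: mono_deg_def)

section \<open>Ideals of polynomial rings\<close>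

lemma carrier_mpol_ring: "carrier (mpol_ring X) = {p. \<forall>t\<in>Poly_Mapping.keys p. Poly_Mapping.keys t \<subseteq> X}"
  by (simp add: mpol_ring_def)

lemma mpol_ring_sel [simp]:
  "\<zero>\<^bsub>mpol_ring X\<^esub> = 0" "\<one>\<^bsub>mpol_ring X\<^esub> = 1"
  "p \<oplus>\<^bsub>mpol_ring X\<^esub> q = p + q" "p \<otimes>\<^bsub>mpol_ring X\<^esub> q = p * q"
  by (simp_all add: mpol_ring_def)

lemma single_in_carrier: "Poly_Mapping.keys t \<subseteq> X \<Longrightarrow> Poly_Mapping.single t c \<in> carrier (mpol_ring X)"
  by (auto simp: carrier_mpol_ring)

lemma carrier_closed:
  assumes "p \<in> carrier (mpol_ring X)" "q \<in> carrier (mpol_ring X)"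
  shows "p + q \<in> carrier (mpol_ring X)" "p * q \<in> carrier (mpol_ring X)"
proof -
  interpret cring "mpol_ring X :: ('a, 'b) mpol ring" by (rule cring_mpol_ring)
  show "p + q \<in> carrier (mpol_ring X)" "p * q \<in> carrier (mpol_ring X)"
    using add.m_closed[OF assms] m_closed[OF assms] by simp_all
qed

lemma carrier_basic [simp]:
  "0 \<in> carrier (mpol_ring X)" "1 \<in> carrier (mpol_ring X)" "cst c \<in> carrier (mpol_ring X)"
  using single_in_carrier[of 0 X] by (auto simp: carrier_mpol_ring)

lemma carrier_uminus: "p \<in> carrier (mpol_ring X) \<Longrightarrow> - p \<in> carrier (mpol_ring X)"
  by (simp add: carrier_mpol_ring)

lemma carrier_sum:
  "(\<And>i. i \<in> A \<Longrightarrow> p i \<in> carrier (mpol_ring X)) \<Longrightarrow> sum p A \<in> carrier (mpol_ring X)"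
  by (induction A rule: infinite_finite_induct) (auto intro: carrier_closed)

text \<open>Multiplication by -1 supplies additive inverses, so the subgroup axioms shrink to 0 and
  closure under addition, and membership goals use the operations of the type.\<close>

lemma ideal_mpol_ring_iff:
  fixes J :: "('x, 'a::comm_ring_1) mpol set"
  shows "ideal J (mpol_ring X) \<longleftrightarrow> J \<subseteq> carrier (mpol_ring X) \<and> 0 \<in> J \<and>
    (\<forall>p\<in>J. \<forall>q\<in>J. p + q \<in> J) \<and> (\<forall>p\<in>J. \<forall>c\<in>carrier (mpol_ring X). c * p \<in> J)" (is "_ \<longleftrightarrow> ?r")
proof
  assume "ideal J (mpol_ring X)"
  then interpret ideal J "mpol_ring X" .
  show ?r using a_subset additive_subgroup.zero_closed[OF is_additive_subgroup]
      additive_subgroup.a_closed[OF is_additive_subgroup] I_l_closed by auto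
next
  assume r: ?r
  interpret R: cring "mpol_ring X :: ('x, 'a) mpol ring" by (rule cring_mpol_ring)
  have neg: "- p \<in> J" if "p \<in> J" for p
  proof -
    have "(- 1) * p \<in> J"
      using r that carrier_uminus[of 1 X] by (metis carrier_basic(2))
    then show ?thesis by simp
  qed
  have inv: "inv\<^bsub>add_monoid (mpol_ring X)\<^esub> p = - p" if "p \<in> J" for p
    using r that carrier_uminus[of p X] R.minus_equality[of "- p" p] by (auto simp: a_inv_def)
  show "ideal J (mpol_ring X)"
  proof (rule idealI)
    show "ring (mpol_ring X :: ('x, 'a) mpol ring)" by (rule R.ring_axioms)
    show "subgroup J (add_monoid (mpol_ring X))"
      using r neg inv by (intro subgroup.intro) auto
  qed (use r in \<open>auto simp: mult.commute\<close>)
qed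

lemma idealD:
  assumes "ideal J (mpol_ring X)"
  shows "J \<subseteq> carrier (mpol_ring X)" "0 \<in> J"
    "p \<in> J \<Longrightarrow> q \<in> J \<Longrightarrow> p + q \<in> J" "p \<in> J \<Longrightarrow> c \<in> carrier (mpol_ring X) \<Longrightarrow> c * p \<in> J"
    "p \<in> J \<Longrightarrow> c \<in> carrier (mpol_ring X) \<Longrightarrow> p * c \<in> J"
    "p \<in> J \<Longrightarrow> - p \<in> J" "p \<in> J \<Longrightarrow> q \<in> J \<Longrightarrow> p - q \<in> J"
proof -
  note r = assms[unfolded ideal_mpol_ring_iff]
  show "J \<subseteq> carrier (mpol_ring X)" "0 \<in> J"
    "p \<in> J \<Longrightarrow> q \<in> J \<Longrightarrow> p + q \<in> J" "p \<in> J \<Longrightarrow> c \<in> carrier (mpol_ring X) \<Longrightarrow> c * p \<in> J"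
    "p \<in> J \<Longrightarrow> c \<in> carrier (mpol_ring X) \<Longrightarrow> p * c \<in> J"
    using r by (auto simp: mult.commute)
  have neg: "- p \<in> J" if "p \<in> J" for p
  proof -
    have "(- 1) * p \<in> J"
      using r that carrier_uminus[of 1 X] by (metis carrier_basic(2))
    then show ?thesis by simp
  qed
  then show "p \<in> J \<Longrightarrow> - p \<in> J" .
  show "p \<in> J \<Longrightarrow> q \<in> J \<Longrightarrow> p - q \<in> J"
    using neg r by (metis add_uminus_conv_diff)
qed

lemma ideal_sum:
  assumes "ideal J (mpol_ring X)" "\<And>i. i \<in> A \<Longrightarrow> p i \<in> J"
  shows "sum p A \<in> J"
  using assms(2) by (induction A rule: infinite_finite_induct) (auto intro: idealD[OF assms(1)])

lemma subspace_ideal: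
  fixes J :: "('x, 'k::field) mpol set"
  assumes "ideal J (mpol_ring X)"
  shows "mpol.subspace J"
  by (intro mpol.subspaceI) (auto intro: idealD[OF assms])

lemma ideal_eq_carrier_iff:
  assumes "ideal J (mpol_ring X)"
  shows "J = carrier (mpol_ring X) \<longleftrightarrow> 1 \<in> J"
  using idealD(1)[OF assms] idealD(4)[OF assms, of 1] by force

lemma genideal_mpol_ring:
  fixes S :: "('x, 'a::comm_ring_1) mpol set"
  assumes "S \<subseteq> carrier (mpol_ring X)"
  shows "ideal (genideal (mpol_ring X) S) (mpol_ring X)" "S \<subseteq> genideal (mpol_ring X) S"
    "ideal J (mpol_ring X) \<Longrightarrow> S \<subseteq> J \<Longrightarrow> genideal (mpol_ring X) S \<subseteq> J"
proof -
  interpret R: cring "mpol_ring X :: ('x, 'a) mpol ring" by (rule cring_mpol_ring)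
  show "ideal (genideal (mpol_ring X) S) (mpol_ring X)" by (rule R.genideal_ideal[OF assms])
  show "S \<subseteq> genideal (mpol_ring X) S" by (rule R.genideal_self[OF assms])
  show "ideal J (mpol_ring X) \<Longrightarrow> S \<subseteq> J \<Longrightarrow> genideal (mpol_ring X) S \<subseteq> J" by (rule R.genideal_minimal)
qed

lemma primeideal_mpol_ring_iff:
  fixes P :: "('x, 'a::comm_ring_1) mpol set"
  shows "primeideal P (mpol_ring X) \<longleftrightarrow> ideal P (mpol_ring X) \<and> 1 \<notin> P \<and>
    (\<forall>a\<in>carrier (mpol_ring X). \<forall>b\<in>carrier (mpol_ring X). a * b \<in> P \<longrightarrow> a \<in> P \<or> b \<in> P)"
  (is "_ \<longleftrightarrow> ?r")
proof
  assume P: "primeideal P (mpol_ring X)"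
  then have "ideal P (mpol_ring X)" by (rule primeideal.axioms(1))
  then show ?r
    using primeideal.I_prime[OF P] primeideal.I_notcarr[OF P] ideal_eq_carrier_iff by fastforce
next
  assume r: ?r
  then have "carrier (mpol_ring X) \<noteq> P" using ideal_eq_carrier_iff by blast
  with r show "primeideal P (mpol_ring X)"
    using cring_mpol_ring by (intro primeidealI) auto
qed

section \<open>Forms and monomials of a fixed degree\<close>

lemma formsI:
  "(\<And>t. t \<in> Poly_Mapping.keys p \<Longrightarrow> Poly_Mapping.keys t \<subseteq> {..<m} \<and> mono_deg t = n) \<Longrightarrow> p \<in> forms m n"
  by (auto simp: forms_def poly_ring_def carrier_mpol_ring)

lemma forms_carrier: "forms m n \<subseteq> carrier (mpol_ring {..<m})"
  by (auto simp: forms_def poly_ring_def)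

lemma zero_forms [simp]: "0 \<in> forms m n"
  by (auto intro: formsI)

lemma keys_forms: "p \<in> forms m n \<Longrightarrow> Poly_Mapping.keys p \<subseteq> monomials m n"
  by (auto simp: forms_def poly_ring_def carrier_mpol_ring monomials_def)

lemma mono_forms: "t \<in> monomials m n \<Longrightarrow> Poly_Mapping.single t c \<in> forms m n"
  by (auto simp: monomials_def intro!: formsI split: if_splits)

lemma forms_mult: "p \<in> forms m a \<Longrightarrow> q \<in> forms m b \<Longrightarrow> p * q \<in> forms m (a + b)"
  using keys_mult[of p q] keys_forms[of p m a] keys_forms[of q m b]
  by (intro formsI) (fastforce simp: monomials_def keys_add_nat mono_deg_add)

lemma forms_add: "p \<in> forms m n \<Longrightarrow> q \<in> forms m n \<Longrightarrow> p + q \<in> forms m n"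
  using Poly_Mapping.keys_add[of p q] keys_forms[of p m n] keys_forms[of q m n]
  by (intro formsI) (fastforce simp: monomials_def)

lemma cst_forms: "cst c \<in> forms m 0"
  by (intro formsI) (auto split: if_splits)

lemma subspace_forms: "mpol.subspace (forms m n :: (nat, 'k::field) mpol set)"
  by (intro mpol.subspaceI) (auto intro: forms_add forms_mult[of _ m 0 _ n, simplified] cst_forms)

lemma forms_sum: "(\<And>i. i \<in> A \<Longrightarrow> p i \<in> forms m n) \<Longrightarrow> sum p A \<in> forms m n"
  using mpol.subspace_sum[OF subspace_forms] by blast

lemma finite_monomials [simp]: "finite (monomials m n)"
proof -
  have "monomials m n \<subseteq> (\<lambda>xs. \<Sum>j<m. Poly_Mapping.single j (xs ! j)) ` {xs. set xs \<subseteq> {..n} \<and> length xs = m}"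
  proof
    fix t assume t: "t \<in> monomials m n"
    let ?xs = "map (Poly_Mapping.lookup t) [0..<m]"
    have le: "Poly_Mapping.lookup t j \<le> n" if "j < m" for j
    proof -
      have "n = (\<Sum>j<m. Poly_Mapping.lookup t j)"
        using t by (subst mono_deg_superset[symmetric, of "{..<m}"]) (auto simp: monomials_def)
      with that show ?thesis by (simp add: member_le_sum)
    qed
    have "t = (\<Sum>j<m. Poly_Mapping.single j (?xs ! j))"
      using t mpol_expand[of "{..<m}" t]
      by (simp add: monomials_def)
    with le show "t \<in> (\<lambda>xs. \<Sum>j<m. Poly_Mapping.single j (xs ! j)) ` {xs. set xs \<subseteq> {..n} \<and> length xs = m}"
      by (intro image_eqI[of _ _ ?xs]) auto
  qed
  then show ?thesis
    by (rule finite_subset) (simp add: finite_lists_length_eq)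
qed

lemma forms_expand:
  "p \<in> forms m n \<Longrightarrow> p = (\<Sum>t\<in>monomials m n. cst (Poly_Mapping.lookup p t) * mon t)"
  using mpol_expand[OF finite_monomials keys_forms] by (simp add: cst_mult_mono)

lemma forms_span: "forms m n = mpol.span (mon ` monomials m n :: (nat, 'k::field) mpol set)"
proof
  show "forms m n \<subseteq> mpol.span (mon ` monomials m n :: (nat, 'k) mpol set)"
  proof
    fix p :: "(nat, 'k) mpol"
    assume "p \<in> forms m n"
    then show "p \<in> mpol.span (mon ` monomials m n)"
      by (subst forms_expand) (auto intro!: mpol.span_sum mpol.span_scale[OF mpol.span_base])
  qed
  show "mpol.span (mon ` monomials m n :: (nat, 'k) mpol set) \<subseteq> forms m n"
    by (rule mpol.span_minimal) (auto intro: mono_forms subspace_forms)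
qed

lemma monomials_Suc:
  assumes "t \<in> monomials m (Suc n)"
  obtains j s where "j < m" "s \<in> monomials m n" "t = Poly_Mapping.single j 1 + s"
proof -
  have "mono_deg t \<noteq> 0" using assms by (simp add: monomials_def)
  then obtain j where j: "j \<in> Poly_Mapping.keys t"
    unfolding mono_deg_def by (meson sum.not_neutral_contains_not_neutral)
  define s where "s = t - Poly_Mapping.single j 1"
  have t: "t = Poly_Mapping.single j 1 + s"
    using j by (intro poly_mapping_eqI)
      (auto simp: s_def lookup_add lookup_minus lookup_single when_def in_keys_iff)
  then have "s \<in> monomials m n" "j < m"
    using assms j mono_deg_add[of "Poly_Mapping.single j 1" s]
    by (auto simp: monomials_def keys_add_nat)
  with t that show thesis by blast
qed

abbreviation var :: "nat \<Rightarrow> (nat, 'a::comm_ring_1) mpol"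
  where "var j \<equiv> mon (Poly_Mapping.single j 1)"

lemma var_forms: "j < m \<Longrightarrow> var j \<in> forms m 1"
  by (intro mono_forms) (auto simp: monomials_def)

text \<open>A factorisation with as many factors as the degree lets each variable be taken from its
  own member of a list of ideals, which is how \<open>exists_small_reduction\<close> ends.\<close>

lemma mono_prod_vars:
  fixes t :: "nat monom"
  assumes "t \<in> monomials m n"
  shows "\<exists>xs :: (nat, 'a::comm_ring_1) mpol list.
    length xs = n \<and> set xs \<subseteq> var ` {..<m} \<and> mon t = prod_list xs"
  using assms
proof (induction n arbitrary: t)
  case 0
  then have "t = 0"
    by (auto simp: monomials_def mono_deg_def in_keys_iff intro!: poly_mapping_eqI)
  then show ?case by simp
next
  case (Suc n)
  then obtain j s where js: "j < m" "s \<in> monomials m n" "t = Poly_Mapping.single j 1 + s"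
    by (elim monomials_Suc)
  then obtain xs :: "(nat, 'a) mpol list" where "length xs = n" "set xs \<subseteq> var ` {..<m}" "mon s = prod_list xs"
    using Suc.IH by blast
  moreover have "(mon t :: (nat, 'a) mpol) = var j * mon s"
    by (simp only: js(3) mult_single mult_1_left)
  ultimately show ?case
    using js(1) by (intro exI[of _ "var j # xs"]) auto
qed

section \<open>Homogeneous components and homogeneous ideals\<close>

lemma lookup_hom_component:
  "Poly_Mapping.lookup (hom_component n p) t = (if mono_deg t = n then Poly_Mapping.lookup p t else 0)"
proof -
  have "Poly_Mapping.lookup (hom_component n p) t =
     (\<Sum>s\<in>{s \<in> Poly_Mapping.keys p. mono_deg s = n}. if s = t then Poly_Mapping.lookup p s else 0)"
    unfolding hom_component_def lookup_sum
    by (rule sum.cong) (auto simp: lookup_single when_def)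
  then show ?thesis by (auto simp: in_keys_iff)
qed

lemma hom_component_add: "hom_component n (p + q) = hom_component n p + hom_component n q"
  by (rule poly_mapping_eqI) (simp add: lookup_hom_component lookup_add)

lemma hom_component_zero [simp]: "hom_component n 0 = 0"
  by (rule poly_mapping_eqI) (simp add: lookup_hom_component)

lemma hom_component_sum: "hom_component n (sum p A) = (\<Sum>i\<in>A. hom_component n (p i))"
  by (induction A rule: infinite_finite_induct) (auto simp: hom_component_add)

lemma hom_component_forms:
  "p \<in> carrier (mpol_ring {..<m}) \<Longrightarrow> hom_component n p \<in> forms m n"
  by (intro formsI) (auto simp: in_keys_iff lookup_hom_component carrier_mpol_ring split: if_splits)

lemma hom_component_of_form:
  "p \<in> forms m n \<Longrightarrow> hom_component k p = (if k = n then p else 0)"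
  by (rule poly_mapping_eqI)
     (auto simp: lookup_hom_component in_keys_iff forms_def)

lemma hom_component_expand:
  assumes "\<And>t. t \<in> Poly_Mapping.keys p \<Longrightarrow> mono_deg t \<le> D"
  shows "p = (\<Sum>n\<le>D. hom_component n p)"
proof (rule poly_mapping_eqI)
  fix t
  have "Poly_Mapping.lookup (\<Sum>n\<le>D. hom_component n p) t =
     (\<Sum>n\<le>D. if n = mono_deg t then Poly_Mapping.lookup p t else 0)"
    unfolding lookup_sum by (rule sum.cong) (auto simp: lookup_hom_component)
  also have "\<dots> = Poly_Mapping.lookup p t"
    using assms[of t] by (auto simp: in_keys_iff)
  finally show "Poly_Mapping.lookup p t = Poly_Mapping.lookup (\<Sum>n\<le>D. hom_component n p) t" ..
qed

lemma degree_bound_exists: "\<exists>D. \<forall>t\<in>Poly_Mapping.keys p. mono_deg t \<le> D"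
  by (rule exI[of _ "Max (mono_deg ` Poly_Mapping.keys p)"]) simp

lemma hom_component_form_mult:
  assumes z: "z \<in> forms m e" and q: "q \<in> carrier (mpol_ring {..<m})"
  shows "hom_component n (z * q) = (if e \<le> n then z * hom_component (n - e) q else 0)"
proof -
  obtain D where D: "\<And>t. t \<in> Poly_Mapping.keys q \<Longrightarrow> mono_deg t \<le> D"
    using degree_bound_exists by blast
  \<comment> \<open>The bound is raised to at least \<open>n\<close> so that the index
    \<open>n - e\<close> lies in the summation range.\<close>
  have D': "q = (\<Sum>k\<le>max D n. hom_component k q)"
    using D by (intro hom_component_expand) (simp add: le_max_iff_disj)
  have "hom_component n (z * q) = (\<Sum>k\<le>max D n. hom_component n (z * hom_component k q))"
    by (subst D') (simp add: sum_distrib_left hom_component_sum)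
  also have "\<dots> = (\<Sum>k\<le>max D n. if n = e + k then z * hom_component k q else 0)"
    by (rule sum.cong[OF refl], rule hom_component_of_form[OF forms_mult[OF z hom_component_forms[OF q]]])
  also have "\<dots> = (\<Sum>k\<le>max D n. if k = n - e \<and> e \<le> n then z * hom_component k q else 0)"
    by (rule sum.cong) auto
  also have "\<dots> = (if e \<le> n then z * hom_component (n - e) q else 0)"
    by auto
  finally show ?thesis .
qed

lemma homogeneous_idealD:
  assumes "homogeneous_ideal m J"
  shows "ideal J (mpol_ring {..<m})" "p \<in> J \<Longrightarrow> hom_component n p \<in> J"
  using assms by (auto simp: homogeneous_ideal_def poly_ring_def)

lemma homogeneous_ideal_components:
  assumes "homogeneous_ideal m J"
  shows "p \<in> J \<longleftrightarrow> (\<forall>n. hom_component n p \<in> J)"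
proof
  assume r: "\<forall>n. hom_component n p \<in> J"
  obtain D where "\<And>t. t \<in> Poly_Mapping.keys p \<Longrightarrow> mono_deg t \<le> D"
    using degree_bound_exists by blast
  then have "p = (\<Sum>k\<le>D. hom_component k p)" by (rule hom_component_expand)
  with r ideal_sum[OF homogeneous_idealD(1)[OF assms]] show "p \<in> J" by metis
qed (use homogeneous_idealD(2)[OF assms] in blast)

lemma ideal_zero: "ideal {0} (mpol_ring X)"
  by (auto simp: ideal_mpol_ring_iff)

lemma homogeneous_ideal_zero: "homogeneous_ideal m {0}"
  by (simp add: homogeneous_ideal_def poly_ring_def ideal_zero)

subsection \<open>Adjoining finitely many elements to an ideal\<close>

text \<open>An explicit description of the sum of \<open>J\<close> and the ideal generated by the
  \<open>z i\<close>. Unlike an intersection of ideals it exhibits multipliers, whose homogeneous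
  components can be taken.\<close>

definition adjoin :: "nat \<Rightarrow> (nat, 'k::field) mpol set \<Rightarrow> 'i set \<Rightarrow> ('i \<Rightarrow> (nat, 'k) mpol) \<Rightarrow> (nat, 'k) mpol set"
  where "adjoin m J A z = {p + (\<Sum>i\<in>A. z i * q i) | p q. p \<in> J \<and> (\<forall>i\<in>A. q i \<in> carrier (mpol_ring {..<m}))}"

lemma ideal_adjoin:
  fixes J :: "(nat, 'k::field) mpol set"
  assumes J: "ideal J (mpol_ring {..<m})" and z: "\<And>i. i \<in> A \<Longrightarrow> z i \<in> carrier (mpol_ring {..<m})"
  shows "ideal (adjoin m J A z) (mpol_ring {..<m})"
  unfolding ideal_mpol_ring_iff
proof (intro conjI ballI)
  show "adjoin m J A z \<subseteq> carrier (mpol_ring {..<m})"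
    using z idealD(1)[OF J] by (auto simp: adjoin_def intro!: carrier_closed carrier_sum)
  show "0 \<in> adjoin m J A z"
    using idealD(2)[OF J] by (auto simp: adjoin_def intro!: exI[of _ 0] exI[of _ "\<lambda>_. 0"])
next
  fix p q assume "p \<in> adjoin m J A z" "q \<in> adjoin m J A z"
  then obtain p0 p1 q0 q1 where pq: "p = p0 + (\<Sum>i\<in>A. z i * p1 i)" "q = q0 + (\<Sum>i\<in>A. z i * q1 i)"
    "p0 \<in> J" "q0 \<in> J" "\<forall>i\<in>A. p1 i \<in> carrier (mpol_ring {..<m})" "\<forall>i\<in>A. q1 i \<in> carrier (mpol_ring {..<m})"
    by (auto simp: adjoin_def)
  then have "p + q = (p0 + q0) + (\<Sum>i\<in>A. z i * (p1 i + q1 i))"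
    by (simp add: algebra_simps sum.distrib)
  with pq show "p + q \<in> adjoin m J A z"
    unfolding adjoin_def using idealD(3)[OF J]
    by (intro CollectI exI[of _ "p0 + q0"] exI[of _ "\<lambda>i. p1 i + q1 i"]) (auto intro: carrier_closed)
next
  fix p c :: "(nat, 'k) mpol" assume c: "c \<in> carrier (mpol_ring {..<m})" and "p \<in> adjoin m J A z"
  then obtain p0 p1 where pq: "p = p0 + (\<Sum>i\<in>A. z i * p1 i)"
    "p0 \<in> J" "\<forall>i\<in>A. p1 i \<in> carrier (mpol_ring {..<m})"
    by (auto simp: adjoin_def)
  then have "c * p = c * p0 + (\<Sum>i\<in>A. z i * (c * p1 i))"
    by (simp add: algebra_simps sum_distrib_left)
  with pq c show "c * p \<in> adjoin m J A z"
    unfolding adjoin_def using idealD(4)[OF J]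
    by (intro CollectI exI[of _ "c * p0"] exI[of _ "\<lambda>i. c * p1 i"]) (auto intro: carrier_closed)
qed

lemma adjoin_superset:
  assumes J: "ideal J (mpol_ring {..<m})"
  shows "J \<subseteq> adjoin m J A z" "finite A \<Longrightarrow> i \<in> A \<Longrightarrow> z i \<in> adjoin m J A z"
proof -
  show "J \<subseteq> adjoin m J A z"
    by (auto simp: adjoin_def intro!: exI[of _ "\<lambda>_. 0"])
  assume A: "finite A" "i \<in> A"
  have "z i = 0 + (\<Sum>j\<in>A. z j * (if j = i then 1 else 0))"
    using A by (simp add: if_distrib[of "\<lambda>x. _ * x"] cong: if_cong)
  then show "z i \<in> adjoin m J A z"
    unfolding adjoin_def using idealD(2)[OF J] by fastforce
qed

lemma adjoin_minimal:
  assumes "ideal K (mpol_ring {..<m})" "J \<subseteq> K" "\<And>i. i \<in> A \<Longrightarrow> z i \<in> K"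
  shows "adjoin m J A z \<subseteq> K"
  using assms(2,3) by (auto simp: adjoin_def intro!: idealD(3,5)[OF assms(1)] ideal_sum[OF assms(1)])

lemma adjoin_eq_genideal:
  assumes J: "ideal J (mpol_ring {..<m})" and z: "\<And>i. i \<in> A \<Longrightarrow> z i \<in> carrier (mpol_ring {..<m})"
    and A: "finite A"
  shows "adjoin m J A z = genideal (mpol_ring {..<m}) (J \<union> z ` A)"
proof
  have S: "J \<union> z ` A \<subseteq> carrier (mpol_ring {..<m})" using z idealD(1)[OF J] by auto
  note G = genideal_mpol_ring[OF S]
  show "adjoin m J A z \<subseteq> genideal (mpol_ring {..<m}) (J \<union> z ` A)"
    using G by (intro adjoin_minimal) auto
  show "genideal (mpol_ring {..<m}) (J \<union> z ` A) \<subseteq> adjoin m J A z"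
    using adjoin_superset[OF J] A by (intro G(3) ideal_adjoin[OF J z]) auto
qed

text \<open>Multiplication by a form of degree \<open>e i\<close> shifts components by
  \<open>e i\<close>, so in degree \<open>n\<close> the multipliers become forms of degree
  \<open>n - e i\<close>. When \<open>e i > n\<close> the component is 0; a separate clause records
  this, because truncated subtraction would otherwise allow a constant multiplier.\<close>

lemma adjoin_component:
  assumes J: "homogeneous_ideal m J" and z: "\<And>i. i \<in> A \<Longrightarrow> z i \<in> forms m (e i)"
    and p: "p \<in> adjoin m J A z"
  obtains p0 q where "p0 \<in> J" "p0 \<in> forms m n"
    "\<And>i. i \<in> A \<Longrightarrow> e i \<le> n \<Longrightarrow> q i \<in> forms m (n - e i)"
    "\<And>i. i \<in> A \<Longrightarrow> \<not> e i \<le> n \<Longrightarrow> q i = 0"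
    "hom_component n p = p0 + (\<Sum>i\<in>A. z i * q i)"
proof -
  obtain p1 r where pr: "p = p1 + (\<Sum>i\<in>A. z i * r i)"
    "p1 \<in> J" "\<forall>i\<in>A. r i \<in> carrier (mpol_ring {..<m})"
    using p by (auto simp: adjoin_def)
  have "hom_component n p1 \<in> J" "hom_component n p1 \<in> forms m n"
    using homogeneous_idealD[OF J] pr(2) idealD(1) hom_component_forms by blast+
  moreover have "hom_component n p = hom_component n p1 +
     (\<Sum>i\<in>A. z i * (if e i \<le> n then hom_component (n - e i) (r i) else 0))"
    unfolding pr(1) hom_component_add hom_component_sum
    using hom_component_form_mult[OF z] pr(3)
    by (intro arg_cong2[of _ _ _ _ "(+)"] sum.cong refl) (simp add: if_distrib[of "\<lambda>x. _ * x"])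
  ultimately show thesis
    using that[of "hom_component n p1" "\<lambda>i. if e i \<le> n then hom_component (n - e i) (r i) else 0"]
      pr(3) hom_component_forms by auto
qed

lemma homogeneous_adjoin:
  assumes J: "homogeneous_ideal m J" and z: "\<And>i. i \<in> A \<Longrightarrow> z i \<in> forms m (e i)"
  shows "homogeneous_ideal m (adjoin m J A z)"
  unfolding homogeneous_ideal_def poly_ring_def
proof (intro conjI ballI allI)
  show "ideal (adjoin m J A z) (mpol_ring {..<m})"
    using homogeneous_idealD[OF J] z forms_carrier by (intro ideal_adjoin) blast+
next
  fix p n assume "p \<in> adjoin m J A z"
  then obtain p0 q where *: "p0 \<in> J" "p0 \<in> forms m n"
    "\<And>i. i \<in> A \<Longrightarrow> e i \<le> n \<Longrightarrow> q i \<in> forms m (n - e i)"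
    "\<And>i. i \<in> A \<Longrightarrow> \<not> e i \<le> n \<Longrightarrow> q i = 0"
    "hom_component n p = p0 + (\<Sum>i\<in>A. z i * q i)"
    by (rule adjoin_component[where n = n and e = e, OF J z, rotated]) blast+
  have "q i \<in> carrier (mpol_ring {..<m})" if "i \<in> A" for i
    using *(3,4)[OF that] forms_carrier by (cases "e i \<le> n") auto
  with * show "hom_component n p \<in> adjoin m J A z"
    unfolding adjoin_def by blast
qed

text \<open>Each monomial of degree \<open>Suc n\<close> is a variable times one of degree
  \<open>n\<close>. Hence a condition on all large degrees can be replaced by a condition on one
  degree.\<close>

lemma forms_subset_Suc:
  fixes J :: "(nat, 'k::field) mpol set"
  assumes J: "ideal J (mpol_ring {..<m})" and f: "forms m n \<subseteq> J"
  shows "forms m (Suc n) \<subseteq> J"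
proof
  fix p :: "(nat, 'k) mpol" assume "p \<in> forms m (Suc n)"
  then have "p = (\<Sum>t\<in>monomials m (Suc n). cst (Poly_Mapping.lookup p t) * mon t)"
    by (rule forms_expand)
  moreover have "(mon t :: (nat, 'k) mpol) \<in> J" if t: "t \<in> monomials m (Suc n)" for t
  proof -
    obtain j s where js: "j < m" "s \<in> monomials m n" "t = Poly_Mapping.single j 1 + s"
      using t by (rule monomials_Suc)
    have "var j * mon s \<in> J"
      using js f mono_forms[OF js(2), of 1] var_forms[OF js(1)] forms_carrier
      by (intro idealD(4)[OF J]) auto
    then show ?thesis by (simp add: js mult_single)
  qed
  ultimately show "p \<in> J"
    using ideal_sum[OF J] idealD(4)[OF J] by (metis (no_types, lifting) carrier_basic(3))
qed

lemma forms_subset_mono: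
  assumes J: "ideal J (mpol_ring {..<m})" and f: "forms m n \<subseteq> J" and "n \<le> k"
  shows "forms m k \<subseteq> J"
  using \<open>n \<le> k\<close> by (induction rule: dec_induct) (use f forms_subset_Suc[OF J] in blast)+

section \<open>Noetherianity of polynomial rings\<close>

lemma lookup_mult_single:
  "Poly_Mapping.lookup (p * Poly_Mapping.single u c) t =
     (\<Sum>s\<in>Poly_Mapping.keys p. if s + u = t then Poly_Mapping.lookup p s * c else 0)"
proof -
  have "p * Poly_Mapping.single u c =
      (\<Sum>s\<in>Poly_Mapping.keys p. Poly_Mapping.single (s + u) (Poly_Mapping.lookup p s * c))"
    by (subst mpol_expand[of "Poly_Mapping.keys p" p]) (simp_all add: sum_distrib_right mult_single)
  then show ?thesis by (simp add: lookup_sum lookup_single when_def)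
qed

lemma lookup_mult_single_shift:
  fixes p :: "('x, 'a::comm_ring_1) mpol"
  shows "Poly_Mapping.lookup (p * Poly_Mapping.single u c) (s + u) = Poly_Mapping.lookup p s * c"
  by (auto simp: lookup_mult_single in_keys_iff)

lemma incseq_subseq_nat:
  fixes s :: "nat \<Rightarrow> nat"
  obtains r where "strict_mono r" "incseq (s \<circ> r)"
proof -
  obtain g where g: "strict_mono g" "monoseq (s \<circ> g)"
    using seq_monosub[of s] by (auto simp: comp_def)
  then consider "incseq (s \<circ> g)" | "decseq (s \<circ> g)" by (auto simp: monoseq_iff)
  then show thesis
  proof cases
    case 1 with g that show ?thesis by blast
  next
    case 2
    \<comment> \<open>A decreasing sequence of naturals attains its minimum and is constant from
      there on, so its tail is also weakly increasing.\<close>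
    have "\<exists>N. \<forall>i. s (g N) \<le> s (g i)"
      using ex_has_least_nat[of "\<lambda>_. True" _ "\<lambda>i. s (g i)"] by auto
    then obtain N where N: "\<And>i. s (g N) \<le> s (g i)" by blast
    have "s (g (N + i)) = s (g N)" for i
      using N[of "N + i"] decseqD[OF 2, of N "N + i"] by (auto simp: comp_def)
    then have "incseq (s \<circ> (\<lambda>i. g (N + i)))" by (simp add: incseq_def)
    moreover have "strict_mono (\<lambda>i. g (N + i))"
      using g(1) by (simp add: strict_mono_def)
    ultimately show ?thesis using that by blast
  qed
qed

text \<open>One variable of \<open>X\<close> is treated at a time by passing to a further
  subsequence; monotonicity already achieved in the other variables survives this.\<close>

lemma dickson:
  fixes s :: "nat \<Rightarrow> 'x monom"
  assumes "finite X"
  obtains r where "strict_mono r" "\<And>x. x \<in> X \<Longrightarrow> incseq (\<lambda>i. Poly_Mapping.lookup (s (r i)) x)"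
proof -
  have "\<exists>r. strict_mono r \<and> (\<forall>x\<in>X. incseq (\<lambda>i. Poly_Mapping.lookup (s (r i)) x))"
    using assms
  proof induction
    case empty
    then show ?case using strict_mono_id by blast
  next
    case (insert y X)
    then obtain r where r: "strict_mono r" "\<forall>x\<in>X. incseq (\<lambda>i. Poly_Mapping.lookup (s (r i)) x)" by blast
    obtain r' where r': "strict_mono r'" "incseq ((\<lambda>i. Poly_Mapping.lookup (s (r i)) y) \<circ> r')"
      by (rule incseq_subseq_nat)
    have "incseq (\<lambda>i. Poly_Mapping.lookup (s ((r \<circ> r') i)) x)" if "x \<in> insert y X" for x
      using that r r' strict_mono_mono[OF r'(1)] by (auto simp: incseq_def comp_def monoD)
    with strict_mono_o[OF r(1) r'(1)] show ?case by blast
  qed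
  with that show thesis by blast
qed

lemma dickson_pair:
  fixes s :: "nat \<Rightarrow> 'x monom"
  assumes "finite X" "\<And>i. Poly_Mapping.keys (s i) \<subseteq> X"
  obtains i j u where "i < j" "s j = s i + u" "Poly_Mapping.keys u \<subseteq> X"
proof -
  obtain r where r: "strict_mono r" "\<And>x. x \<in> X \<Longrightarrow> incseq (\<lambda>i. Poly_Mapping.lookup (s (r i)) x)"
    using dickson[OF assms(1)] by blast
  have le: "Poly_Mapping.lookup (s (r 0)) x \<le> Poly_Mapping.lookup (s (r 1)) x" for x
  proof (cases "x \<in> X")
    case True
    with r(2)[OF True] show ?thesis by (simp add: incseq_def)
  next
    case False
    then have "Poly_Mapping.lookup (s (r 0)) x = 0" using assms(2)[of "r 0"] by (auto simp: in_keys_iff)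
    then show ?thesis by simp
  qed
  have eq: "s (r 1) = s (r 0) + (s (r 1) - s (r 0))"
    using le by (intro poly_mapping_eqI) (simp add: lookup_add lookup_minus)
  moreover have "Poly_Mapping.keys (s (r 1) - s (r 0)) \<subseteq> X"
    using assms(2)[of "r 1"] by (subst (asm) eq) (simp add: keys_add_nat)
  moreover have "r 0 < r 1" using r(1) by (simp add: strict_mono_def)
  ultimately show thesis using that by blast
qed

text \<open>Monomials are compared at the smallest indeterminate where their exponents differ, and
  there a nonzero \<open>u\<close> exceeds 0. So a multiple of a monomial is never smaller than the
  monomial.\<close>

lemma monom_nonneg: "0 \<le> (u :: 'x::linorder monom)"
proof (cases "u = 0")
  case False
  then have ne: "Poly_Mapping.keys u \<noteq> {}" by simp
  let ?k = "Min (Poly_Mapping.keys u)"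
  have "Poly_Mapping.lookup u ?k \<noteq> 0"
    using Min_in[OF finite_keys ne] by (simp add: in_keys_iff)
  moreover have "Poly_Mapping.lookup u k = 0" if "k < ?k" for k
  proof (rule ccontr)
    assume "Poly_Mapping.lookup u k \<noteq> 0"
    then have "?k \<le> k" by (intro Min_le) (auto simp: in_keys_iff)
    with that show False by simp
  qed
  ultimately have "less_fun (Poly_Mapping.lookup 0) (Poly_Mapping.lookup u)"
    unfolding less_fun_def by (intro exI[of _ ?k]) simp
  then show ?thesis by (simp add: less_poly_mapping.rep_eq less_imp_le)
qed simp

text \<open>In an infinite descent Dickson's lemma finds an earlier monomial dividing a later one,
  which makes the later one at least as large. With infinitely many variables the claim can fail:
  over the naturals x_0 > x_1 > x_2 > ... descends forever.\<close>

lemma wf_monoms: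
  assumes "finite (X :: 'x::linorder set)"
  shows "wf {(s, t). s < t \<and> Poly_Mapping.keys s \<subseteq> X \<and> Poly_Mapping.keys (t :: 'x monom) \<subseteq> X}"
  unfolding wf_iff_no_infinite_down_chain
proof clarify
  fix f :: "nat \<Rightarrow> 'x monom"
  assume "\<forall>i. (f (Suc i), f i) \<in> {(s, t). s < t \<and> Poly_Mapping.keys s \<subseteq> X \<and> Poly_Mapping.keys t \<subseteq> X}"
  then have f: "f (Suc i) < f i" "Poly_Mapping.keys (f i) \<subseteq> X" for i by auto
  obtain i j u where iju: "i < j" "f j = f i + u" "Poly_Mapping.keys u \<subseteq> X"
    by (rule dickson_pair[of X f, OF assms f(2)])
  have "f j < f i" using iju(1) f(1) by (induction rule: less_Suc_induct) auto
  moreover have "f i \<le> f j" using add_left_mono[OF monom_nonneg[of u], of "f i"] iju(2) by simp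
  ultimately show False by simp
qed

text \<open>In each difference of consecutive ideals choose an element with least leading monomial; by
  Dickson's lemma one of them could be reduced by an earlier one.\<close>

lemma no_ascending_chain_of_ideals:
  fixes J :: "nat \<Rightarrow> ('x::linorder, 'k::field) mpol set"
  assumes X: "finite X" and J: "\<And>i. ideal (J i) (mpol_ring X)" and asc: "\<And>i. J i \<subset> J (Suc i)"
  shows False
proof -
  define lead where "lead p = Max (Poly_Mapping.keys p)" for p :: "('x, 'k) mpol"
  have incl: "J i \<subseteq> J j" if "i \<le> j" for i j
    by (rule lift_Suc_mono_le[of J, OF psubset_imp_subset[OF asc] that])
  have lead: "lead p \<in> Poly_Mapping.keys p" "Poly_Mapping.keys (lead p) \<subseteq> X" if "p \<in> J j - J i" for p i j
  proof -
    have "p \<noteq> 0" using that idealD(2)[OF J] by auto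
    then show "lead p \<in> Poly_Mapping.keys p" unfolding lead_def by (intro Max_in) auto
    then show "Poly_Mapping.keys (lead p) \<subseteq> X"
      using that idealD(1)[OF J] by (auto simp: carrier_mpol_ring)
  qed
  have "\<exists>p. p \<in> J (Suc i) - J i \<and> (\<forall>q \<in> J (Suc i) - J i. \<not> lead q < lead p)" for i
  proof -
    let ?D = "lead ` (J (Suc i) - J i)"
    obtain x where "x \<in> ?D" using asc[of i] by blast
    then obtain t where t: "t \<in> ?D" and
      t_min: "\<And>s. (s, t) \<in> {(s, t). s < t \<and> Poly_Mapping.keys s \<subseteq> X \<and> Poly_Mapping.keys t \<subseteq> X} \<Longrightarrow> s \<notin> ?D"
      by (rule wfE_min[OF wf_monoms[OF X]]) (rule that)
    from t obtain p where p: "p \<in> J (Suc i) - J i" "t = lead p" by blast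
    have "\<not> lead q < lead p" if q: "q \<in> J (Suc i) - J i" for q
      using t_min[of "lead q"] lead(2)[OF p(1)] lead(2)[OF q] q p(2) by auto
    with p(1) show ?thesis by blast
  qed
  then obtain p where p: "\<And>i. p i \<in> J (Suc i) - J i"
    and least: "\<And>i q. q \<in> J (Suc i) - J i \<Longrightarrow> \<not> lead q < lead (p i)" by metis
  obtain i j u where iju: "i < j" "lead (p j) = lead (p i) + u" "Poly_Mapping.keys u \<subseteq> X"
    by (rule dickson_pair[of X "\<lambda>i. lead (p i)", OF X lead(2)[OF p]])
  \<comment> \<open>A multiple of the earlier element cancels the leading term of
    \<open>p j\<close>. As \<open>r\<close> lies in \<open>J (Suc i)\<close> and hence in
    \<open>J j\<close>, the difference stays outside \<open>J j\<close>, so its smaller leading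
    monomial contradicts the choice of \<open>p j\<close>.\<close>
  define c where "c = Poly_Mapping.lookup (p j) (lead (p j)) / Poly_Mapping.lookup (p i) (lead (p i))"
  define r where "r = p i * Poly_Mapping.single u c"
  define q where "q = p j - r"
  have "r \<in> J (Suc i)"
    unfolding r_def using p[of i] iju(3) by (intro idealD(5)[OF J] single_in_carrier) auto
  then have r: "r \<in> J j" "r \<in> J (Suc j)" using incl[of "Suc i" j] incl[of "Suc i" "Suc j"] iju(1) by auto
  have "q \<in> J (Suc j)" using p[of j] r by (auto simp: q_def intro: idealD(7)[OF J])
  moreover have "q \<notin> J j"
  proof
    assume "q \<in> J j"
    then have "q + r \<in> J j" using r(1) by (rule idealD(3)[OF J])
    then show False using p[of j] by (simp add: q_def)
  qed
  ultimately have q: "q \<in> J (Suc j) - J j" by blast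
  have "Poly_Mapping.lookup (p i) (lead (p i)) \<noteq> 0" using lead(1)[OF p] by (simp add: in_keys_iff)
  then have "Poly_Mapping.lookup q (lead (p j)) = 0"
    unfolding q_def r_def iju(2) lookup_minus lookup_mult_single_shift by (simp add: c_def iju(2))
  moreover have "t \<le> lead (p j)" if t: "t \<in> Poly_Mapping.keys q" for t
  proof -
    have "t \<in> Poly_Mapping.keys (p j) \<or> t \<in> Poly_Mapping.keys r"
      using t Poly_Mapping.keys_diff[of "p j" r] unfolding q_def by (auto simp: in_keys_iff lookup_minus)
    then show ?thesis
    proof
      assume "t \<in> Poly_Mapping.keys r"
      then obtain s where "s \<in> Poly_Mapping.keys (p i)" "t = s + u"
        using keys_mult[of "p i" "Poly_Mapping.single u c"] unfolding r_def by (auto split: if_splits)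
      then show ?thesis unfolding iju(2) by (auto simp: lead_def intro: add_right_mono)
    qed (simp add: lead_def)
  qed
  ultimately have "lead q < lead (p j)"
    using lead(1)[OF q] by (metis in_keys_iff order_le_less)
  with least[OF q] show False by blast
qed

text \<open>Larger ideals come lower in this relation, so induction along it is noetherian
  induction: a claim may be assumed for all strictly larger ideals.\<close>

lemma wf_ideals:
  assumes "finite (X :: 'x::linorder set)"
  shows "wf {(K, J :: ('x, 'k::field) mpol set). ideal J (mpol_ring X) \<and> ideal K (mpol_ring X) \<and> J \<subset> K}"
  unfolding wf_iff_no_infinite_down_chain
proof clarify
  fix f :: "nat \<Rightarrow> ('x, 'k) mpol set"
  assume f: "\<forall>i. (f (Suc i), f i) \<in>
    {(K, J). ideal J (mpol_ring X) \<and> ideal K (mpol_ring X) \<and> J \<subset> K}"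
  show False by (rule no_ascending_chain_of_ideals[OF assms, of f]) (use f in auto)
qed

text \<open>Infinitely many jumps could be enumerated into a strictly ascending chain. It is applied
  to the indeterminates u_ij, whose index pairs are ordered lexicographically.\<close>

lemma finite_jumps_of_ideals:
  fixes J :: "nat \<Rightarrow> ('x::linorder, 'k::field) mpol set"
  assumes X: "finite X" and J: "\<And>i. ideal (J i) (mpol_ring X)" and asc: "\<And>i. J i \<subseteq> J (Suc i)"
  shows "finite {i. J i \<noteq> J (Suc i)}" (is "finite ?T")
proof (rule ccontr)
  assume inf: "infinite ?T"
  let ?e = "enumerate ?T"
  have "J (?e i) \<subset> J (?e (Suc i))" for i
  proof -
    have "J (?e i) \<subset> J (Suc (?e i))" using enumerate_in_set[OF inf, of i] asc by blast
    also have "\<dots> \<subseteq> J (?e (Suc i))"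
      using enumerate_step[OF inf, of i] by (intro lift_Suc_mono_le[of J, OF asc]) auto
    finally show ?thesis .
  qed
  then show False using no_ascending_chain_of_ideals[OF X J, of ?e] by blast
qed

section \<open>The dimension is at most the number of generators of a reduction\<close>

text \<open>Gaussian elimination: a member \<open>b j\<close> that involves the generator
  \<open>s\<close> serves as pivot and removes \<open>s\<close> from the others, and both counts
  drop by one. The span of \<open>S \<union> V\<close> stands in for a quotient by \<open>V\<close>,
  and indexing by \<open>T\<close> makes a repeated vector count as a dependence.\<close>

lemma dependent_modulo:
  fixes b :: "'i \<Rightarrow> ('x, 'k::field) mpol"
  assumes "finite S" "mpol.subspace V" "finite T" "card S < card T" "\<And>i. i \<in> T \<Longrightarrow> b i \<in> mpol.span (S \<union> V)"
  shows "\<exists>c. (\<exists>i\<in>T. c i \<noteq> 0) \<and> (\<Sum>i\<in>T. cst (c i) * b i) \<in> V"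
  using assms(1,3-5)
proof (induction S arbitrary: T b)
  case empty
  then obtain i where "i \<in> T" by fastforce
  have "(\<Sum>j\<in>T. cst (if j = i then 1 else 0) * b j) = (\<Sum>j\<in>T. if j = i then b i else 0)"
    by (rule sum.cong) auto
  also have "\<dots> = b i" using \<open>i \<in> T\<close> empty.prems(1) by simp
  also have "\<dots> \<in> V" using empty.prems(3)[OF \<open>i \<in> T\<close>] assms(2) by (metis Un_empty_left mpol.span_eq_iff)
  finally show ?case using \<open>i \<in> T\<close> by (intro exI[of _ "\<lambda>j. if j = i then 1 else 0"]) auto
next
  case (insert s S)
  have "\<exists>k. b i - cst k * s \<in> mpol.span (S \<union> V)" if "i \<in> T" for i
    using insert.prems(3)[OF that] mpol.span_breakdown_eq[of "b i" s "S \<union> V"] by simp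
  then obtain k where k: "\<And>i. i \<in> T \<Longrightarrow> b i - cst (k i) * s \<in> mpol.span (S \<union> V)" by metis
  show ?case
  proof (cases "\<forall>i\<in>T. k i = 0")
    case True
    have "\<exists>c. (\<exists>i\<in>T. c i \<noteq> 0) \<and> (\<Sum>i\<in>T. cst (c i) * b i) \<in> V"
      by (rule insert.IH) (use insert k True in force)+
    then show ?thesis .
  next
    case False
    then obtain j where j: "j \<in> T" "k j \<noteq> 0" by blast
    let ?b = "\<lambda>i. b i - cst (k i / k j) * b j"
    have "?b i \<in> mpol.span (S \<union> V)" if "i \<in> T - {j}" for i
    proof -
      have "(b i - cst (k i) * s) - cst (k i / k j) * (b j - cst (k j) * s) \<in> mpol.span (S \<union> V)"
        using that j(1) by (intro mpol.span_diff mpol.span_scale k) auto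
      moreover have "cst (k i / k j) * (cst (k j) * s) = cst (k i) * s"
        using j(2) by (simp add: mult_single flip: mult.assoc)
      ultimately show ?thesis using j(2) by (simp add: right_diff_distrib)
    qed
    then have "\<exists>c. (\<exists>i\<in>T-{j}. c i \<noteq> 0) \<and> (\<Sum>i\<in>T-{j}. cst (c i) * ?b i) \<in> V"
      using insert.prems(1,2) insert.hyps j by (intro insert.IH) auto
    then obtain c i where c: "i \<in> T - {j}" "c i \<noteq> 0" "(\<Sum>i\<in>T-{j}. cst (c i) * ?b i) \<in> V" by blast
    \<comment> \<open>The coefficient of the pivot \<open>b j\<close> collects what the elimination
      subtracted from all the other members.\<close>
    define r where "r = - (\<Sum>i\<in>T-{j}. c i * (k i / k j))"
    have "(\<Sum>i\<in>T-{j}. cst (c i) * ?b i) = (\<Sum>i\<in>T-{j}. cst (c i) * b i) + cst r * b j"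
    proof -
      have "cst (\<Sum>i\<in>T-{j}. c i * (k i / k j)) * b j = (\<Sum>i\<in>T-{j}. cst (c i * (k i / k j)) * b j)"
        by (rule mpol.scale_sum_left)
      then show ?thesis
        by (simp add: r_def algebra_simps sum_subtractf mult_single single_uminus flip: mult.assoc)
    qed
    also have "\<dots> = (\<Sum>i\<in>T. cst ((c(j := r)) i) * b i)"
      using j(1) insert.prems(1) by (simp add: sum.remove[of T j])
    finally show ?thesis using c by (intro exI[of _ "c(j := r)"]) auto
  qed
qed

lemma prime_power_notin:
  assumes P: "primeideal P (mpol_ring X)" and y: "y \<in> carrier (mpol_ring X)" "y \<notin> P"
  shows "y ^ a \<in> carrier (mpol_ring X) \<and> y ^ a \<notin> P"
proof (induction a)
  case (Suc a)
  with P y show ?case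
    unfolding primeideal_mpol_ring_iff by (auto intro: carrier_closed)
qed (use P primeideal_mpol_ring_iff in auto)

text \<open>A box of exponent vectors instead of a bound on the total degree: its size is an exact
  power, so the later growth estimate compares plain powers.\<close>

definition exponents :: "nat \<Rightarrow> nat \<Rightarrow> nat list set"
  where "exponents N n = {xs. set xs \<subseteq> {..N} \<and> length xs = n}"

definition power_product :: "'a::comm_monoid_mult list \<Rightarrow> nat list \<Rightarrow> 'a"
  where "power_product ys xs = prod_list (map2 (^) ys xs)"

lemma finite_exponents: "finite (exponents N n)"
  by (simp add: exponents_def finite_lists_length_eq)

lemma card_exponents: "card (exponents N n) = Suc N ^ n"
  by (simp add: exponents_def card_lists_length_eq)

lemma sum_exponents_Suc:
  "(\<Sum>xs\<in>exponents N (Suc n). g xs) = (\<Sum>a\<le>N. \<Sum>xs\<in>exponents N n. g (a # xs))"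
proof -
  have *: "exponents N (Suc n) = (\<lambda>(a, xs). a # xs) ` ({..N} \<times> exponents N n)"
    by (auto simp: exponents_def length_Suc_conv image_iff)
  show ?thesis
    unfolding * by (subst sum.reindex) (auto simp: inj_on_def sum.cartesian_product case_prod_beta)
qed

lemma power_product_carrier:
  assumes "set ys \<subseteq> carrier (mpol_ring X)"
  shows "power_product ys xs \<in> carrier (mpol_ring X)"
proof -
  have pow: "y ^ a \<in> carrier (mpol_ring X)" if "y \<in> carrier (mpol_ring X)" for y :: "('a, 'b) mpol" and a
    using that by (induction a) (auto intro: carrier_closed)
  show ?thesis
    using assms unfolding power_product_def
  proof (induction ys xs rule: list_induct2')
    case (4 y ys x xs)
    then show ?case by (auto intro: carrier_closed pow)
  qed auto
qed

text \<open>Elements picked from the successive differences of a chain of primes are algebraically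
  independent modulo the smallest prime.\<close>

lemma prime_chain_independent:
  fixes P :: "nat \<Rightarrow> ('x, 'k::field) mpol set"
  assumes "\<And>i. i \<le> n \<Longrightarrow> primeideal (P i) (mpol_ring X)" "\<And>i. i < n \<Longrightarrow> P i \<subset> P (Suc i)"
  shows "\<exists>ys. length ys = n \<and> set ys \<subseteq> carrier (mpol_ring X) \<and>
    (\<forall>N c. (\<Sum>xs\<in>exponents N n. cst (c xs) * power_product ys xs) \<in> P 0 \<longrightarrow>
      (\<forall>xs\<in>exponents N n. c xs = 0))"
  using assms
proof (induction n arbitrary: P)
  case 0
  then have P: "ideal (P 0) (mpol_ring X)" "1 \<notin> P 0" by (auto simp: primeideal_mpol_ring_iff)
  have "x = 0" if "cst x \<in> P 0" for x
  proof (rule ccontr)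
    assume "x \<noteq> 0"
    moreover have "cst (inverse x) * cst x \<in> P 0" using that by (intro idealD(4)[OF P(1)]) auto
    ultimately show False using P(2) by (simp add: mult_single)
  qed
  moreover have "exponents N 0 = {[]}" for N by (auto simp: exponents_def)
  ultimately show ?case by (auto simp: power_product_def)
next
  case (Suc n)
  have "\<exists>ys. length ys = n \<and> set ys \<subseteq> carrier (mpol_ring X) \<and>
    (\<forall>N c. (\<Sum>xs\<in>exponents N n. cst (c xs) * power_product ys xs) \<in> (P \<circ> Suc) 0 \<longrightarrow>
      (\<forall>xs\<in>exponents N n. c xs = 0))"
    using Suc.prems by (intro Suc.IH) auto
  then obtain ys where ys: "length ys = n" "set ys \<subseteq> carrier (mpol_ring X)"
    and indep: "\<And>N c xs. (\<Sum>xs\<in>exponents N n. cst (c xs) * power_product ys xs) \<in> P 1 \<Longrightarrow>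
      xs \<in> exponents N n \<Longrightarrow> c xs = 0"
    by auto
  have P0: "primeideal (P 0) (mpol_ring X)" and P1: "ideal (P 1) (mpol_ring X)" and sub: "P 0 \<subseteq> P 1"
    using Suc.prems by (auto simp: primeideal_mpol_ring_iff less_imp_le)
  then have iP0: "ideal (P 0) (mpol_ring X)" by (simp add: primeideal_mpol_ring_iff)
  \<comment> \<open>The new element vanishes modulo \<open>P 1\<close>, where the \<open>ys\<close>
    are independent by the induction hypothesis, but not modulo \<open>P 0\<close>.\<close>
  obtain y where y: "y \<in> P 1" "y \<notin> P 0" using Suc.prems(2)[of 0] by auto
  then have yc: "y \<in> carrier (mpol_ring X)" using idealD(1)[OF P1] by auto
  have "c xs = 0"
    if rel: "(\<Sum>xs\<in>exponents N (Suc n). cst (c xs) * power_product (y # ys) xs) \<in> P 0"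
      and xs: "xs \<in> exponents N (Suc n)" for N c xs
  proof -
    define G where "G a = (\<Sum>xs\<in>exponents N n. cst (c (a # xs)) * power_product ys xs)" for a
    have G: "G a \<in> carrier (mpol_ring X)" for a
      unfolding G_def using power_product_carrier[OF ys(2)]
      by (intro carrier_sum carrier_closed) auto
    have sumG: "(\<Sum>a\<le>N. y ^ a * G a) \<in> P 0"
      using rel by (simp add: sum_exponents_Suc G_def power_product_def sum_distrib_left mult_ac)
    \<comment> \<open>The coefficients of the powers of \<open>y\<close> are killed from the lowest
      up. Once the lower ones are 0, primality of \<open>P 0\<close> cancels \<open>y ^ a\<close>;
      what is left is \<open>G a\<close> plus a multiple of \<open>y\<close>, so \<open>G a\<close>
      lies in \<open>P 1\<close> and independence modulo \<open>P 1\<close> applies.\<close>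
    have coeff: "a \<le> N \<Longrightarrow> \<forall>xs\<in>exponents N n. c (a # xs) = 0" for a
    proof (induction a rule: less_induct)
      case (less a)
      have zero: "G a' = 0" if "a' < a" for a'
        unfolding G_def using less.IH[OF that] less.prems that by (intro sum.neutral) auto
      let ?r = "\<Sum>a'\<in>{a<..N}. y ^ (a' - a - 1) * G a'"
      have pow: "y ^ a' \<in> carrier (mpol_ring X)" for a'
        using prime_power_notin[OF P0 yc y(2)] by blast
      have r: "?r \<in> carrier (mpol_ring X)"
        using G pow by (intro carrier_sum carrier_closed) auto
      have "(\<Sum>a'\<le>N. y ^ a' * G a') = (\<Sum>a'\<in>{a..N}. y ^ a' * G a')"
        using zero by (intro sum.mono_neutral_right) auto
      also have "\<dots> = y ^ a * G a + (\<Sum>a'\<in>{a<..N}. y ^ a' * G a')"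
        using less.prems by (simp add: sum.head)
      also have "(\<Sum>a'\<in>{a<..N}. y ^ a' * G a') = y ^ a * (y * ?r)"
        unfolding sum_distrib_left
      proof (rule sum.cong)
        fix a' assume "a' \<in> {a<..N}"
        then have "y ^ a' = y ^ a * (y * y ^ (a' - a - 1))"
          by (simp flip: power_add power_Suc)
        then show "y ^ a' * G a' = y ^ a * (y * (y ^ (a' - a - 1) * G a'))" by (simp add: mult_ac)
      qed simp
      finally have "y ^ a * (G a + y * ?r) \<in> P 0" using sumG by (simp add: distrib_left)
      moreover have "G a + y * ?r \<in> carrier (mpol_ring X)"
        using G r yc by (intro carrier_closed) auto
      ultimately have "G a + y * ?r \<in> P 0"
        using prime_power_notin[OF P0 yc y(2), of a] P0 unfolding primeideal_mpol_ring_iff by blast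
      then have "G a + y * ?r - y * ?r \<in> P 1"
        using sub y(1) r by (intro idealD(7)[OF P1] idealD(5)[OF P1]) auto
      then have "G a \<in> P 1" by simp
      then show ?case
        unfolding G_def using indep[where c = "\<lambda>xs. c (a # xs)"] by blast
    qed
    obtain a xs' where "xs = a # xs'" "a \<le> N" "xs' \<in> exponents N n"
      using xs by (cases xs) (auto simp: exponents_def)
    with coeff show ?thesis by blast
  qed
  with ys yc show ?case by (intro exI[of _ "y # ys"]) auto
qed

section \<open>Growth of the quotient with the degree\<close>

definition deg_le :: "nat \<Rightarrow> ('x, 'a::comm_ring_1) mpol \<Rightarrow> bool"
  where "deg_le D p \<longleftrightarrow> (\<forall>t\<in>Poly_Mapping.keys p. mono_deg t \<le> D)"

lemma deg_le_mult: "deg_le D p \<Longrightarrow> deg_le E q \<Longrightarrow> deg_le (D + E) (p * q)"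
  using keys_mult[of p q] by (fastforce simp: deg_le_def mono_deg_add intro: add_mono)

lemma deg_le_one: "deg_le 0 1"
  by (simp add: deg_le_def)

lemma deg_le_power: "deg_le D p \<Longrightarrow> deg_le (D * a) (p ^ a)"
  by (induction a) (auto simp: deg_le_one intro: deg_le_mult)

lemma deg_le_mono: "deg_le D p \<Longrightarrow> D \<le> E \<Longrightarrow> deg_le E p"
  by (auto simp: deg_le_def)

lemma deg_le_power_product:
  assumes "\<And>y. y \<in> set ys \<Longrightarrow> deg_le D y" "set xs \<subseteq> {..N}"
  shows "deg_le (D * N * length ys) (power_product ys xs)"
  using assms unfolding power_product_def
proof (induction ys xs rule: list_induct2')
  case (4 y ys x xs)
  have "deg_le (D * N + D * N * length ys) (y ^ x * prod_list (map2 (^) ys xs))"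
    using 4 by (intro deg_le_mult deg_le_mono[OF deg_le_power[of D y x]]) auto
  then show ?case by simp
qed (auto intro: deg_le_mono[OF deg_le_one])

text \<open>From degree \<open>n0\<close> on, a form is modulo \<open>I\<close> a combination of the
  \<open>z i\<close> with multipliers one degree lower. Repeating this until the degree falls below
  \<open>n0\<close> leaves products of powers of the \<open>z i\<close> with monomials of degree
  below \<open>n0\<close>. Bounding each exponent separately keeps \<open>W M\<close> easy to
  count.\<close>

lemma forms_growth:
  fixes I :: "(nat, 'k::field) mpol set"
  assumes I: "homogeneous_ideal m I" and A: "finite A" and z: "\<And>i. i \<in> A \<Longrightarrow> z i \<in> forms m 1"
    and red: "forms m n0 \<subseteq> adjoin m I A z"
  defines "W \<equiv> \<lambda>M. (\<lambda>(\<beta>, g). (\<Prod>i\<in>A. z i ^ \<beta> i) * mon g) ` ((A \<rightarrow>\<^sub>E {..M}) \<times> (\<Union>j<n0. monomials m j))"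
  shows "forms m j \<subseteq> mpol.span (W j \<union> I)"
proof (induction j rule: less_induct)
  case (less j)
  note iI = homogeneous_idealD(1)[OF I]
  have W_mono: "W M \<subseteq> W M'" if "M \<le> M'" for M M'
    unfolding W_def using that by (intro image_mono Sigma_mono PiE_mono) auto
  show ?case
  proof (cases "j < n0")
    case True
    have "mon g \<in> W j" if "g \<in> monomials m j" for g
      unfolding W_def using that True
      by (intro image_eqI[of _ _ "(restrict (\<lambda>_. 0) A, g)"]) auto
    then show ?thesis
      unfolding forms_span by (intro mpol.span_mono) auto
  next
    case False
    show ?thesis
    proof
      fix p :: "(nat, 'k) mpol" assume p: "p \<in> forms m j"
      have "forms m j \<subseteq> adjoin m I A z"
        using False forms_carrier
        by (intro forms_subset_mono[OF ideal_adjoin[OF iI] red]) (use z in auto)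
      with p have "p \<in> adjoin m I A z" by blast
      then obtain p0 q where pq: "p0 \<in> I" "\<And>i. i \<in> A \<Longrightarrow> 1 \<le> j \<Longrightarrow> q i \<in> forms m (j - 1)"
        "\<And>i. i \<in> A \<Longrightarrow> \<not> 1 \<le> j \<Longrightarrow> q i = 0" "hom_component j p = p0 + (\<Sum>i\<in>A. z i * q i)"
        by (rule adjoin_component[where n = j and e = "\<lambda>_. 1", OF I z, rotated]) blast+
      have "z i * q i \<in> mpol.span (W j \<union> I)" if i: "i \<in> A" for i
      proof (cases "1 \<le> j")
        case True
        \<comment> \<open>The elements that \<open>z i\<close> multiplies into the target span form
          a subspace, so only generators from \<open>W (j - 1)\<close> and \<open>I\<close> need
          testing; a generator of the first kind just gains one in its \<open>i\<close>-th
          exponent.\<close>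
        let ?S = "{x. z i * x \<in> mpol.span (W j \<union> I)}"
        have "mpol.subspace ?S"
          by (intro mpol.subspaceI)
             (auto simp: distrib_left mpol.span_zero mult.left_commute[of "z i"] intro: mpol.span_add mpol.span_scale)
        moreover have "W (j - 1) \<subseteq> ?S"
        proof
          fix w assume "w \<in> W (j - 1)"
          then obtain \<beta> g where w: "w = (\<Prod>i\<in>A. z i ^ \<beta> i) * mon g" "\<beta> \<in> A \<rightarrow>\<^sub>E {..j - 1}"
            "g \<in> (\<Union>j<n0. monomials m j)" unfolding W_def by auto
          have "z i * (\<Prod>i\<in>A. z i ^ \<beta> i) = (\<Prod>l\<in>A. z l ^ (\<beta>(i := Suc (\<beta> i))) l)"
            using A i by (simp add: prod.remove[of A i])
          then have "z i * w = (\<Prod>l\<in>A. z l ^ (\<beta>(i := Suc (\<beta> i))) l) * mon g"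
            by (simp add: w mult.assoc flip: \<open>z i * _ = _\<close>)
          moreover have "\<beta>(i := Suc (\<beta> i)) \<in> A \<rightarrow>\<^sub>E {..j}"
            using w(2) i True by (auto simp: PiE_iff extensional_def Pi_iff dest!: bspec)
          ultimately have "z i * w \<in> W j"
            unfolding W_def using w(3) by (intro image_eqI[of _ _ "(\<beta>(i := Suc (\<beta> i)), g)"]) auto
          then show "w \<in> ?S" by (auto intro: mpol.span_base)
        qed
        moreover have "I \<subseteq> ?S"
          using idealD(5)[OF iI] subsetD[OF forms_carrier z[OF i]]
          by (auto simp: mult.commute[of "z i"] intro!: mpol.span_base)
        ultimately have "mpol.span (W (j - 1) \<union> I) \<subseteq> ?S"
          by (intro mpol.span_minimal) auto
        then show ?thesis using less.IH[of "j - 1"] pq(2)[OF i True] True by auto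
      qed (use pq(3) i mpol.span_zero in auto)
      moreover have "p = p0 + (\<Sum>i\<in>A. z i * q i)"
        using pq(4) hom_component_of_form[OF p, of j] by simp
      ultimately show "p \<in> mpol.span (W j \<union> I)"
        using pq(1) by (auto intro: mpol.span_add mpol.span_sum mpol.span_base)
    qed
  qed
qed

text \<open>The independent power products with exponents up to \<open>N\<close> number
  \<open>Suc N ^ n\<close> and have degree at most \<open>D * N * n\<close>. Modulo \<open>I\<close>
  they lie in the span of at most a constant times \<open>Suc (D * N * n) ^ card A\<close> elements,
  which is too few for large \<open>N\<close> when \<open>n > card A\<close>.\<close>

lemma prime_chain_length_le:
  fixes I :: "(nat, 'k::field) mpol set"
  assumes I: "homogeneous_ideal m I" and A: "finite A" and z: "\<And>i. i \<in> A \<Longrightarrow> z i \<in> forms m 1"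
    and red: "forms m n0 \<subseteq> adjoin m I A z"
    and P: "\<And>i. i \<le> n \<Longrightarrow> primeideal (P i) (mpol_ring {..<m})" "\<And>i. i < n \<Longrightarrow> P i \<subset> P (Suc i)" "I \<subseteq> P 0"
  shows "n \<le> card A"
proof (rule ccontr)
  assume n: "\<not> n \<le> card A"
  obtain ys where ys: "length ys = n" "set ys \<subseteq> carrier (mpol_ring {..<m})"
    and "\<forall>N c. (\<Sum>xs\<in>exponents N n. cst (c xs) * power_product ys xs) \<in> P 0 \<longrightarrow>
      (\<forall>xs\<in>exponents N n. c xs = 0)"
    using prime_chain_independent[of n P "{..<m}"] P(1,2) by auto
  then have indep: "c xs = 0"
    if "(\<Sum>xs\<in>exponents N n. cst (c xs) * power_product ys xs) \<in> P 0" "xs \<in> exponents N n" for N c xs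
    using that by blast
  obtain D where D: "\<And>y. y \<in> set ys \<Longrightarrow> deg_le D y"
  proof -
    have "\<exists>D. \<forall>y\<in>set ys. deg_le D y"
    proof (induction ys)
      case (Cons y ys)
      then obtain D where "\<forall>y\<in>set ys. deg_le D y" by blast
      moreover obtain E where "deg_le E y" using degree_bound_exists by (auto simp: deg_le_def)
      ultimately show ?case
        by (intro exI[of _ "max D E"]) (auto intro: deg_le_mono)
    qed simp
    with that show thesis by blast
  qed
  define W where "W M = (\<lambda>(\<beta>, g). (\<Prod>i\<in>A. z i ^ \<beta> i) * mon g :: (nat, 'k) mpol) `
    ((A \<rightarrow>\<^sub>E {..M}) \<times> (\<Union>j<n0. monomials m j))" for M
  let ?G = "\<Union>j<n0. monomials m j"
  have finW: "finite (W M)" for M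
    unfolding W_def using A by (intro finite_imageI finite_cartesian_product finite_PiE) auto
  have cardW: "card (W M) \<le> Suc M ^ card A * card ?G" for M
  proof -
    have "card (W M) \<le> card ((A \<rightarrow>\<^sub>E {..M}) \<times> ?G)"
      unfolding W_def using A by (intro card_image_le finite_cartesian_product finite_PiE) auto
    also have "\<dots> = Suc M ^ card A * card ?G"
      using A by (simp add: card_cartesian_product card_PiE)
    finally show ?thesis .
  qed
  have W_mono: "W M \<subseteq> W M'" if "M \<le> M'" for M M'
    unfolding W_def using that by (intro image_mono Sigma_mono PiE_mono) auto
  have bound: "Suc N ^ n \<le> Suc (D * N * n) ^ card A * card ?G" for N
  proof (rule ccontr)
    assume *: "\<not> ?thesis"
    let ?M = "D * N * n"
    have "power_product ys xs \<in> mpol.span (W ?M \<union> I)" if xs: "xs \<in> exponents N n" for xs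
    proof -
      have c: "power_product ys xs \<in> carrier (mpol_ring {..<m})"
        by (rule power_product_carrier[OF ys(2)])
      have "deg_le ?M (power_product ys xs)"
        using deg_le_power_product[of ys D xs N] D xs ys(1) by (auto simp: exponents_def)
      then have "power_product ys xs = (\<Sum>j\<le>?M. hom_component j (power_product ys xs))"
        by (intro hom_component_expand) (auto simp: deg_le_def)
      moreover have "hom_component j (power_product ys xs) \<in> mpol.span (W ?M \<union> I)" if "j \<le> ?M" for j
      proof -
        have "hom_component j (power_product ys xs) \<in> mpol.span (W j \<union> I)"
          using forms_growth[OF I A z red, of j] hom_component_forms[OF c] unfolding W_def by blast
        also have "\<dots> \<subseteq> mpol.span (W ?M \<union> I)"
          using W_mono[OF that] by (intro mpol.span_mono) auto
        finally show ?thesis .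
      qed
      then have "(\<Sum>j\<le>?M. hom_component j (power_product ys xs)) \<in> mpol.span (W ?M \<union> I)"
        by (intro mpol.span_sum) simp
      ultimately show ?thesis by metis
    qed
    moreover have "card (W ?M) < card (exponents N n)"
      using cardW[of ?M] * by (simp add: card_exponents)
    ultimately have "\<exists>c. (\<exists>xs\<in>exponents N n. c xs \<noteq> 0) \<and>
        (\<Sum>xs\<in>exponents N n. cst (c xs) * power_product ys xs) \<in> I"
      by (intro dependent_modulo[OF finW subspace_ideal[OF homogeneous_idealD(1)[OF I]] finite_exponents]) auto
    with indep P(3) show False by blast
  qed
  \<comment> \<open>Since \<open>Suc (D * K * n) \<le> Suc (D * n) * Suc K\<close>, the bound at
    \<open>N = K\<close> gives at most \<open>K * Suc K ^ card A\<close>, while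
    \<open>n > card A\<close> gives at least \<open>Suc K * Suc K ^ card A\<close>.\<close>
  define K where "K = Suc (D * n) ^ card A * card ?G"
  have "Suc K * Suc K ^ card A \<le> Suc K ^ n"
    using n by (simp flip: power_Suc add: power_increasing del: power_Suc)
  also have "\<dots> \<le> Suc (D * K * n) ^ card A * card ?G" by (rule bound)
  also have "\<dots> \<le> (Suc (D * n) * Suc K) ^ card A * card ?G"
    by (intro mult_right_mono power_mono) (auto simp: algebra_simps)
  also have "\<dots> = K * Suc K ^ card A"
    by (simp only: power_mult_distrib K_def mult_ac)
  finally show False by simp
qed

section \<open>Reductions generated by as many linear forms as the dimension\<close>

lemma hom_component_mult:
  fixes p q :: "(nat, 'k::field) mpol"
  assumes p: "p \<in> carrier (mpol_ring {..<m})" and q: "q \<in> carrier (mpol_ring {..<m})"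
  shows "hom_component n (p * q) = (\<Sum>a\<le>n. hom_component a p * hom_component (n - a) q)"
proof -
  obtain D where D: "\<And>t. t \<in> Poly_Mapping.keys p \<Longrightarrow> mono_deg t \<le> D"
    using degree_bound_exists by blast
  have "p = (\<Sum>a\<le>max D n. hom_component a p)"
    using D by (intro hom_component_expand) (simp add: le_max_iff_disj)
  then have "hom_component n (p * q) = hom_component n ((\<Sum>a\<le>max D n. hom_component a p) * q)" by simp
  also have "\<dots> = (\<Sum>a\<le>max D n. hom_component n (hom_component a p * q))"
    by (simp add: sum_distrib_right hom_component_sum)
  also have "\<dots> = (\<Sum>a\<le>max D n. if a \<le> n then hom_component a p * hom_component (n - a) q else 0)"
    by (rule sum.cong[OF refl], rule hom_component_form_mult[OF hom_component_forms[OF p] q])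
  also have "\<dots> = (\<Sum>a\<le>n. hom_component a p * hom_component (n - a) q)"
    by (rule sum.mono_neutral_cong_right) auto
  finally show ?thesis .
qed

lemma last_component_notin:
  assumes J: "homogeneous_ideal m J" and p: "p \<notin> J"
  obtains i where "hom_component i p \<notin> J" "\<And>a. i < a \<Longrightarrow> hom_component a p \<in> J"
proof -
  obtain D where D: "\<And>t. t \<in> Poly_Mapping.keys p \<Longrightarrow> mono_deg t \<le> D"
    using degree_bound_exists by blast
  have high: "hom_component a p \<in> J" if "D < a" for a
  proof -
    have "hom_component a p = 0"
      using D that by (intro poly_mapping_eqI) (force simp: lookup_hom_component in_keys_iff)
    then show ?thesis using idealD(2)[OF homogeneous_idealD(1)[OF J]] by simp
  qed
  let ?S = "{a. hom_component a p \<notin> J}"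
  have "?S \<subseteq> {..D}" using high by (auto simp: not_less[symmetric])
  then have fin: "finite ?S" by (rule finite_subset) simp
  moreover have "?S \<noteq> {}" using p homogeneous_ideal_components[OF J, of p] by blast
  ultimately have "Max ?S \<in> ?S" by (rule Max_in)
  moreover have "hom_component a p \<in> J" if "Max ?S < a" for a
    using Max_ge[OF fin, of a] that by fastforce
  ultimately show thesis using that by blast
qed

text \<open>Take the highest components of \<open>p\<close> and \<open>q\<close> outside
  \<open>J\<close>, in degrees \<open>i\<close> and \<open>j\<close>. In degree \<open>i + j\<close>
  of \<open>p * q\<close> every other term has a factor in \<open>J\<close>, so the product of these
  two components lies in \<open>J\<close>, against primality on forms.\<close>

lemma homogeneous_primeI:
  fixes J :: "(nat, 'k::field) mpol set"
  assumes J: "homogeneous_ideal m J" and "1 \<notin> J"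
    and prime: "\<And>a b i j. a \<in> forms m i \<Longrightarrow> b \<in> forms m j \<Longrightarrow> a * b \<in> J \<Longrightarrow> a \<in> J \<or> b \<in> J"
  shows "primeideal J (mpol_ring {..<m})"
  unfolding primeideal_mpol_ring_iff
proof (intro conjI ballI impI)
  note iJ = homogeneous_idealD(1)[OF J]
  show "ideal J (mpol_ring {..<m})" "1 \<notin> J" by fact+
  fix p q :: "(nat, 'k) mpol"
  assume pq: "p \<in> carrier (mpol_ring {..<m})" "q \<in> carrier (mpol_ring {..<m})" "p * q \<in> J"
  show "p \<in> J \<or> q \<in> J"
  proof (rule ccontr)
    assume "\<not> (p \<in> J \<or> q \<in> J)"
    then have np: "p \<notin> J" and nq: "q \<notin> J" by auto
    obtain i where i: "hom_component i p \<notin> J" "\<And>a. i < a \<Longrightarrow> hom_component a p \<in> J"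
      by (rule last_component_notin[OF J np]) (rule that)
    obtain j where j: "hom_component j q \<notin> J" "\<And>a. j < a \<Longrightarrow> hom_component a q \<in> J"
      by (rule last_component_notin[OF J nq]) (rule that)
    have carr: "hom_component a p \<in> carrier (mpol_ring {..<m})" "hom_component a q \<in> carrier (mpol_ring {..<m})" for a
      using hom_component_forms[OF pq(1)] hom_component_forms[OF pq(2)] forms_carrier by blast+
    let ?t = "\<lambda>a. hom_component a p * hom_component (i + j - a) q"
    have "?t a \<in> J" if "a \<in> {..i + j} - {i}" for a
    proof (cases "a < i")
      case True
      then show ?thesis by (intro idealD(4)[OF iJ] j(2) carr) simp
    next
      case False
      with that show ?thesis by (intro idealD(5)[OF iJ] i(2) carr) simp
    qed
    then have "sum ?t ({..i + j} - {i}) \<in> J" by (rule ideal_sum[OF iJ])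
    moreover have "hom_component (i + j) (p * q) \<in> J" using homogeneous_idealD(2)[OF J pq(3)] .
    moreover have "hom_component (i + j) (p * q) = ?t i + sum ?t ({..i + j} - {i})"
      unfolding hom_component_mult[OF pq(1,2)] by (intro sum.remove) auto
    ultimately have "?t i + sum ?t ({..i + j} - {i}) - sum ?t ({..i + j} - {i}) \<in> J"
      by (intro idealD(7)[OF iJ]) simp_all
    then have "?t i \<in> J" by simp
    then show False
      using prime[OF hom_component_forms[OF pq(1)] hom_component_forms[OF pq(2)], of i j] i(1) j(1) by simp
  qed
qed

text \<open>Noetherian induction: if \<open>J\<close> is proper and not prime, there are forms
  \<open>a\<close>, \<open>b\<close> outside \<open>J\<close> with \<open>a * b\<close> in
  \<open>J\<close>. The product of \<open>J + (a)\<close> and \<open>J + (b)\<close> lies in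
  \<open>J\<close>, so the lists for these two larger ideals are concatenated. Choosing one element
  from each prime expresses that the product of the primes lies in \<open>J\<close>; every prime
  above \<open>J\<close> then contains a listed one.\<close>

lemma homogeneous_prime_product:
  fixes J :: "(nat, 'k::field) mpol set"
  assumes "homogeneous_ideal m J"
  shows "\<exists>Ps. (\<forall>P\<in>set Ps. homogeneous_ideal m P \<and> primeideal P (mpol_ring {..<m}) \<and> J \<subseteq> P) \<and>
    (\<forall>xs. list_all2 (\<in>) xs Ps \<longrightarrow> prod_list xs \<in> J)"
  using assms
proof (induction J rule: wf_induct_rule[OF wf_ideals[of "{..<m}"]])
  case 1
  show ?case by simp
next
  case (2 J)
  note iJ = homogeneous_idealD(1)[OF 2(2)]
  show ?case
  proof (cases "1 \<in> J \<or> primeideal J (mpol_ring {..<m})")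
    case True
    then show ?thesis
    proof
      assume "1 \<in> J"
      \<comment> \<open>The unit ideal gets the empty list, whose only product is 1.\<close>
      then show ?thesis by (intro exI[of _ "[]"]) simp
    next
      assume "primeideal J (mpol_ring {..<m})"
      then show ?thesis using 2(2)
        by (intro exI[of _ "[J]"]) (auto simp: list_all2_Cons2)
    qed
  next
    case False
    then obtain a b i j where ab: "a \<in> forms m i" "b \<in> forms m j" "a * b \<in> J" "a \<notin> J" "b \<notin> J"
      using homogeneous_primeI[OF 2(2)] by blast
    let ?A = "\<lambda>a. adjoin m J {()} (\<lambda>_. a)"
    have dec: "\<exists>Ps. (\<forall>P\<in>set Ps. homogeneous_ideal m P \<and> primeideal P (mpol_ring {..<m}) \<and> J \<subseteq> P) \<and>
        (\<forall>xs. list_all2 (\<in>) xs Ps \<longrightarrow> prod_list xs \<in> ?A c)" if c: "c \<in> forms m k" "c \<notin> J" for c k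
    proof -
      have h: "homogeneous_ideal m (?A c)"
        by (rule homogeneous_adjoin[OF 2(2), where e = "\<lambda>_. k"]) (rule c(1))
      moreover have "J \<subset> ?A c"
        using adjoin_superset[OF iJ, where z = "\<lambda>_. c" and A = "{()}"] c(2) by auto
      ultimately have "\<exists>Ps. (\<forall>P\<in>set Ps. homogeneous_ideal m P \<and> primeideal P (mpol_ring {..<m}) \<and> ?A c \<subseteq> P) \<and>
          (\<forall>xs. list_all2 (\<in>) xs Ps \<longrightarrow> prod_list xs \<in> ?A c)"
        using homogeneous_idealD(1)[OF h] iJ by (intro 2(1)) auto
      with \<open>J \<subset> ?A c\<close> show ?thesis by (meson dual_order.trans psubset_imp_subset)
    qed
    obtain Ps where Ps: "\<forall>P\<in>set Ps. homogeneous_ideal m P \<and> primeideal P (mpol_ring {..<m}) \<and> J \<subseteq> P"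
      "\<forall>xs. list_all2 (\<in>) xs Ps \<longrightarrow> prod_list xs \<in> ?A a"
      using dec[OF ab(1,4)] by (elim exE conjE) (rule that)
    obtain Qs where Qs: "\<forall>P\<in>set Qs. homogeneous_ideal m P \<and> primeideal P (mpol_ring {..<m}) \<and> J \<subseteq> P"
      "\<forall>xs. list_all2 (\<in>) xs Qs \<longrightarrow> prod_list xs \<in> ?A b"
      using dec[OF ab(2,5)] by (elim exE conjE) (rule that)
    have "prod_list xs \<in> J" if xs: "list_all2 (\<in>) xs (Ps @ Qs)" for xs
    proof -
      obtain us vs where uv: "xs = us @ vs" "list_all2 (\<in>) us Ps" "list_all2 (\<in>) vs Qs"
        using xs unfolding list_all2_append2 by blast
      then have "prod_list us \<in> ?A a" "prod_list vs \<in> ?A b" using Ps(2) Qs(2) by auto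
      then obtain p q p' q' where *: "prod_list us = p + a * q" "prod_list vs = p' + b * q'"
        "p \<in> J" "p' \<in> J" "q \<in> carrier (mpol_ring {..<m})" "q' \<in> carrier (mpol_ring {..<m})"
        by (auto simp: adjoin_def)
      have c: "a \<in> carrier (mpol_ring {..<m})" "b \<in> carrier (mpol_ring {..<m})"
        using ab forms_carrier by blast+
      have pc: "p' \<in> carrier (mpol_ring {..<m})" using *(4) idealD(1)[OF iJ] by blast
      have "prod_list xs = p * (p' + b * q') + p' * (a * q) + (a * b) * (q * q')"
        by (simp add: uv * algebra_simps)
      also have "\<dots> \<in> J"
        using *(3-6) c pc ab(3)
        by (intro idealD(3)[OF iJ] idealD(5)[OF iJ, of p] idealD(5)[OF iJ, of p'] idealD(5)[OF iJ, of "a * b"]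
            carrier_closed)
      finally show ?thesis .
    qed
    with Ps(1) Qs(1) show ?thesis by (intro exI[of _ "Ps @ Qs"]) auto
  qed
qed

text \<open>On the line \<open>z + cst c * w\<close> each subspace is met for at most one
  \<open>c\<close>: two hits would put both \<open>w\<close> and \<open>z\<close> into it, but
  \<open>w\<close> avoids \<open>U\<close> and \<open>z\<close> avoids the others. An infinite field
  leaves a good \<open>c\<close>.\<close>

lemma avoid_subspaces:
  fixes L :: "('x, 'k::field) mpol set"
  assumes k: "infinite (UNIV :: 'k set)" and L: "mpol.subspace L" and F: "finite F"
    and V: "\<And>V. V \<in> F \<Longrightarrow> mpol.subspace V \<and> \<not> L \<subseteq> V"
  shows "\<exists>z\<in>L. \<forall>V\<in>F. z \<notin> V"
  using F V
proof (induction F)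
  case empty
  then show ?case using mpol.subspace_0[OF L] by auto
next
  case (insert U F)
  then obtain z where z: "z \<in> L" "\<And>V. V \<in> F \<Longrightarrow> z \<notin> V" by auto
  obtain w where w: "w \<in> L" "w \<notin> U" using insert.prems by blast
  have bad: "finite {c. z + cst c * w \<in> V}" if V: "V \<in> insert U F" for V
  proof -
    have sV: "mpol.subspace V" using insert.prems V by blast
    have "c = c'" if cc: "z + cst c * w \<in> V" "z + cst c' * w \<in> V" for c c'
    proof (rule ccontr)
      assume ne: "c \<noteq> c'"
      have "(z + cst c * w) - (z + cst c' * w) \<in> V" using cc by (rule mpol.subspace_diff[OF sV])
      then have "cst (c - c') * w \<in> V" by (simp add: mpol.scale_left_diff_distrib)
      then have "cst (inverse (c - c')) * (cst (c - c') * w) \<in> V" by (rule mpol.subspace_scale[OF sV])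
      with ne have "w \<in> V" by (simp add: mult_single flip: mult.assoc)
      then have "z + cst c * w - cst c * w \<in> V"
        using cc(1) by (intro mpol.subspace_diff[OF sV] mpol.subspace_scale[OF sV])
      then have "z \<in> V" by simp
      with \<open>w \<in> V\<close> V z(2) w(2) show False by blast
    qed
    then have "{c. z + cst c * w \<in> V} = {} \<or> (\<exists>c. {c. z + cst c * w \<in> V} = {c})" by blast
    then show ?thesis by auto
  qed
  have "finite (\<Union>V\<in>insert U F. {c. z + cst c * w \<in> V})"
    using insert.hyps(1) bad by blast
  then obtain c where "c \<notin> (\<Union>V\<in>insert U F. {c. z + cst c * w \<in> V})"
    using k ex_new_if_finite by blast
  moreover have "z + cst c * w \<in> L"
    using z(1) w(1) by (intro mpol.subspace_add[OF L] mpol.subspace_scale[OF L])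
  ultimately show ?case by blast
qed

text \<open>The ideal generated by the variables: \<open>0\<close> is the monomial 1, so the
  condition says that the constant term vanishes.\<close>

definition irrelevant :: "nat \<Rightarrow> (nat, 'k::field) mpol set"
  where "irrelevant m = {p \<in> carrier (mpol_ring {..<m}). 0 \<notin> Poly_Mapping.keys p}"

lemma add_eq_0_monom: "s + t = 0 \<Longrightarrow> s = (0 :: 'x monom)"
  by (rule poly_mapping_eqI) (metis add_is_0 lookup_add lookup_zero)

lemma ideal_irrelevant: "ideal (irrelevant m :: (nat, 'k::field) mpol set) (mpol_ring {..<m})"
  unfolding ideal_mpol_ring_iff
proof (intro conjI ballI)
  fix p q :: "(nat, 'k) mpol"
  assume p: "p \<in> irrelevant m"
  { assume "q \<in> irrelevant m"
    with p show "p + q \<in> irrelevant m"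
      using Poly_Mapping.keys_add[of p q] by (auto simp: irrelevant_def carrier_closed) }
  { assume "q \<in> carrier (mpol_ring {..<m})"
    moreover have "0 \<notin> Poly_Mapping.keys (q * p)"
    proof
      assume "0 \<in> Poly_Mapping.keys (q * p)"
      then obtain s t where "s \<in> Poly_Mapping.keys q" "t \<in> Poly_Mapping.keys p" "s + t = 0"
        using keys_mult[of q p] by auto
      then have "0 \<in> Poly_Mapping.keys p" using add_eq_0_monom[of t s] by (simp add: add.commute)
      with p show False by (simp add: irrelevant_def)
    qed
    ultimately show "q * p \<in> irrelevant m" using p by (auto simp: irrelevant_def carrier_closed) }
qed (auto simp: irrelevant_def)

lemma monomials_0: "monomials m 0 = {0}"
  by (auto simp: monomials_def mono_deg_def in_keys_iff intro!: poly_mapping_eqI)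

lemma forms_0: "p \<in> forms m 0 \<Longrightarrow> p = cst (Poly_Mapping.lookup p 0)"
  using forms_expand[of p m 0] by (simp add: monomials_0)

lemma homogeneous_irrelevant: "homogeneous_ideal m (irrelevant m)"
  unfolding homogeneous_ideal_def poly_ring_def
  using ideal_irrelevant subsetD[OF forms_carrier hom_component_forms]
  by (auto simp: irrelevant_def in_keys_iff lookup_hom_component)

lemma primeideal_irrelevant: "primeideal (irrelevant m :: (nat, 'k::field) mpol set) (mpol_ring {..<m})"
proof (rule homogeneous_primeI[OF homogeneous_irrelevant])
  show "1 \<notin> (irrelevant m :: (nat, 'k) mpol set)" by (simp add: irrelevant_def)
next
  fix a b :: "(nat, 'k) mpol" and i j
  assume ab: "a \<in> forms m i" "b \<in> forms m j" "a * b \<in> irrelevant m"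
  have pos: "p \<in> irrelevant m" if "p \<in> forms m k" "k \<noteq> 0" for p :: "(nat, 'k) mpol" and k
    using that subsetD[OF forms_carrier that(1)] by (auto simp: irrelevant_def forms_def)
  show "a \<in> irrelevant m \<or> b \<in> irrelevant m"
  proof (cases "i = 0 \<and> j = 0")
    case True
    then have f: "a \<in> forms m 0" "b \<in> forms m 0" using ab by auto
    let ?\<alpha> = "Poly_Mapping.lookup a 0" and ?\<beta> = "Poly_Mapping.lookup b 0"
    have "cst ?\<alpha> * cst ?\<beta> \<in> irrelevant m" using ab(3) forms_0[OF f(1)] forms_0[OF f(2)] by simp
    then have "?\<alpha> * ?\<beta> = 0" by (simp add: mult_single irrelevant_def split: if_splits)
    then show ?thesis using ab(1,2) forms_carrier by (auto simp: irrelevant_def in_keys_iff)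
  qed (use pos ab in blast)
qed

text \<open>A nonzero constant term would be the degree 0 component of an element of
  \<open>J\<close>, hence a unit in \<open>J\<close>. So every chain of homogeneous primes stays
  below the irrelevant ideal.\<close>

lemma homogeneous_proper_le_irrelevant:
  assumes J: "homogeneous_ideal m J" and "1 \<notin> J"
  shows "J \<subseteq> irrelevant m"
proof
  fix p assume p: "p \<in> J"
  note iJ = homogeneous_idealD(1)[OF J]
  have pc: "p \<in> carrier (mpol_ring {..<m})" using p idealD(1)[OF iJ] by blast
  have "hom_component 0 p = cst (Poly_Mapping.lookup p 0)"
    using forms_0[OF hom_component_forms[OF pc]] by (simp add: lookup_hom_component)
  then have "cst (Poly_Mapping.lookup p 0) \<in> J" using homogeneous_idealD(2)[OF J p] by metis
  then have "cst (inverse (Poly_Mapping.lookup p 0)) * cst (Poly_Mapping.lookup p 0) \<in> J"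
    by (intro idealD(4)[OF iJ]) auto
  moreover have "cst (inverse (Poly_Mapping.lookup p 0)) * cst (Poly_Mapping.lookup p 0) = 1"
    if "Poly_Mapping.lookup p 0 \<noteq> 0" using that by (simp add: mult_single)
  ultimately have "Poly_Mapping.lookup p 0 = 0" using \<open>1 \<notin> J\<close> by metis
  with pc show "p \<in> irrelevant m" by (simp add: irrelevant_def in_keys_iff)
qed

lemma irrelevant_le:
  fixes J :: "(nat, 'k::field) mpol set"
  assumes J: "ideal J (mpol_ring {..<m})" and f: "forms m 1 \<subseteq> J"
  shows "irrelevant m \<subseteq> J"
proof
  fix p :: "(nat, 'k) mpol" assume p: "p \<in> irrelevant m"
  obtain D where "\<And>t. t \<in> Poly_Mapping.keys p \<Longrightarrow> mono_deg t \<le> D"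
    using degree_bound_exists by blast
  then have sum: "p = (\<Sum>n\<le>D. hom_component n p)" by (rule hom_component_expand)
  have pc: "p \<in> carrier (mpol_ring {..<m})" using p by (simp add: irrelevant_def)
  have "hom_component n p \<in> J" for n
  proof (cases "n = 0")
    case True
    have "hom_component 0 p = 0"
      using forms_0[OF hom_component_forms[OF pc]] p
      by (simp add: lookup_hom_component irrelevant_def in_keys_iff)
    with True show ?thesis using idealD(2)[OF J] by simp
  next
    case False
    then show ?thesis using forms_subset_mono[OF J f, of n] hom_component_forms[OF pc] by auto
  qed
  then have "(\<Sum>n\<le>D. hom_component n p) \<in> J" by (intro ideal_sum[OF J]) simp
  with sum show "p \<in> J" by metis
qed

lemma forms_power: "z \<in> forms m 1 \<Longrightarrow> z ^ n \<in> forms m n"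
  using cst_forms[of 1 m] forms_mult[of z m 1 _ _] by (induction n) auto

lemma prime_contains_linear_forms:
  fixes P :: "(nat, 'k::field) mpol set"
  assumes P: "primeideal P (mpol_ring {..<m})" and f: "forms m n \<subseteq> P"
  shows "forms m 1 \<subseteq> P"
proof
  fix z :: "(nat, 'k) mpol" assume z: "z \<in> forms m 1"
  then have "z ^ n \<in> P" using f forms_power by blast
  then show "z \<in> P" using prime_power_notin[OF P] subsetD[OF forms_carrier z] by blast
qed

lemma prime_contains_factor:
  assumes P: "primeideal P (mpol_ring X)" and Ps: "\<And>Q. Q \<in> set Ps \<Longrightarrow> Q \<subseteq> carrier (mpol_ring X)"
    and prod: "\<And>xs. list_all2 (\<in>) xs Ps \<Longrightarrow> prod_list xs \<in> P"
  shows "\<exists>Q\<in>set Ps. Q \<subseteq> P"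
proof (rule ccontr)
  assume no: "\<not> ?thesis"
  then have "\<exists>xs. list_all2 (\<in>) xs Ps \<and> prod_list xs \<in> carrier (mpol_ring X) \<and> prod_list xs \<notin> P"
    using Ps
  proof (induction Ps)
    case Nil
    then show ?case using P primeideal_mpol_ring_iff by auto
  next
    case (Cons Q Ps)
    obtain x where x: "x \<in> Q" "x \<notin> P" "x \<in> carrier (mpol_ring X)" using Cons.prems by auto
    obtain xs where "list_all2 (\<in>) xs Ps" "prod_list xs \<in> carrier (mpol_ring X)" "prod_list xs \<notin> P"
      using Cons by auto
    with x P show ?case unfolding primeideal_mpol_ring_iff
      by (intro exI[of _ "x # xs"]) (auto intro: carrier_closed)
  qed
  with prod show False by blast
qed

text \<open>Each new form avoids the minimal primes not containing \<open>L\<close>, so chains of homogeneous primes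
  get shorter. When no chain of positive length is left, the irrelevant ideal is the only
  homogeneous prime, and a power of it lies in the ideal.\<close>

lemma exists_small_reduction:
  fixes I :: "(nat, 'k::field) mpol set"
  assumes k: "infinite (UNIV :: 'k set)" and I: "homogeneous_ideal m I"
    and L: "mpol.subspace L" "L \<subseteq> forms m 1"
    and red: "\<And>K. ideal K (mpol_ring {..<m}) \<Longrightarrow> I \<subseteq> K \<Longrightarrow> L \<subseteq> K \<Longrightarrow> forms m n0 \<subseteq> K"
    and dim: "\<And>P n. (\<And>i. i \<le> n \<Longrightarrow> primeideal (P i) (mpol_ring {..<m})) \<Longrightarrow>
      (\<And>i. i < n \<Longrightarrow> P i \<subset> P (Suc i)) \<Longrightarrow> I \<subseteq> P 0 \<Longrightarrow> n \<le> d"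
  shows "\<exists>z. (\<forall>i<d. z i \<in> L) \<and> (\<exists>n. forms m n \<subseteq> adjoin m I {..<d} z)"
proof -
  note iI = homogeneous_idealD(1)[OF I]
  let ?H = "\<lambda>P. homogeneous_ideal m P \<and> primeideal P (mpol_ring {..<m})"
  have hom: "homogeneous_ideal m (adjoin m I {..<e} z)" if "\<forall>i<e. z i \<in> L" for e z
    using that L(2) by (intro homogeneous_adjoin[OF I, where e = "\<lambda>_. 1"]) auto
  define chains_short where "chains_short e z \<longleftrightarrow> (\<forall>P n. (\<forall>i\<le>n. ?H (P i)) \<longrightarrow>
    (\<forall>i<n. P i \<subset> P (Suc i)) \<longrightarrow> adjoin m I {..<e} z \<subseteq> P 0 \<longrightarrow> n + e \<le> d)" for e z
  have ex: "\<exists>z. (\<forall>i<e. z i \<in> L) \<and> chains_short e z" if "e \<le> d" for e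
    using that
  proof (induction e)
    case 0
    have "adjoin m I {..<0} z = I" for z :: "nat \<Rightarrow> (nat, 'k) mpol" by (simp add: adjoin_def)
    moreover have "n \<le> d" if "\<forall>i\<le>n. ?H (P i)" "\<forall>i<n. P i \<subset> P (Suc i)" "I \<subseteq> P 0" for P n
      by (rule dim[of n P]) (use that in blast)+
    ultimately show ?case by (auto simp: chains_short_def)
  next
    case (Suc e)
    then obtain z where z: "\<forall>i<e. z i \<in> L" and short: "chains_short e z"
      using Suc_leD by blast
    have IH: "n + e \<le> d"
      if "\<forall>i\<le>n. ?H (P i)" "\<forall>i<n. P i \<subset> P (Suc i)" "adjoin m I {..<e} z \<subseteq> P 0" for P n
      using short that unfolding chains_short_def by blast
    let ?J = "adjoin m I {..<e} z"
    obtain Ps where Ps: "\<forall>P\<in>set Ps. ?H P \<and> ?J \<subseteq> P" "\<forall>xs. list_all2 (\<in>) xs Ps \<longrightarrow> prod_list xs \<in> ?J"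
      using homogeneous_prime_product[OF hom[OF z]] by (auto simp: conj_assoc)
    have "\<exists>w\<in>L. \<forall>P\<in>{P \<in> set Ps. \<not> L \<subseteq> P}. w \<notin> P"
      using Ps(1) by (intro avoid_subspaces[OF k L(1)]) (auto intro: subspace_ideal homogeneous_idealD(1))
    then obtain w where w: "w \<in> L" "\<And>P. P \<in> set Ps \<Longrightarrow> \<not> L \<subseteq> P \<Longrightarrow> w \<notin> P" by blast
    let ?z = "z(e := w)"
    have z': "\<forall>i<Suc e. ?z i \<in> L" using z w(1) by (simp add: less_Suc_eq)
    let ?J' = "adjoin m I {..<Suc e} ?z"
    note sup = adjoin_superset[OF iI, where A = "{..<Suc e}" and z = ?z]
    have "?J \<subseteq> ?J'"
    proof (rule adjoin_minimal[OF homogeneous_idealD(1)[OF hom[OF z']] sup(1)])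
      fix i assume "i \<in> {..<e}"
      then show "z i \<in> ?J'" using sup(2)[of i] by auto
    qed
    have "n + Suc e \<le> d" if P: "\<forall>i\<le>n. ?H (P i)" "\<forall>i<n. P i \<subset> P (Suc i)" "?J' \<subseteq> P 0" for P n
    proof -
      have P0: "primeideal (P 0) (mpol_ring {..<m})" using P(1) by auto
      then have iP0: "ideal (P 0) (mpol_ring {..<m})" by (simp add: primeideal_mpol_ring_iff)
      have "\<exists>Q\<in>set Ps. Q \<subseteq> P 0"
      proof (rule prime_contains_factor[OF P0])
        show "Q \<subseteq> carrier (mpol_ring {..<m})" if "Q \<in> set Ps" for Q
          using Ps(1) that homogeneous_idealD(1) idealD(1) by blast
        show "prod_list xs \<in> P 0" if "list_all2 (\<in>) xs Ps" for xs
          using Ps(2) that \<open>?J \<subseteq> ?J'\<close> P(3) by blast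
      qed
      then obtain Q where Q: "Q \<in> set Ps" "Q \<subseteq> P 0" by blast
      show ?thesis
      proof (cases "L \<subseteq> Q")
        \<comment> \<open>A listed prime containing \<open>L\<close> cannot be avoided by
          \<open>w\<close>. But then \<open>red\<close> puts all forms of degree \<open>n0\<close>
          into \<open>P 0\<close>, which therefore contains all linear forms and with them the
          irrelevant ideal. No homogeneous prime is larger, so the chain has length 0.\<close>
        case True
        have "I \<subseteq> P 0" using sup(1) P(3) by blast
        then have "forms m 1 \<subseteq> P 0"
          using True Q(2) by (intro prime_contains_linear_forms[OF P0 red[OF iP0]]) auto
        then have M: "irrelevant m \<subseteq> P 0" by (rule irrelevant_le[OF iP0])
        have "n = 0"
        proof (rule ccontr)
          assume "n \<noteq> 0"
          then have "?H (P 1)" "P 0 \<subset> P 1" using P(1,2) by auto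
          then have "P 1 \<subseteq> irrelevant m"
            by (intro homogeneous_proper_le_irrelevant) (auto simp: primeideal_mpol_ring_iff)
          with M \<open>P 0 \<subset> P 1\<close> show False by blast
        qed
        with Suc.prems show ?thesis by simp
      next
        case False
        \<comment> \<open>The form \<open>w\<close> separates \<open>Q\<close> from
          \<open>P 0\<close>, so \<open>Q\<close> can be put in front of the chain. The longer chain
          lies over the previous ideal, where the induction hypothesis gains the missing
          one.\<close>
        have "w \<in> P 0" using sup(2)[of e] P(3) by auto
        then have lt: "Q \<subset> P 0" using w(2)[OF Q(1) False] Q(2) by blast
        have "Suc n + e \<le> d"
        proof (rule IH[of "Suc n" "case_nat Q P"])
          show "\<forall>i\<le>Suc n. ?H (case_nat Q P i)" using Ps(1) Q(1) P(1) by (auto split: nat.split)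
          show "\<forall>i<Suc n. case_nat Q P i \<subset> case_nat Q P (Suc i)"
            using lt P(2) by (auto split: nat.split)
          show "?J \<subseteq> case_nat Q P 0" using Ps(1) Q(1) by auto
        qed
        then show ?thesis by simp
      qed
    qed
    with z' show ?case unfolding chains_short_def by blast
  qed
  obtain z where z: "\<forall>i<d. z i \<in> L" and short: "chains_short d z"
    using ex[OF order_refl] by blast
  have chain: "n + d \<le> d"
    if "\<forall>i\<le>n. ?H (P i)" "\<forall>i<n. P i \<subset> P (Suc i)" "adjoin m I {..<d} z \<subseteq> P 0" for P n
    using short that unfolding chains_short_def by blast
  let ?J = "adjoin m I {..<d} z"
  obtain Ps where Ps: "\<forall>P\<in>set Ps. ?H P \<and> ?J \<subseteq> P" "\<forall>xs. list_all2 (\<in>) xs Ps \<longrightarrow> prod_list xs \<in> ?J"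
    using homogeneous_prime_product[OF hom[OF z]] by (auto simp: conj_assoc)
  \<comment> \<open>Any other listed prime would form a chain of length 1 with the irrelevant ideal,
    but with all \<open>d\<close> forms adjoined only length 0 is left.\<close>
  have irr: "P = irrelevant m" if P: "P \<in> set Ps" for P
  proof (rule ccontr)
    assume ne: "P \<noteq> irrelevant m"
    have "P \<subseteq> irrelevant m"
      using Ps(1) P by (intro homogeneous_proper_le_irrelevant) (auto simp: primeideal_mpol_ring_iff)
    with ne have lt: "P \<subset> irrelevant m" by blast
    have "1 + d \<le> d"
      by (rule chain[of 1 "\<lambda>i. if i = 0 then P else irrelevant m"])
         (use Ps(1) P lt homogeneous_irrelevant primeideal_irrelevant in auto)
    then show False by simp
  qed
  \<comment> \<open>Such a monomial is a product of variables, one for each listed prime, and all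
    these primes are the irrelevant ideal.\<close>
  have "mon t \<in> ?J" if t: "t \<in> monomials m (length Ps)" for t
  proof -
    obtain xs :: "(nat, 'k) mpol list"
      where xs: "length xs = length Ps" "set xs \<subseteq> var ` {..<m}" "mon t = prod_list xs"
      using mono_prod_vars[OF t] by blast
    have v: "(var j :: (nat, 'k) mpol) \<in> irrelevant m" if "j < m" for j
    proof -
      have "Poly_Mapping.single j (1::nat) \<noteq> 0" by (metis mono_deg_single mono_deg_zero zero_neq_one)
      then show ?thesis using subsetD[OF forms_carrier var_forms[OF that]] by (simp add: irrelevant_def)
    qed
    have "list_all2 (\<in>) xs Ps"
      unfolding list_all2_conv_all_nth
    proof (intro conjI allI impI)
      fix i assume i: "i < length xs"
      then have "xs ! i \<in> var ` {..<m}" using xs(2) nth_mem by blast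
      then show "xs ! i \<in> Ps ! i" using v irr[of "Ps ! i"] i xs(1) by auto
    qed (rule xs(1))
    then show ?thesis using Ps(2) xs(3) by metis
  qed
  then have "forms m (length Ps) \<subseteq> ?J"
    unfolding forms_span
    by (intro mpol.span_minimal subspace_ideal[OF homogeneous_idealD(1)[OF hom[OF z]]]) auto
  with z show ?thesis by blast
qed

section \<open>Reductions of the quotient ring\<close>

text \<open>An ideal containing \<open>I\<close> is the union of its cosets, so no element outside
  \<open>J\<close> shares a coset with one inside. This lets containments in the quotient be tested
  in the ring.\<close>

lemma (in ring) quot_image_mem_iff:
  assumes I: "ideal I R" and J: "ideal J R" "I \<subseteq> J" and p: "p \<in> carrier R"
  shows "I +> p \<in> (+>) I ` J \<longleftrightarrow> p \<in> J"
proof -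
  have iJ: "ideal ((+>) I ` J) (R Quot I)" by (rule ring_ideal_imp_quot_ideal[OF I J(1)])
  have "\<Union> ((+>) I ` J) = J" using ideal_incl_iff[OF I J(1)] J(2) by simp
  moreover have "(+>) I ` J \<subseteq> carrier (R Quot I)"
    using additive_subgroup.a_subset[OF ideal.axioms(1)[OF iJ]] .
  ultimately show ?thesis using canonical_proj_vimage_mem_iff[OF I _ p, of "(+>) I ` J"] by simp
qed

lemma (in ring) quot_image_subset_iff:
  assumes I: "ideal I R" and J: "ideal J R" "I \<subseteq> J" and L: "L \<subseteq> carrier R"
  shows "(+>) I ` L \<subseteq> (+>) I ` J \<longleftrightarrow> L \<subseteq> J"
proof
  assume sub: "(+>) I ` L \<subseteq> (+>) I ` J"
  show "L \<subseteq> J"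
  proof
    fix p assume "p \<in> L"
    then show "p \<in> J" using sub L quot_image_mem_iff[OF I J, of p] by blast
  qed
qed blast

text \<open>The preimage of the ideal generated in the quotient is an ideal containing
  \<open>I\<close> and \<open>L\<close>; this gives the second inclusion.\<close>

lemma (in ring) genideal_quot_image:
  assumes I: "ideal I R" and L: "L \<subseteq> carrier R"
  shows "genideal (R Quot I) ((+>) I ` L) = (+>) I ` genideal R (I \<union> L)"
proof
  interpret Q: ring "R Quot I" by (rule ideal.quotient_is_ring[OF I])
  have Ic: "I \<subseteq> carrier R" using additive_subgroup.a_subset[OF ideal.axioms(1)[OF I]] .
  have IL: "I \<union> L \<subseteq> carrier R" using Ic L by blast
  have Lc: "(+>) I ` L \<subseteq> carrier (R Quot I)"
    using L by (auto simp: FactRing_def A_RCOSETS_def')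
  show "genideal (R Quot I) ((+>) I ` L) \<subseteq> (+>) I ` genideal R (I \<union> L)"
    using ring_ideal_imp_quot_ideal[OF I genideal_ideal[OF IL]] genideal_self[OF IL]
    by (intro Q.genideal_minimal) auto
  let ?K = "genideal (R Quot I) ((+>) I ` L)"
  have iK: "ideal ?K (R Quot I)" by (rule Q.genideal_ideal[OF Lc])
  have Kc: "?K \<subseteq> carrier (R Quot I)" using additive_subgroup.a_subset[OF ideal.axioms(1)[OF iK]] .
  note mem = canonical_proj_vimage_mem_iff[OF I Kc]
  have "I \<in> ?K"
    using additive_subgroup.zero_closed[OF ideal.axioms(1)[OF iK]] by (simp add: FactRing_def)
  then have "I \<union> L \<subseteq> \<Union> ?K"
    using mem Q.genideal_self[OF Lc] L by blast
  then have "genideal R (I \<union> L) \<subseteq> \<Union> ?K"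
    by (rule genideal_minimal[OF quot_ideal_imp_ring_ideal[OF I iK]])
  then show "(+>) I ` genideal R (I \<union> L) \<subseteq> ?K"
    using mem canonical_proj_vimage_in_carrier[OF I Kc] by blast
qed

lemma (in cring) primeideal_quot_image:
  assumes I: "ideal I R" and P: "primeideal P R" "I \<subseteq> P"
  shows "primeideal ((+>) I ` P) (R Quot I)"
proof (rule primeidealI)
  have iP: "ideal P R" using P(1) by (rule primeideal.axioms(1))
  note mem = quot_image_mem_iff[OF I iP P(2)]
  show "ideal ((+>) I ` P) (R Quot I)" by (rule ring_ideal_imp_quot_ideal[OF I iP])
  show "cring (R Quot I)" by (rule ideal.quotient_is_cring[OF I is_cring])
  have carr: "carrier (R Quot I) = (+>) I ` carrier R"
    by (auto simp: FactRing_def A_RCOSETS_def')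
  show "carrier (R Quot I) \<noteq> (+>) I ` P"
  proof
    assume eq: "carrier (R Quot I) = (+>) I ` P"
    have "carrier R \<subseteq> P"
    proof
      fix p assume p: "p \<in> carrier R"
      then have "I +> p \<in> (+>) I ` P" using carr eq by blast
      then show "p \<in> P" using mem[OF p] by simp
    qed
    then show False
      using primeideal.I_notcarr[OF P(1)] additive_subgroup.a_subset[OF ideal.axioms(1)[OF iP]] by blast
  qed
  fix a b
  assume "a \<in> carrier (R Quot I)" "b \<in> carrier (R Quot I)" and ab: "a \<otimes>\<^bsub>R Quot I\<^esub> b \<in> (+>) I ` P"
  then obtain p q where pq: "p \<in> carrier R" "q \<in> carrier R" "a = I +> p" "b = I +> q"
    unfolding carr by blast
  then have "a \<otimes>\<^bsub>R Quot I\<^esub> b = I +> (p \<otimes> q)"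
    by (simp add: FactRing_def ideal.rcoset_mult_add[OF I])
  then have "p \<otimes> q \<in> P" using ab mem pq by simp
  then show "a \<in> (+>) I ` P \<or> b \<in> (+>) I ` P"
    using primeideal.I_prime[OF P(1) pq(1,2)] pq(3,4) by blast
qed

lemma solve_relation:
  fixes b :: "'i \<Rightarrow> ('x, 'k::field) mpol"
  assumes K: "ideal K (mpol_ring X)" and T: "finite T" "i \<in> T" "c i \<noteq> 0"
    and rel: "(\<Sum>j\<in>T. cst (c j) * b j) \<in> K" and b: "\<And>j. j \<in> T \<Longrightarrow> j \<noteq> i \<Longrightarrow> b j \<in> K"
  shows "b i \<in> K"
proof -
  have "(\<Sum>j\<in>T. cst (c j) * b j) - (\<Sum>j\<in>T - {i}. cst (c j) * b j) \<in> K"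
    using b by (intro idealD(7)[OF K rel] ideal_sum[OF K] idealD(4)[OF K]) auto
  then have "cst (c i) * b i \<in> K" using T by (simp add: sum.remove[of T i])
  then have "cst (inverse (c i)) * (cst (c i) * b i) \<in> K" by (rule idealD(4)[OF K]) simp
  then show ?thesis using T(3) by (simp add: mult_single flip: mult.assoc)
qed

text \<open>A finite supremum of a nonempty set in \<open>enat\<close> comes from a finite set and
  is its maximum; \<open>d \<ge> 1\<close> excludes the empty set, whose supremum is 0.\<close>

lemma Sup_enat_attained:
  assumes "Sup S = enat d" "d \<ge> 1"
  shows "enat d \<in> S"
proof (cases "S = {}")
  case True
  with assms show ?thesis by (simp add: bot_enat_def zero_enat_def)
next
  case False
  moreover have "finite S" using assms(1) False by (auto simp: Sup_enat_def split: if_splits)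
  ultimately show ?thesis using assms(1) Max_in[of S] by (simp add: Sup_enat_def)
qed

section \<open>The quotient algebra and its minimal reductions\<close>

locale graded_quotient =
  fixes m d :: nat and I :: "(nat, 'k::field) mpol set"
  assumes infinite_field: "infinite (UNIV :: 'k set)"
    and homogeneous: "homogeneous_ideal m I"
    and proper: "I \<noteq> carrier (mpol_ring {..<m})"
    and dimension: "krull_dim (mpol_ring {..<m} Quot I) = enat d" "d \<ge> 1"
begin

abbreviation "R \<equiv> mpol_ring {..<m} :: (nat, 'k) mpol ring"
abbreviation "\<pi> \<equiv> a_r_coset R I"
text \<open>The preimage in \<open>R\<close> of the ideal of the quotient generated by the classes
  of the \<open>z i\<close> with \<open>i < d\<close>. Containing \<open>forms m n\<close> means
  that this ideal has the full piece of degree \<open>n\<close>.\<close>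

abbreviation "H z \<equiv> adjoin m I {..<d} z"

lemma ideal_I: "ideal I R" by (rule homogeneous_idealD(1)[OF homogeneous])

sublocale R: cring R by (rule cring_mpol_ring)

lemma one_notin: "1 \<notin> I"
  using proper ideal_eq_carrier_iff[OF ideal_I] by simp

lemma prime_chain_le:
  assumes P: "\<And>i. i \<le> n \<Longrightarrow> primeideal (P i) R" "\<And>i. i < n \<Longrightarrow> P i \<subset> P (Suc i)" "I \<subseteq> P 0"
  shows "n \<le> d"
proof -
  have sub: "I \<subseteq> P i" if "i \<le> n" for i
    using that
  proof (induction i)
    case (Suc i)
    then show ?case using P(2)[of i] by auto
  qed (rule P(3))
  have iP: "ideal (P i) R" if "i \<le> n" for i
    using P(1)[OF that] by (simp add: primeideal_mpol_ring_iff)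
  have "\<pi> ` P i \<subset> \<pi> ` P (Suc i)" if i: "i < n" for i
  proof -
    have "\<not> P (Suc i) \<subseteq> P i" using P(2)[OF i] by blast
    then have "\<not> \<pi> ` P (Suc i) \<subseteq> \<pi> ` P i"
      using R.quot_image_subset_iff[OF ideal_I iP[of i] sub[of i], of "P (Suc i)"] idealD(1)[OF iP[of "Suc i"]] i by simp
    then show ?thesis using P(2)[OF i] by blast
  qed
  moreover have "primeideal (\<pi> ` P i) (R Quot I)" if "i \<le> n" for i
    by (rule R.primeideal_quot_image[OF ideal_I P(1)[OF that] sub[OF that]])
  ultimately have "\<exists>P. (\<forall>i\<le>n. primeideal (P i) (R Quot I)) \<and> (\<forall>i<n. P i \<subset> P (Suc i))"
    by (intro exI[of _ "\<lambda>i. \<pi> ` P i"]) simp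
  then have "enat n \<in> {enat n | n. \<exists>P. (\<forall>i\<le>n. primeideal (P i) (R Quot I)) \<and> (\<forall>i<n. P i \<subset> P (Suc i))}"
    by (intro CollectI exI[of _ n] conjI refl)
  then have "enat n \<le> krull_dim (R Quot I)"
    unfolding krull_dim_def by (rule Sup_upper)
  then show ?thesis by (simp add: dimension)
qed

lemma prime_chain_exists:
  obtains P where "\<And>i. i \<le> d \<Longrightarrow> primeideal (P i) R" "\<And>i. i < d \<Longrightarrow> P i \<subset> P (Suc i)" "I \<subseteq> P 0"
proof -
  let ?S = "{enat n | n. \<exists>P. (\<forall>i\<le>n. primeideal (P i) (R Quot I)) \<and> (\<forall>i<n. P i \<subset> P (Suc i))}"
  have S: "Sup ?S = enat d" using dimension(1) by (simp add: krull_dim_def)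
  have "enat d \<in> ?S" by (rule Sup_enat_attained[OF S dimension(2)])
  then obtain P where P: "\<And>i. i \<le> d \<Longrightarrow> primeideal (P i) (R Quot I)" "\<And>i. i < d \<Longrightarrow> P i \<subset> P (Suc i)"
    by auto
  let ?P = "\<lambda>i. {r \<in> carrier R. \<pi> r \<in> P i}"
  have sub: "P i \<subseteq> carrier (R Quot I)" if "i \<le> d" for i
    using additive_subgroup.a_subset[OF ideal.axioms(1)[OF primeideal.axioms(1)[OF P(1)[OF that]]]] .
  have "primeideal (?P i) R" if "i \<le> d" for i
    by (rule ring_hom_ring.primeideal_vimage[OF ideal.rcos_ring_hom_ring[OF ideal_I] R.is_cring P(1)[OF that]])
  moreover have "?P i \<subset> ?P (Suc i)" if i: "i < d" for i
  proof -
    obtain x where x: "x \<in> P (Suc i)" "x \<notin> P i" using P(2)[OF i] by blast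
    then obtain r where "r \<in> carrier R" "x = \<pi> r"
      using sub[of "Suc i"] i by (auto simp: FactRing_def A_RCOSETS_def')
    with x P(2)[OF i] show ?thesis by blast
  qed
  moreover have "I \<subseteq> ?P 0"
  proof
    fix p assume p: "p \<in> I"
    have "\<zero>\<^bsub>R Quot I\<^esub> \<in> P 0"
      using additive_subgroup.zero_closed[OF ideal.axioms(1)[OF primeideal.axioms(1)[OF P(1)]]] by blast
    moreover have "\<pi> p = I"
      using p idealD(1)[OF ideal_I] additive_subgroup.a_subgroup[OF ideal.axioms(1)[OF ideal_I]]
      by (intro R.a_coset_join2) auto
    ultimately show "p \<in> ?P 0" using p idealD(1)[OF ideal_I] by (auto simp: FactRing_def)
  qed
  ultimately show thesis by (rule that)
qed

text \<open>Besides the bound itself, this yields contradictions from families with fewer than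
  \<open>d\<close> members: the empty one, or \<open>d\<close> forms with a redundant one
  dropped.\<close>

lemma reduction_generators_ge:
  assumes "finite B" "\<And>i. i \<in> B \<Longrightarrow> z i \<in> forms m 1" "forms m n \<subseteq> adjoin m I B z"
  shows "d \<le> card B"
proof -
  obtain P where P: "\<And>i. i \<le> d \<Longrightarrow> primeideal (P i) R" "\<And>i. i < d \<Longrightarrow> P i \<subset> P (Suc i)" "I \<subseteq> P 0"
    by (rule prime_chain_exists) (rule that)
  show ?thesis by (rule prime_chain_length_le[OF homogeneous assms P])
qed

text \<open>Without variables the only linear form is 0, so the empty family would generate a
  reduction, against \<open>d \<ge> 1\<close>. Positivity makes the binomial coefficient with
  \<open>m - 1\<close> count monomials.\<close>

lemma m_pos: "m \<ge> 1"
proof (rule ccontr)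
  assume "\<not> m \<ge> 1"
  then have "m = 0" by simp
  then have "monomials m 1 = {}" by (auto simp: monomials_def)
  then have "forms m 1 \<subseteq> (adjoin m I {} (\<lambda>_::nat. 0))"
    using keys_forms[of _ m 1] idealD(2)[OF ideal_I] by (auto simp: adjoin_def)
  from reduction_generators_ge[OF _ _ this] dimension(2) show False by simp
qed

definition linear_tuple :: "(nat \<Rightarrow> (nat, 'k) mpol) \<Rightarrow> bool"
  where "linear_tuple z \<longleftrightarrow> (\<forall>i<d. z i \<in> forms m 1)"

lemma homogeneous_H: "linear_tuple z \<Longrightarrow> homogeneous_ideal m (H z)"
  by (rule homogeneous_adjoin[OF homogeneous, where e = "\<lambda>_. 1"]) (simp add: linear_tuple_def)

lemma ideal_H: "linear_tuple z \<Longrightarrow> ideal (H z) R"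
  by (rule homogeneous_idealD(1)[OF homogeneous_H])

lemma I_subset_H: "I \<subseteq> H z"
  by (rule adjoin_superset[OF ideal_I])

lemma H_component:
  assumes "linear_tuple z" "p \<in> H z"
  obtains p0 q where "p0 \<in> I" "p0 \<in> forms m n"
    "\<And>i. i < d \<Longrightarrow> 1 \<le> n \<Longrightarrow> q i \<in> forms m (n - 1)"
    "\<And>i. i < d \<Longrightarrow> \<not> 1 \<le> n \<Longrightarrow> q i = 0"
    "hom_component n p = p0 + (\<Sum>i<d. z i * q i)"
proof (rule adjoin_component[where n = n and e = "\<lambda>_. 1", OF homogeneous _ assms(2)])
  show "z i \<in> forms m 1" if "i \<in> {..<d}" for i
    using assms(1) that by (simp add: linear_tuple_def)
qed (rule that, auto)

text \<open>The \<open>z i\<close> have degree 1, so in degree 0 \<open>H z\<close> agrees with the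
  proper ideal \<open>I\<close>. This makes reduction number 0 a jump like any other in
  \<open>minimal_reduction_numbers_eq\<close>.\<close>

lemma not_forms_0_subset_H:
  assumes "linear_tuple z"
  shows "\<not> forms m 0 \<subseteq> H z"
proof
  assume "forms m 0 \<subseteq> H z"
  then have "1 \<in> H z" using cst_forms[of 1 m] by auto
  then obtain p0 q where "p0 \<in> I" "p0 \<in> forms m 0"
    "\<And>i. i < d \<Longrightarrow> 1 \<le> (0::nat) \<Longrightarrow> q i \<in> forms m (0 - 1)"
    "\<And>i. i < d \<Longrightarrow> \<not> 1 \<le> (0::nat) \<Longrightarrow> q i = 0" "hom_component 0 1 = p0 + (\<Sum>i<d. z i * q i)"
    by (rule H_component[OF assms]) (rule that)
  then have "hom_component 0 1 \<in> I" by simp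
  moreover have "hom_component 0 1 = (1 :: (nat, 'k) mpol)"
    using hom_component_of_form[OF cst_forms[of "1::'k" m], of 0] by simp
  ultimately show False using one_notin by simp
qed

lemma reduction_quot_iff:
  assumes "ideal J R" "I \<subseteq> J"
  shows "\<pi> ` J \<inter> quot_piece m I n = quot_piece m I n \<longleftrightarrow> forms m n \<subseteq> J"
  using R.quot_image_subset_iff[OF ideal_I assms forms_carrier[of m n]]
  by (auto simp: quot_piece_def poly_ring_def)

lemma is_reduction_iff:
  "is_reduction (R Quot I) (quot_piece m I) Q \<longleftrightarrow>
    (\<exists>L \<subseteq> forms m 1. Q = \<pi> ` genideal R (I \<union> L) \<and> (\<exists>n. forms m n \<subseteq> genideal R (I \<union> L)))"
proof -
  have S: "S \<subseteq> quot_piece m I 1 \<longleftrightarrow> (\<exists>L \<subseteq> forms m 1. S = \<pi> ` L)" for S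
    unfolding quot_piece_def poly_ring_def by (auto simp: subset_image_iff)
  have G: "(\<exists>n0. \<forall>n\<ge>n0. \<pi> ` genideal R (I \<union> L) \<inter> quot_piece m I n = quot_piece m I n) \<longleftrightarrow>
      (\<exists>n. forms m n \<subseteq> genideal R (I \<union> L))" if "L \<subseteq> forms m 1" for L
  proof -
    have IL: "I \<union> L \<subseteq> carrier R" using that forms_carrier idealD(1)[OF ideal_I] by blast
    have "I \<subseteq> genideal R (I \<union> L)" using genideal_mpol_ring(2)[OF IL] by blast
    note * = reduction_quot_iff[OF genideal_mpol_ring(1)[OF IL] this]
    show ?thesis
      unfolding * using forms_subset_mono[OF genideal_mpol_ring(1)[OF IL]] by blast
  qed
  have gen: "genideal (R Quot I) (\<pi> ` L) = \<pi> ` genideal R (I \<union> L)" if "L \<subseteq> forms m 1" for L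
    by (rule R.genideal_quot_image[OF ideal_I subset_trans[OF that forms_carrier]])
  show ?thesis
  proof
    assume "is_reduction (R Quot I) (quot_piece m I) Q"
    then obtain S where S': "S \<subseteq> quot_piece m I 1" "Q = genideal (R Quot I) S"
      and red: "\<exists>n0. \<forall>n\<ge>n0. Q \<inter> quot_piece m I n = quot_piece m I n"
      unfolding is_reduction_def by blast
    obtain L where L: "L \<subseteq> forms m 1" "S = \<pi> ` L" using S'(1) unfolding S by (elim exE conjE) (rule that)
    have "Q = \<pi> ` genideal R (I \<union> L)" unfolding S'(2) L(2) by (rule gen[OF L(1)])
    with red G[OF L(1)] L(1)
    show "\<exists>L\<subseteq>forms m 1. Q = \<pi> ` genideal R (I \<union> L) \<and> (\<exists>n. forms m n \<subseteq> genideal R (I \<union> L))"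
      by (intro exI[of _ L]) simp
  next
    assume "\<exists>L\<subseteq>forms m 1. Q = \<pi> ` genideal R (I \<union> L) \<and> (\<exists>n. forms m n \<subseteq> genideal R (I \<union> L))"
    then obtain L where L: "L \<subseteq> forms m 1" and Q: "Q = \<pi> ` genideal R (I \<union> L)"
      and red: "\<exists>n. forms m n \<subseteq> genideal R (I \<union> L)" by (elim exE conjE) (rule that, auto)
    have "\<pi> ` L \<subseteq> quot_piece m I 1" unfolding S using L by (intro exI[of _ L]) simp
    then show "is_reduction (R Quot I) (quot_piece m I) Q"
      unfolding is_reduction_def using red G[OF L] gen[OF L] Q
      by (intro conjI exI[of _ "\<pi> ` L"]) simp_all
  qed
qed

lemma H_eq_genideal: "linear_tuple z \<Longrightarrow> H z = genideal R (I \<union> z ` {..<d})"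
  by (rule adjoin_eq_genideal[OF ideal_I]) (use forms_carrier in \<open>auto simp: linear_tuple_def\<close>)

lemma is_reduction_H:
  assumes "linear_tuple z" "forms m n \<subseteq> H z"
  shows "is_reduction (R Quot I) (quot_piece m I) (\<pi> ` H z)"
  unfolding is_reduction_iff using assms H_eq_genideal[OF assms(1)]
  by (intro exI[of _ "z ` {..<d}"]) (auto simp: linear_tuple_def)

text \<open>The \<open>d\<close> forms are sought in the space of all linear forms in the preimage
  of \<open>Q\<close>; hence the ideal they generate stays within \<open>Q\<close>.\<close>

lemma reduction_contains_H:
  assumes "is_reduction (R Quot I) (quot_piece m I) Q"
  obtains z n where "linear_tuple z" "forms m n \<subseteq> H z" "\<pi> ` H z \<subseteq> Q"
proof -
  obtain L n0 where L: "L \<subseteq> forms m 1" "Q = \<pi> ` genideal R (I \<union> L)" "forms m n0 \<subseteq> genideal R (I \<union> L)"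
    using assms unfolding is_reduction_iff by blast
  have IL: "I \<union> L \<subseteq> carrier R" using L(1) forms_carrier idealD(1)[OF ideal_I] by blast
  let ?J = "genideal R (I \<union> L)"
  note gen = genideal_mpol_ring[OF IL]
  have "\<exists>z. (\<forall>i<d. z i \<in> forms m 1 \<inter> ?J) \<and> (\<exists>n. forms m n \<subseteq> H z)"
  proof (rule exists_small_reduction[OF infinite_field homogeneous])
    show "mpol.subspace (forms m 1 \<inter> ?J)"
      by (intro mpol.subspace_inter subspace_forms subspace_ideal[OF gen(1)])
    show "forms m n0 \<subseteq> K" if "ideal K R" "I \<subseteq> K" "forms m 1 \<inter> ?J \<subseteq> K" for K
      using gen(2) gen(3)[OF that(1)] that L(1,3) by blast
    show "n \<le> d" if "\<And>i. i \<le> n \<Longrightarrow> primeideal (P i) R" "\<And>i. i < n \<Longrightarrow> P i \<subset> P (Suc i)" "I \<subseteq> P 0" for P n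
      using that by (rule prime_chain_le[of n P])
  qed blast
  then obtain z n where z: "\<And>i. i < d \<Longrightarrow> z i \<in> forms m 1 \<inter> ?J" "forms m n \<subseteq> H z" by blast
  have "H z \<subseteq> ?J"
    using z gen(2) by (intro adjoin_minimal[OF gen(1)]) auto
  with z that[of z n] L(2) show thesis by (auto simp: linear_tuple_def)
qed

text \<open>In degree 1 the inclusion writes each \<open>z' i\<close> as a combination of the
  \<open>z l\<close> modulo \<open>I\<close>. Together with \<open>z j\<close> these are
  \<open>d + 1\<close> elements in the span of \<open>d\<close>, so they satisfy a relation modulo
  \<open>I\<close>. It either expresses \<open>z j\<close> through the \<open>z' i\<close>, or makes
  one \<open>z' i\<close> redundant and leaves a reduction with \<open>d - 1\<close>
  generators.\<close>

lemma H_minimal: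
  assumes z: "linear_tuple z" and z': "linear_tuple z'" "forms m n \<subseteq> H z'" and sub: "H z' \<subseteq> H z"
  shows "H z \<subseteq> H z'"
proof (rule adjoin_minimal[OF ideal_H[OF z'(1)] I_subset_H])
  fix j assume "j \<in> {..<d}"
  then have j: "j < d" by simp
  \<comment> \<open>The family is indexed by \<open>{..d}\<close>: position \<open>d\<close> holds
    \<open>z j\<close>, the others hold the \<open>z' i\<close>.\<close>
  define b where "b i = (if i < d then z' i else z j)" for i
  have "b i \<in> mpol.span (z ` {..<d} \<union> I)" if "i \<in> {..d}" for i
  proof (cases "i < d")
    case True
    have form: "z' i \<in> forms m 1" using z'(1) True by (simp add: linear_tuple_def)
    have "z' i \<in> H z" using adjoin_superset(2)[OF ideal_I, of "{..<d}" i z'] True sub by auto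
    then obtain p0 q where p0: "p0 \<in> I" "p0 \<in> forms m 1"
      and q: "\<And>l. l < d \<Longrightarrow> 1 \<le> (1::nat) \<Longrightarrow> q l \<in> forms m (1 - 1)"
      "\<And>l. l < d \<Longrightarrow> \<not> 1 \<le> (1::nat) \<Longrightarrow> q l = 0"
      and sum: "hom_component 1 (z' i) = p0 + (\<Sum>l<d. z l * q l)"
      by (rule H_component[OF z]) (rule that)
    have swap: "z l * q l = cst (Poly_Mapping.lookup (q l) 0) * z l" if "l < d" for l
      using forms_0[of "q l" m] q(1)[OF that] by (simp add: mult.commute)
    have eq: "(\<Sum>l<d. z l * q l) = (\<Sum>l<d. cst (Poly_Mapping.lookup (q l) 0) * z l)"
      by (intro sum.cong refl swap) simp
    have "z' i = p0 + (\<Sum>l<d. cst (Poly_Mapping.lookup (q l) 0) * z l)"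
      using sum hom_component_of_form[OF form, of 1] eq by simp
    also have "\<dots> \<in> mpol.span (z ` {..<d} \<union> I)"
      using p0(1) by (intro mpol.span_add mpol.span_sum mpol.span_scale) (auto intro: mpol.span_base)
    finally show ?thesis using True by (simp add: b_def)
  qed (use j in \<open>auto simp: b_def intro: mpol.span_base\<close>)
  moreover have "card (z ` {..<d}) < card {..d}" using card_image_le[of "{..<d}" z] by simp
  ultimately have "\<exists>c. (\<exists>i\<in>{..d}. c i \<noteq> 0) \<and> (\<Sum>i\<in>{..d}. cst (c i) * b i) \<in> I"
    by (intro dependent_modulo[OF _ subspace_ideal[OF ideal_I]]) auto
  then obtain c i where c: "i \<le> d" "c i \<noteq> 0" "(\<Sum>i\<in>{..d}. cst (c i) * b i) \<in> I" by auto
  have cH: "(\<Sum>i\<in>{..d}. cst (c i) * b i) \<in> H z'" using c(3) I_subset_H by blast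
  show "z j \<in> H z'"
  proof (cases "c d = 0")
    case False
    have "b d \<in> H z'"
      by (rule solve_relation[where c = c and T = "{..d}", OF ideal_H[OF z'(1)] _ _ False cH])
         (auto simp: b_def intro!: adjoin_superset(2)[OF ideal_I])
    then show ?thesis by (simp add: b_def)
  next
    case True
    with c have i: "i < d" by (cases "i = d") auto
    let ?B = "{..<d} - {i}"
    let ?K = "adjoin m I ?B z'"
    have lin: "z' l \<in> forms m 1" if "l \<in> {..<d}" for l using z'(1) that by (simp add: linear_tuple_def)
    have iK: "ideal ?K R"
      using lin forms_carrier by (intro ideal_adjoin[OF ideal_I]) auto
    have "(\<Sum>l\<in>{..d}. cst (c l) * b l) = (\<Sum>l\<in>{..<d}. cst (c l) * z' l)"
      using True by (simp add: lessThan_Suc_atMost[symmetric] b_def)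
    then have "(\<Sum>l\<in>{..<d}. cst (c l) * z' l) \<in> ?K"
      using c(3) adjoin_superset(1)[OF ideal_I] by auto
    then have "z' i \<in> ?K"
      by (intro solve_relation[where c = c and T = "{..<d}" and b = z', OF iK _ _ c(2)])
         (use i in \<open>auto intro!: adjoin_superset(2)[OF ideal_I]\<close>)
    then have "z' l \<in> ?K" if "l \<in> {..<d}" for l
      using that by (cases "l = i") (auto intro!: adjoin_superset(2)[OF ideal_I])
    then have "H z' \<subseteq> ?K"
      using adjoin_superset(1)[OF ideal_I] by (intro adjoin_minimal[OF iK])
    then have "d \<le> card ?B"
      using z'(2) lin by (intro reduction_generators_ge[where z = z']) auto
    then show ?thesis using i by simp
  qed
qed

text \<open>Every reduction contains one generated by \<open>d\<close> forms, and by
  \<open>H_minimal\<close> none of the latter properly contains another.\<close>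

lemma is_minimal_reduction_iff:
  "is_minimal_reduction (R Quot I) (quot_piece m I) Q \<longleftrightarrow>
    (\<exists>z n. linear_tuple z \<and> forms m n \<subseteq> H z \<and> Q = \<pi> ` H z)"
proof
  assume min: "is_minimal_reduction (R Quot I) (quot_piece m I) Q"
  then obtain z n where z: "linear_tuple z" "forms m n \<subseteq> H z" "\<pi> ` H z \<subseteq> Q"
    unfolding is_minimal_reduction_def by (auto elim: reduction_contains_H)
  with min is_reduction_H[OF z(1,2)] show "\<exists>z n. linear_tuple z \<and> forms m n \<subseteq> H z \<and> Q = \<pi> ` H z"
    unfolding is_minimal_reduction_def by metis
next
  assume "\<exists>z n. linear_tuple z \<and> forms m n \<subseteq> H z \<and> Q = \<pi> ` H z"
  then obtain z n where z: "linear_tuple z" "forms m n \<subseteq> H z" and Q: "Q = \<pi> ` H z" by blast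
  have "Q' = Q" if Q': "is_reduction (R Quot I) (quot_piece m I) Q'" "Q' \<subseteq> Q" for Q'
  proof -
    obtain z' n' where z': "linear_tuple z'" "forms m n' \<subseteq> H z'" "\<pi> ` H z' \<subseteq> Q'"
      by (rule reduction_contains_H[OF Q'(1)]) (rule that)
    have "\<pi> ` H z' \<subseteq> \<pi> ` H z" using z'(3) Q'(2) Q by blast
    then have "H z' \<subseteq> H z"
      using R.quot_image_subset_iff[OF ideal_I ideal_H[OF z(1)] I_subset_H idealD(1)[OF ideal_H[OF z'(1)]]] by blast
    then have "H z \<subseteq> H z'" by (rule H_minimal[OF z(1) z'(1,2)])
    with z'(3) Q'(2) Q show ?thesis by blast
  qed
  with is_reduction_H[OF z] Q show "is_minimal_reduction (R Quot I) (quot_piece m I) Q"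
    unfolding is_minimal_reduction_def by blast
qed

text \<open>Containing \<open>forms m n\<close> persists to larger \<open>n\<close>, so for each
  reduction it starts at exactly one place, and the least \<open>n\<close> in the reduction number
  is the step just before it.\<close>

lemma minimal_reduction_numbers_eq:
  "minimal_reduction_numbers (R Quot I) (quot_piece m I) =
    {n. \<exists>z. linear_tuple z \<and> forms m (n + 1) \<subseteq> H z \<and> \<not> forms m n \<subseteq> H z}" (is "_ = ?E")
proof -
  have num: "reduction_number (quot_piece m I) (\<pi> ` H z) = (LEAST n. forms m (n + 1) \<subseteq> H z)"
    if "linear_tuple z" for z
    unfolding reduction_number_def reduction_quot_iff[OF ideal_H[OF that] I_subset_H] ..
  have least: "forms m (k + 1) \<subseteq> H z \<and> \<not> forms m k \<subseteq> H z \<longleftrightarrow>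
      (\<exists>n. forms m n \<subseteq> H z) \<and> k = (LEAST n. forms m (n + 1) \<subseteq> H z)" if z: "linear_tuple z" for z k
  proof
    assume k: "forms m (k + 1) \<subseteq> H z \<and> \<not> forms m k \<subseteq> H z"
    have "k \<le> n" if n: "forms m (n + 1) \<subseteq> H z" for n
    proof (rule ccontr)
      assume "\<not> k \<le> n"
      then have "n + 1 \<le> k" by simp
      with forms_subset_mono[OF ideal_H[OF z] n] k show False by blast
    qed
    with k show "(\<exists>n. forms m n \<subseteq> H z) \<and> k = (LEAST n. forms m (n + 1) \<subseteq> H z)"
      by (metis (mono_tags, lifting) Least_equality)
  next
    assume k: "(\<exists>n. forms m n \<subseteq> H z) \<and> k = (LEAST n. forms m (n + 1) \<subseteq> H z)"
    then obtain n where "forms m n \<subseteq> H z" by blast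
    then have "forms m (n + 1) \<subseteq> H z" by (rule forms_subset_mono[OF ideal_H[OF z]]) simp
    then have "forms m (k + 1) \<subseteq> H z" using k LeastI[of "\<lambda>n. forms m (n + 1) \<subseteq> H z" n] by blast
    moreover have "\<not> forms m k \<subseteq> H z"
    proof (cases k)
      case 0
      then show ?thesis using not_forms_0_subset_H[OF z] by simp
    next
      case (Suc l)
      then show ?thesis using k not_less_Least[of l "\<lambda>n. forms m (n + 1) \<subseteq> H z"] by simp
    qed
    ultimately show "forms m (k + 1) \<subseteq> H z \<and> \<not> forms m k \<subseteq> H z" by blast
  qed
  show ?thesis
  proof (rule Set.set_eqI, rule iffI)
    fix k assume "k \<in> minimal_reduction_numbers (R Quot I) (quot_piece m I)"
    then obtain z n where "linear_tuple z" "forms m n \<subseteq> H z" "k = reduction_number (quot_piece m I) (\<pi> ` H z)"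
      unfolding minimal_reduction_numbers_def is_minimal_reduction_iff by blast
    then have "(\<exists>n. forms m n \<subseteq> H z) \<and> k = (LEAST n. forms m (n + 1) \<subseteq> H z)"
      using num by (auto simp del: One_nat_def Suc_eq_plus1)
    then have "forms m (k + 1) \<subseteq> H z \<and> \<not> forms m k \<subseteq> H z" by (rule iffD2[OF least[OF \<open>linear_tuple z\<close>]])
    with \<open>linear_tuple z\<close> show "k \<in> ?E" by blast
  next
    fix k assume "k \<in> ?E"
    then obtain z where z: "linear_tuple z" "forms m (k + 1) \<subseteq> H z \<and> \<not> forms m k \<subseteq> H z" by blast
    have "k = reduction_number (quot_piece m I) (\<pi> ` H z)"
      using iffD1[OF least[OF z(1)] z(2)] num[OF z(1)] by simp
    moreover have "is_minimal_reduction (R Quot I) (quot_piece m I) (\<pi> ` H z)"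
      unfolding is_minimal_reduction_iff using z by (intro exI[of _ z] exI[of _ "k + 1"]) simp
    ultimately show "k \<in> minimal_reduction_numbers (R Quot I) (quot_piece m I)"
      unfolding minimal_reduction_numbers_def by (intro CollectI exI[of _ "\<pi> ` H z"] conjI)
  qed
qed

text \<open>All linear forms together generate a reduction, which contains a minimal one.\<close>

lemma minimal_reduction_numbers_nonempty:
  "minimal_reduction_numbers (R Quot I) (quot_piece m I) \<noteq> {}"
proof -
  have IL: "I \<union> forms m 1 \<subseteq> carrier R" using forms_carrier idealD(1)[OF ideal_I] by blast
  have "is_reduction (R Quot I) (quot_piece m I) (\<pi> ` genideal R (I \<union> forms m 1))"
    unfolding is_reduction_iff using genideal_mpol_ring(2)[OF IL] by blast
  then obtain z n where z: "linear_tuple z" "forms m n \<subseteq> H z"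
    by (rule reduction_contains_H)
  then have "is_minimal_reduction (R Quot I) (quot_piece m I) (\<pi> ` H z)"
    unfolding is_minimal_reduction_iff by blast
  then show ?thesis unfolding minimal_reduction_numbers_def by blast
qed

end

section \<open>Evaluation and minors\<close>

definition mon_eval :: "('x \<Rightarrow> 'a::comm_ring_1) \<Rightarrow> 'x monom \<Rightarrow> 'a"
  where "mon_eval a t = (\<Prod>x\<in>Poly_Mapping.keys t. a x ^ Poly_Mapping.lookup t x)"

lemma mon_eval_superset:
  "finite X \<Longrightarrow> Poly_Mapping.keys t \<subseteq> X \<Longrightarrow> mon_eval a t = (\<Prod>x\<in>X. a x ^ Poly_Mapping.lookup t x)"
  unfolding mon_eval_def by (intro prod.mono_neutral_left) (auto simp: in_keys_iff)

lemma mon_eval_add: "mon_eval a (s + t) = mon_eval a s * mon_eval a t"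
proof -
  let ?X = "Poly_Mapping.keys s \<union> Poly_Mapping.keys t"
  have "mon_eval a u = (\<Prod>x\<in>?X. a x ^ Poly_Mapping.lookup u x)" if "u \<in> {s, t, s + t}" for u
    using that by (intro mon_eval_superset) (auto simp: keys_add_nat)
  then show ?thesis by (simp add: lookup_add power_add prod.distrib)
qed

lemma mpol_eval_mon_eval:
  "mpol_eval a p = (\<Sum>t\<in>Poly_Mapping.keys p. Poly_Mapping.lookup p t * mon_eval a t)"
  by (simp add: mpol_eval_def mon_eval_def)

lemma mpol_eval_add: "mpol_eval a (p + q) = mpol_eval a p + mpol_eval a q"
  unfolding mpol_eval_mon_eval by (rule setsum_keys_plus_distrib) (auto simp: distrib_right)

lemma mpol_eval_zero [simp]: "mpol_eval a 0 = 0"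
  by (simp add: mpol_eval_def)

lemma mpol_eval_sum: "mpol_eval a (sum p A) = (\<Sum>i\<in>A. mpol_eval a (p i))"
  by (induction A rule: infinite_finite_induct) (auto simp: mpol_eval_add)

lemma mpol_eval_single: "mpol_eval a (Poly_Mapping.single t c) = c * mon_eval a t"
  by (simp add: mpol_eval_mon_eval)

lemma mpol_eval_mult:
  fixes p q :: "('x, 'a::comm_ring_1) mpol"
  shows "mpol_eval a (p * q) = mpol_eval a p * mpol_eval a q"
proof -
  let ?S = "\<lambda>p :: ('x, 'a) mpol. \<Sum>t\<in>Poly_Mapping.keys p. Poly_Mapping.single t (Poly_Mapping.lookup p t)"
  have expand: "?S r = r" for r
    by (rule mpol_expand[symmetric]) auto
  have "mpol_eval a (?S p * ?S q) = mpol_eval a (?S p) * mpol_eval a (?S q)"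
    by (simp add: sum_product mpol_eval_sum mult_single mpol_eval_single mon_eval_add mult_ac)
  then show ?thesis by (simp only: expand)
qed

lemma mpol_eval_one [simp]: "mpol_eval a 1 = 1"
  by (simp add: mpol_eval_def)

lemma comm_ring_hom_mpol_eval: "comm_ring_hom (mpol_eval a)"
  by unfold_locales (simp_all add: mpol_eval_add mpol_eval_mult)

text \<open>Specialises the indeterminates u_ij in k[u][x] and keeps the x_j, so that a row of the
  generic matrix becomes the coefficient vector of an element of R.\<close>

definition eval_coeffs :: "('y \<Rightarrow> 'a::comm_ring_1) \<Rightarrow> ('x, ('y, 'a) mpol) mpol \<Rightarrow> ('x, 'a) mpol"
  where "eval_coeffs a = Poly_Mapping.map (mpol_eval a)"

lemma lookup_eval_coeffs: "Poly_Mapping.lookup (eval_coeffs a p) t = mpol_eval a (Poly_Mapping.lookup p t)"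
  by (simp add: eval_coeffs_def Poly_Mapping.map.rep_eq when_def)

lemma eval_coeffs_mult_mono: "eval_coeffs a (p * mon g) = eval_coeffs a p * mon g"
proof (rule poly_mapping_eqI)
  fix t
  \<comment> \<open>Evaluation may kill coefficients, so the sum runs over the keys of
    \<open>p\<close>, which include those of \<open>eval_coeffs a p\<close>.\<close>
  have "Poly_Mapping.lookup (eval_coeffs a p * mon g) t =
     (\<Sum>s\<in>Poly_Mapping.keys p. if s + g = t then Poly_Mapping.lookup (eval_coeffs a p) s * 1 else 0)"
    unfolding lookup_mult_single
    by (intro sum.mono_neutral_left) (auto simp: in_keys_iff lookup_eval_coeffs)
  also have "\<dots> = Poly_Mapping.lookup (eval_coeffs a (p * mon g)) t"
    unfolding lookup_eval_coeffs lookup_mult_single mpol_eval_sum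
    by (intro sum.cong) auto
  finally show "Poly_Mapping.lookup (eval_coeffs a (p * mon g)) t = Poly_Mapping.lookup (eval_coeffs a p * mon g) t" ..
qed

definition linear_form :: "nat \<Rightarrow> (nat \<times> nat \<Rightarrow> 'k::field) \<Rightarrow> nat \<Rightarrow> (nat, 'k) mpol"
  where "linear_form m a i = (\<Sum>j<m. cst (a (i, j)) * var j)"

lemma linear_form_forms: "linear_form m a i \<in> forms m 1"
  unfolding linear_form_def
  by (intro forms_sum mpol.subspace_scale[OF subspace_forms] var_forms) simp

lemma eval_coeffs_generic_form: "eval_coeffs a (generic_form m i) = linear_form m a i"
proof (rule poly_mapping_eqI)
  fix t
  have "mpol_eval a (Poly_Mapping.lookup (Poly_Mapping.single (Poly_Mapping.single j 1)
      (Poly_Mapping.single (Poly_Mapping.single (i, j) 1) 1)) t) =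
      Poly_Mapping.lookup (cst (a (i, j)) * var j) t" for j
    by (simp add: lookup_single when_def mpol_eval_single mon_eval_def lookup_cst_mult)
  then show "Poly_Mapping.lookup (eval_coeffs a (generic_form m i)) t = Poly_Mapping.lookup (linear_form m a i) t"
    by (simp add: lookup_eval_coeffs generic_form_def linear_form_def lookup_sum mpol_eval_sum)
qed

lemma eval_coeffs_lift_coeffs: "eval_coeffs a (lift_coeffs p) = p"
  by (rule poly_mapping_eqI)
     (simp add: lookup_eval_coeffs lift_coeffs_def Poly_Mapping.map.rep_eq when_def mpol_eval_single mon_eval_def)

text \<open>Stars and bars on exponent lists. The value is the number of columns of
  \<open>M_n(u)\<close>, so a minor of this size uses every column and only its rows vary.\<close>

lemma card_monomials:
  assumes "m \<ge> 1"
  shows "card (monomials m n) = (n + m - 1) choose (m - 1)"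
proof -
  let ?L = "{xs :: nat list. length xs = m \<and> sum_list xs = n}"
  have "bij_betw (\<lambda>t. map (Poly_Mapping.lookup t) [0..<m]) (monomials m n) ?L"
  proof (rule bij_betw_byWitness[where f' = "\<lambda>xs. \<Sum>j<m. Poly_Mapping.single j (xs ! j)"])
    have deg: "mono_deg t = (\<Sum>j<m. Poly_Mapping.lookup t j)" if "Poly_Mapping.keys t \<subseteq> {..<m}" for t :: "nat monom"
      by (rule mono_deg_superset[OF _ that]) simp
    have lk: "Poly_Mapping.lookup (\<Sum>j<l. Poly_Mapping.single j (xs ! j)) i = (if i < l then xs ! i else 0)"
      for xs :: "nat list" and i l
      by (simp add: lookup_sum lookup_single when_def)
    show "\<forall>t\<in>monomials m n. (\<Sum>j<m. Poly_Mapping.single j (map (Poly_Mapping.lookup t) [0..<m] ! j)) = t"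
      by (auto simp: monomials_def intro!: mpol_expand[symmetric])
    show "\<forall>xs\<in>?L. map (Poly_Mapping.lookup (\<Sum>j<m. Poly_Mapping.single j (xs ! j))) [0..<m] = xs"
      by (auto intro!: nth_equalityI simp: lk)
    show "(\<lambda>t. map (Poly_Mapping.lookup t) [0..<m]) ` monomials m n \<subseteq> ?L"
      by (auto simp: monomials_def deg interv_sum_list_conv_sum_set_nat atLeast0LessThan)
    show "(\<lambda>xs. \<Sum>j<m. Poly_Mapping.single j (xs ! j)) ` ?L \<subseteq> monomials m n"
    proof clarify
      fix xs :: "nat list" assume xs: "m = length xs" "n = sum_list xs"
      let ?t = "\<Sum>j<length xs. Poly_Mapping.single j (xs ! j)"
      have "Poly_Mapping.keys ?t \<subseteq> {..<length xs}"
        using lk[of xs] xs(1) by (auto simp: in_keys_iff split: if_splits)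
      moreover from deg[of ?t] this xs have "mono_deg ?t = sum_list xs"
        using lk[of xs] by (simp add: sum_list_sum_nth atLeast0LessThan)
      ultimately show "?t \<in> monomials (length xs) (sum_list xs)" by (simp add: monomials_def)
    qed
  qed
  then have "card (monomials m n) = (n + m - 1) choose n"
    using card_length_sum_list[of m n] by (simp add: bij_betw_same_card)
  also have "\<dots> = (n + m - 1) choose (m - 1)"
    using binomial_symmetric[of n "n + m - 1"] assms by simp
  finally show ?thesis .
qed

section \<open>Maximal minors and spanning sets of forms\<close>

lemma pick_lessThan: "i < n \<Longrightarrow> pick {..<n} i = i"
proof -
  assume "i < n"
  then have "{a \<in> {..<n}. a < i} = {..<i}" by auto
  with \<open>i < n\<close> pick_card_in_set[of i "{..<n}"] show ?thesis by simp
qed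

lemma pick_bij:
  assumes "finite S"
  shows "bij_betw (pick S) {..<card S} S"
proof (rule bij_betw_imageI)
  show inj: "inj_on (pick S) {..<card S}"
    by (rule inj_on_inverseI[where g = "\<lambda>x. card {a \<in> S. a < x}"]) (simp add: card_pick_le)
  show "pick S ` {..<card S} = S"
  proof (rule card_subset_eq[OF assms])
    show "pick S ` {..<card S} \<subseteq> S" using pick_in_set_le by auto
    show "card (pick S ` {..<card S}) = card S" using inj by (simp add: card_image)
  qed
qed

lemma lookup_form_eq_0:
  assumes "p \<in> forms m n" "t \<notin> monomials m n"
  shows "Poly_Mapping.lookup p t = 0"
proof -
  have "t \<notin> Poly_Mapping.keys p" using keys_forms[OF assms(1)] assms(2) by blast
  then show ?thesis by (simp add: in_keys_iff)
qed

lemma mono_eq_iff: "(mon s :: ('x, 'a::comm_ring_1) mpol) = mon t \<longleftrightarrow> s = t"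
proof
  assume "(mon s :: ('x, 'a) mpol) = mon t"
  then have "Poly_Mapping.keys (mon s :: ('x, 'a) mpol) = Poly_Mapping.keys (mon t :: ('x, 'a) mpol)" by simp
  then show "s = t" by simp
qed simp

lemma independent_monomials:
  "\<not> mpol.dependent (mon ` T :: ('x, 'k::field) mpol set)"
proof
  assume "mpol.dependent (mon ` T :: ('x, 'k) mpol set)"
  then obtain S :: "('x, 'k) mpol set" and u where S: "finite S" "S \<subseteq> mon ` T"
    "(\<Sum>v\<in>S. cst (u v) * v) = 0" "\<exists>v\<in>S. u v \<noteq> 0"
    unfolding mpol.dependent_explicit by blast
  then obtain t where t: "mon t \<in> S" "u (mon t) \<noteq> 0" by blast
  have "0 = Poly_Mapping.lookup (\<Sum>v\<in>S. cst (u v) * v) t" using S(3) by simp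
  also have "\<dots> = (\<Sum>v\<in>S. if v = mon t then u (mon t) else 0)"
    unfolding lookup_sum
  proof (rule sum.cong)
    fix v assume "v \<in> S"
    then obtain s where "v = mon s" using S(2) by blast
    then show "Poly_Mapping.lookup (cst (u v) * v) t = (if v = mon t then u (mon t) else 0)"
      by (auto simp: lookup_cst_mult lookup_single when_def mono_eq_iff)
  qed simp
  also have "\<dots> = u (mon t)" using S(1) t(1) by simp
  finally show False using t(2) by simp
qed

lemma card_basis_forms:
  fixes B :: "(nat, 'k::field) mpol set"
  assumes "\<not> mpol.dependent B" "B \<subseteq> forms m n" "forms m n \<subseteq> mpol.span B"
  shows "card B = card (monomials m n)"
proof -
  have inj: "inj_on (mon :: _ \<Rightarrow> (nat, 'k) mpol) (monomials m n)"
    by (auto simp: inj_on_def mono_eq_iff)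
  have "card B = mpol.dim (forms m n :: (nat, 'k) mpol set)"
    by (rule mpol.basis_card_eq_dim[OF assms(2,3,1)])
  also have "\<dots> = card (mon ` monomials m n :: (nat, 'k) mpol set)"
    by (rule mpol.basis_card_eq_dim[symmetric])
       (auto simp: forms_span independent_monomials intro: mpol.span_base)
  also have "\<dots> = card (monomials m n)" using inj by (rule card_image)
  finally show ?thesis .
qed

definition coeff_matrix :: "nat \<Rightarrow> nat \<Rightarrow> (nat, 'a::comm_ring_1) mpol list \<Rightarrow> 'a mat"
  where "coeff_matrix m n es = (let ts = sorted_list_of_set (monomials m n)
    in mat (length es) (length ts) (\<lambda>(r, c). Poly_Mapping.lookup (es ! r) (ts ! c)))"

text \<open>The adjugate of an invertible minor writes the determinant times each monomial as a
  combination of the chosen rows. Conversely, rows are chosen from a basis contained in the list,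
  one index per basis element; a kernel vector of the transposed minor would be a linear relation on
  this basis.\<close>

lemma spanning_iff_minor:
  fixes es :: "(nat, 'k::field) mpol list"
  assumes es: "set es \<subseteq> forms m n"
  defines "N \<equiv> card (monomials m n)"
  shows "forms m n \<subseteq> mpol.span (set es) \<longleftrightarrow>
    (\<exists>S \<subseteq> {..<length es}. card S = N \<and> det (submatrix (coeff_matrix m n es) S {..<N}) \<noteq> 0)"
proof -
  define ts where "ts = sorted_list_of_set (monomials m n)"
  have ts: "set ts = monomials m n" "length ts = N" "distinct ts"
    by (simp_all add: ts_def N_def)
  let ?M = "coeff_matrix m n es"
  let ?B = "\<lambda>S. submatrix ?M S {..<N}"
  have dims: "dim_row ?M = length es" "dim_col ?M = N"
    by (simp_all add: coeff_matrix_def Let_def ts ts_def[symmetric])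
  have B: "?B S \<in> carrier_mat N N"
    "\<And>r c. r < N \<Longrightarrow> c < N \<Longrightarrow> ?B S $$ (r, c) = Poly_Mapping.lookup (es ! pick S r) (ts ! c)"
    if S: "S \<subseteq> {..<length es}" "card S = N" for S
  proof -
    have rows: "{i. i < dim_row ?M \<and> i \<in> S} = S" and cols: "{j. j < dim_col ?M \<and> j \<in> {..<N}} = {..<N}"
      using S(1) by (auto simp: dims)
    show "?B S \<in> carrier_mat N N"
      by (rule carrier_matI) (simp_all only: dim_submatrix rows cols S(2) card_lessThan)
    fix r c assume rc: "r < N" "c < N"
    have "pick S r \<in> S" using rc(1) S(2) pick_in_set_le by simp
    then have "pick S r < length es" using S(1) by auto
    moreover have "?B S $$ (r, c) = ?M $$ (pick S r, pick {..<N} c)"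
      by (rule submatrix_index) (simp_all only: rows cols S(2) card_lessThan rc)
    ultimately show "?B S $$ (r, c) = Poly_Mapping.lookup (es ! pick S r) (ts ! c)"
      using rc(2) by (simp add: pick_lessThan coeff_matrix_def Let_def ts ts_def[symmetric])
  qed
  have pick_es: "es ! pick S r \<in> set es" if "S \<subseteq> {..<length es}" "card S = N" "r < N" for S r
    using that pick_in_set_le[of r S] by auto
  show ?thesis
  proof
    assume "\<exists>S \<subseteq> {..<length es}. card S = N \<and> det (?B S) \<noteq> 0"
    then obtain S where S: "S \<subseteq> {..<length es}" "card S = N" and det: "det (?B S) \<noteq> 0" by blast
    let ?adj = "adj_mat (?B S)"
    note adj = adj_mat[OF B(1)[OF S]]
    have "mon t \<in> mpol.span (set es)" if t: "t \<in> monomials m n" for t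
    proof -
      obtain c where c: "c < N" "ts ! c = t" using t ts by (metis in_set_conv_nth)
      \<comment> \<open>The coefficients are row \<open>c\<close> of the adjugate; comparing both
        sides at the monomial in column \<open>c'\<close> reads off entry \<open>(c, c')\<close> of
        adjugate times minor.\<close>
      have "(\<Sum>r<N. cst (?adj $$ (c, r)) * es ! pick S r) = cst (det (?B S)) * mon t"
      proof (rule poly_mapping_eqI)
        fix s
        show "Poly_Mapping.lookup (\<Sum>r<N. cst (?adj $$ (c, r)) * es ! pick S r) s =
          Poly_Mapping.lookup (cst (det (?B S)) * mon t) s"
        proof (cases "s \<in> monomials m n")
          case True
          then obtain c' where c': "c' < N" "ts ! c' = s" using ts by (metis in_set_conv_nth)
          have "(?adj * ?B S) $$ (c, c') = (\<Sum>r<N. ?adj $$ (c, r) * ?B S $$ (r, c'))"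
            using adj(1) B(1)[OF S] c c' by (simp add: scalar_prod_def atLeast0LessThan)
          also have "\<dots> = Poly_Mapping.lookup (\<Sum>r<N. cst (?adj $$ (c, r)) * es ! pick S r) s"
            using B(2)[OF S _ c'(1)] c'(2) by (simp add: lookup_sum lookup_cst_mult)
          also have "(?adj * ?B S) $$ (c, c') = (if c = c' then det (?B S) else 0)"
            unfolding adj(3) using c c' by simp
          also have "\<dots> = Poly_Mapping.lookup (cst (det (?B S)) * mon t) s"
            using c c' ts nth_eq_iff_index_eq[of ts c c']
            by (auto simp: lookup_cst_mult lookup_single when_def)
          finally show ?thesis ..
        next
          case False
          then have "Poly_Mapping.lookup (es ! pick S r) s = 0" if "r < N" for r
            using pick_es[OF S that] es by (intro lookup_form_eq_0) auto
          then show ?thesis using False t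
            by (auto simp: lookup_sum lookup_cst_mult lookup_single when_def)
        qed
      qed
      moreover have "(\<Sum>r<N. cst (?adj $$ (c, r)) * es ! pick S r) \<in> mpol.span (set es)"
        using pick_es[OF S] by (intro mpol.span_sum mpol.span_scale mpol.span_base) auto
      ultimately have "cst (det (?B S)) * mon t \<in> mpol.span (set es)" by simp
      then have "cst (inverse (det (?B S))) * (cst (det (?B S)) * mon t) \<in> mpol.span (set es)"
        by (rule mpol.span_scale)
      then show ?thesis using det by (simp add: mult_single flip: mult.assoc)
    qed
    then show "forms m n \<subseteq> mpol.span (set es)"
      unfolding forms_span by (intro mpol.span_minimal) auto
  next
    assume span: "forms m n \<subseteq> mpol.span (set es)"
    obtain B where Bs: "B \<subseteq> set es" "\<not> mpol.dependent B" "set es \<subseteq> mpol.span B"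
      by (rule mpol.maximal_independent_subset)
    have "mpol.span (set es) \<subseteq> mpol.span B" using Bs(3) by (intro mpol.span_minimal) auto
    then have cardB: "card B = N"
      unfolding N_def using Bs es span by (intro card_basis_forms) auto
    have "\<forall>b\<in>B. \<exists>r. r < length es \<and> es ! r = b" using Bs(1) by (metis in_set_conv_nth subsetD)
    then obtain ix where ix: "\<And>b. b \<in> B \<Longrightarrow> ix b < length es \<and> es ! ix b = b" by metis
    have inj_ix: "inj_on ix B" using ix by (metis inj_onI)
    let ?S = "ix ` B"
    have S: "?S \<subseteq> {..<length es}" "card ?S = N" using ix cardB inj_ix by (auto simp: card_image)
    have finB: "finite B" using Bs(1) finite_subset by blast
    have bij: "bij_betw (\<lambda>r. es ! pick ?S r) {..<N} B"
    proof -
      have "bij_betw (pick ?S) {..<N} ?S" using pick_bij[of ?S] finB S(2) by simp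
      moreover have "bij_betw (\<lambda>r. es ! r) ?S B"
        by (rule bij_betw_byWitness[where f' = ix]) (use ix in auto)
      ultimately show ?thesis using bij_betw_trans by (fastforce simp: comp_def)
    qed
    have "det (?B ?S) \<noteq> 0"
    proof
      assume "det (?B ?S) = 0"
      then have "det (transpose_mat (?B ?S)) = 0" using det_transpose[OF B(1)[OF S]] by simp
      moreover have Bt: "transpose_mat (?B ?S) \<in> carrier_mat N N" using B(1)[OF S] by simp
      ultimately obtain v where v: "v \<in> carrier_vec N" "v \<noteq> 0\<^sub>v N" "transpose_mat (?B ?S) *\<^sub>v v = 0\<^sub>v N"
        using det_0_iff_vec_prod_zero_field[OF Bt] by blast
      have zero: "(\<Sum>r<N. cst (v $ r) * es ! pick ?S r) = 0"
      proof (rule poly_mapping_eqI)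
        fix s
        show "Poly_Mapping.lookup (\<Sum>r<N. cst (v $ r) * es ! pick ?S r) s = Poly_Mapping.lookup 0 s"
        proof (cases "s \<in> monomials m n")
          case True
          then obtain c where c: "c < N" "ts ! c = s" using ts by (metis in_set_conv_nth)
          have "0 = (transpose_mat (?B ?S) *\<^sub>v v) $ c" using v(3) c(1) by simp
          also have "\<dots> = (\<Sum>r<N. ?B ?S $$ (r, c) * v $ r)"
            using B(1)[OF S] v(1) c(1) by (simp add: scalar_prod_def atLeast0LessThan)
          also have "\<dots> = Poly_Mapping.lookup (\<Sum>r<N. cst (v $ r) * es ! pick ?S r) s"
            using B(2)[OF S _ c(1)] c(2) by (simp add: lookup_sum lookup_cst_mult mult.commute)
          finally show ?thesis by simp
        next
          case False
          then have "Poly_Mapping.lookup (es ! pick ?S r) s = 0" if "r < N" for r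
            using pick_es[OF S that] es by (intro lookup_form_eq_0) auto
          then show ?thesis by (simp add: lookup_sum lookup_cst_mult)
        qed
      qed
      let ?g = "\<lambda>r. es ! pick ?S r"
      let ?h = "the_inv_into {..<N} ?g"
      have inj: "inj_on ?g {..<N}" using bij by (rule bij_betw_imp_inj_on)
      have "(\<Sum>b\<in>B. cst (v $ ?h b) * b) = (\<Sum>r<N. cst (v $ ?h (?g r)) * ?g r)"
        using sum.reindex_bij_betw[OF bij, of "\<lambda>b. cst (v $ ?h b) * b"] by simp
      also have "\<dots> = (\<Sum>r<N. cst (v $ r) * ?g r)"
        using the_inv_into_f_f[OF inj] by (intro sum.cong) auto
      finally have sumB: "(\<Sum>b\<in>B. cst (v $ ?h b) * b) = 0" using zero by simp
      have "v $ r = 0" if r: "r < N" for r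
      proof -
        have "?g r \<in> B" using bij r by (auto simp: bij_betw_def)
        then have "v $ ?h (?g r) = 0"
          using mpol.independentD[OF Bs(2) finB subset_refl sumB] by blast
        then show ?thesis using the_inv_into_f_f[OF inj, of r] r by simp
      qed
      then have "v = 0\<^sub>v N" using v(1) by (intro eq_vecI) auto
      with v(2) show False by blast
    qed
    with S show "\<exists>S \<subseteq> {..<length es}. card S = N \<and> det (?B S) \<noteq> 0" by blast
  qed
qed

section \<open>Rows of the generic matrix and their values at a point\<close>

lemma mult_form_span:
  fixes z :: "(nat, 'k::field) mpol"
  assumes "q \<in> forms m k"
  shows "z * q \<in> mpol.span ((\<lambda>h. z * mon h) ` monomials m k)"
proof -
  have "z * q = z * (\<Sum>t\<in>monomials m k. cst (Poly_Mapping.lookup q t) * mon t)"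
    using forms_expand[OF assms] by simp
  also have "\<dots> = (\<Sum>t\<in>monomials m k. cst (Poly_Mapping.lookup q t) * (z * mon t))"
    by (simp add: sum_distrib_left mult_ac)
  also have "\<dots> \<in> mpol.span ((\<lambda>h. z * mon h) ` monomials m k)"
    by (intro mpol.span_sum mpol.span_scale mpol.span_base imageI)
  finally show ?thesis .
qed

lemma generic_matrix_eq: "generic_matrix m d v f e n = coeff_matrix m n (generic_elements m d v f e n)"
  by (simp add: generic_matrix_def coeff_matrix_def Let_def)

lemma map_coeff_matrix:
  "map_mat (mpol_eval a) (coeff_matrix m n es) = coeff_matrix m n (map (eval_coeffs a) es)"
  by (rule eq_matI) (auto simp: coeff_matrix_def Let_def lookup_eval_coeffs)

lemma submatrix_map_mat: "submatrix (map_mat h A) S T = map_mat h (submatrix A S T)"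
  by (rule eq_matI) (auto simp: submatrix_def pick_le)

lemma set_generic_elements:
  "set (generic_elements m d v f e n) =
    {generic_form m i * mon g | i g. i < d \<and> 1 \<le> n \<and> g \<in> monomials m (n - 1)} \<union>
    {lift_coeffs (f j) * mon h | j h. j < v \<and> e j \<le> n \<and> h \<in> monomials m (n - e j)}"
  unfolding generic_elements_def by (auto split: if_splits)

lemma generic_elements_eval:
  "set (map (eval_coeffs a) (generic_elements m d v f e n)) =
    {linear_form m a i * mon g | i g. i < d \<and> 1 \<le> n \<and> g \<in> monomials m (n - 1)} \<union>
    {f j * mon h | j h. j < v \<and> e j \<le> n \<and> h \<in> monomials m (n - e j)}"
  unfolding set_map set_generic_elements image_Un
  by (auto simp: eval_coeffs_mult_mono eval_coeffs_generic_form eval_coeffs_lift_coeffs image_iff)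
    (metis eval_coeffs_mult_mono eval_coeffs_generic_form eval_coeffs_lift_coeffs)+

lemma lookup_mult_mono_carrier:
  assumes "\<And>s. Poly_Mapping.lookup p s \<in> carrier (mpol_ring U)"
  shows "Poly_Mapping.lookup (p * mon g) t \<in> carrier (mpol_ring U)"
  unfolding lookup_mult_single using assms by (intro carrier_sum) auto

lemma generic_matrix_carrier:
  assumes "r < dim_row (generic_matrix m d v f e n)" "c < dim_col (generic_matrix m d v f e n)"
  shows "generic_matrix m d v f e n $$ (r, c) \<in> carrier (mpol_ring (u_indices m d))"
proof -
  let ?es = "generic_elements m d v f e n"
  let ?C = "carrier (mpol_ring (u_indices m d))"
  have gen: "Poly_Mapping.lookup (generic_form m i) s \<in> ?C" if "i < d" for i s
    unfolding generic_form_def lookup_sum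
    using that by (intro carrier_sum) (auto simp: lookup_single when_def u_indices_def intro!: single_in_carrier)
  have lift: "Poly_Mapping.lookup (lift_coeffs p) s \<in> ?C" for p s
    by (simp add: lift_coeffs_def Poly_Mapping.map.rep_eq when_def)
  have "?es ! r \<in> set ?es" using assms(1) by (simp add: generic_matrix_def Let_def)
  then have "Poly_Mapping.lookup (?es ! r) t \<in> ?C" for t
    unfolding set_generic_elements using lookup_mult_mono_carrier gen lift by fastforce
  with assms show ?thesis by (simp add: generic_matrix_def Let_def)
qed

lemma carrier_prod:
  "(\<And>i. i \<in> A \<Longrightarrow> p i \<in> carrier (mpol_ring X)) \<Longrightarrow> prod p A \<in> carrier (mpol_ring X)"
  by (induction A rule: infinite_finite_induct) (auto intro: carrier_closed)

lemma det_carrier: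
  assumes "\<And>r c. r < dim_row M \<Longrightarrow> c < dim_col M \<Longrightarrow> M $$ (r, c) \<in> carrier (mpol_ring X)"
  shows "det M \<in> carrier (mpol_ring X)"
proof (cases "dim_row M = dim_col M")
  case True
  have "M $$ (i, p i) \<in> carrier (mpol_ring X)" if "p permutes {0..<dim_row M}" "i < dim_row M" for p i
    using that permutes_in_image[OF that(1), of i] True by (intro assms) auto
  then show ?thesis
    unfolding det_def using True
    by (auto intro!: carrier_sum carrier_closed carrier_prod carrier_uminus simp: sign_def)
qed (simp add: det_def)

lemma minors_carrier:
  "minors N (generic_matrix m d v f e n) \<subseteq> carrier (mpol_ring (u_indices m d))"
proof -
  have "det (submatrix (generic_matrix m d v f e n) S T) \<in> carrier (mpol_ring (u_indices m d))" for S T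
    by (rule det_carrier) (auto simp: submatrix_def intro!: generic_matrix_carrier pick_le)
  then show ?thesis by (auto simp: minors_def)
qed

lemma ideal_vanishing: "ideal {p \<in> carrier (mpol_ring X). \<forall>a\<in>S. mpol_eval a p = 0} (mpol_ring X)"
  unfolding ideal_mpol_ring_iff by (auto simp: mpol_eval_add mpol_eval_mult intro: carrier_closed)

lemma linear_form_expand:
  fixes z :: "(nat, 'k::field) mpol"
  assumes "z \<in> forms m 1"
  shows "z = (\<Sum>j<m. cst (Poly_Mapping.lookup z (Poly_Mapping.single j 1)) * var j)"
proof -
  have mon: "monomials m 1 = (\<lambda>j. Poly_Mapping.single j 1) ` {..<m}"
  proof (intro equalityI subsetI)
    fix t assume "t \<in> monomials m 1"
    then have "t \<in> monomials m (Suc 0)" by simp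
    then obtain j s where "j < m" "s \<in> monomials m 0" "t = Poly_Mapping.single j 1 + s"
      by (rule monomials_Suc)
    then show "t \<in> (\<lambda>j. Poly_Mapping.single j 1) ` {..<m}" by (auto simp: monomials_0)
  qed (auto simp: monomials_def)
  have inj: "inj_on (\<lambda>j. Poly_Mapping.single j (1::nat)) {..<m}"
    using mono_eq_iff by (auto simp: inj_on_def dest: arg_cong[of _ _ Poly_Mapping.keys])
  show ?thesis using forms_expand[OF assms] unfolding mon sum.reindex[OF inj] o_def .
qed

section \<open>The varieties\<close>

locale graded_presentation = graded_quotient m d I
  for m d :: nat and I :: "(nat, 'k::field) mpol set" +
  fixes v :: nat and f :: "nat \<Rightarrow> (nat, 'k) mpol" and e :: "nat \<Rightarrow> nat"
  assumes f_forms: "\<And>j. j < v \<Longrightarrow> f j \<in> forms m (e j)"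
    and I_generated: "I = genideal (mpol_ring {..<m}) (f ` {..<v})"
begin

abbreviation "U \<equiv> u_indices m d"
abbreviation "V \<equiv> variety m d v f e"
abbreviation "H_at a \<equiv> H (linear_form m a)"

lemma linear_tuple_linear_form: "linear_tuple (linear_form m a)"
  unfolding linear_tuple_def using linear_form_forms by blast

text \<open>With \<open>I\<close> built over the zero ideal, \<open>adjoin_component\<close>
  represents each form in \<open>I\<close> through the \<open>f j\<close> with multipliers of degree
  \<open>n - e j\<close>, the degree of the monomials that index the rows.\<close>

lemma I_eq_adjoin: "I = adjoin m {0} {..<v} f"
proof
  have fc: "f ` {..<v} \<subseteq> carrier R" using f_forms forms_carrier by blast
  have "ideal (adjoin m {0} {..<v} f) R" using fc by (intro ideal_adjoin ideal_zero) auto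
  moreover have "f j \<in> adjoin m {0} {..<v} f" if "j < v" for j
    using that by (intro adjoin_superset(2)[OF ideal_zero]) auto
  ultimately show "I \<subseteq> adjoin m {0} {..<v} f"
    unfolding I_generated by (intro genideal_mpol_ring(3)[OF fc]) auto
  show "adjoin m {0} {..<v} f \<subseteq> I"
    using genideal_mpol_ring(2)[OF fc] idealD(2)[OF ideal_I] I_generated by (intro adjoin_minimal[OF ideal_I]) auto
qed

text \<open>A form in \<open>H_at a\<close> is split along the linear forms, and its part in
  \<open>I\<close> along the \<open>f j\<close>. The multipliers then have exactly the degrees used
  in the matrix, and expanding them in monomials produces the rows.\<close>

lemma spanning_iff_subset_H:
  "forms m n \<subseteq> mpol.span (set (map (eval_coeffs a) (generic_elements m d v f e n))) \<longleftrightarrow> forms m n \<subseteq> H_at a"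
  (is "_ \<subseteq> mpol.span ?E \<longleftrightarrow> _")
proof
  note iH = ideal_H[OF linear_tuple_linear_form[of a]]
  have "?E \<subseteq> H_at a"
  proof
    fix p assume "p \<in> ?E"
    then consider i g where "i < d" "g \<in> monomials m (n - 1)" "p = linear_form m a i * mon g"
      | j h where "j < v" "h \<in> monomials m (n - e j)" "p = f j * mon h"
      unfolding generic_elements_eval by blast
    then show "p \<in> H_at a"
    proof cases
      case 1
      then show ?thesis
        using adjoin_superset(2)[OF ideal_I, of "{..<d}" i "linear_form m a"] subsetD[OF forms_carrier mono_forms[OF 1(2)]]
        by (auto intro: idealD(5)[OF iH])
    next
      case 2
      have "f j \<in> I" using adjoin_superset(2)[OF ideal_zero, of "{..<v}" j] 2(1) unfolding I_eq_adjoin by auto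
      then show ?thesis
        using 2 I_subset_H subsetD[OF forms_carrier mono_forms[OF 2(2)]] by (auto intro: idealD(5)[OF iH])
    qed
  qed
  then have "mpol.span ?E \<subseteq> H_at a" by (intro mpol.span_minimal subspace_ideal[OF iH])
  then show "forms m n \<subseteq> mpol.span ?E \<Longrightarrow> forms m n \<subseteq> H_at a" by blast
next
  assume sub: "forms m n \<subseteq> H_at a"
  show "forms m n \<subseteq> mpol.span ?E"
  proof
    fix p :: "(nat, 'k) mpol" assume p: "p \<in> forms m n"
    then have "p \<in> H_at a" using sub by blast
    then obtain p0 q where pq: "p0 \<in> I" "p0 \<in> forms m n"
      "\<And>i. i < d \<Longrightarrow> 1 \<le> n \<Longrightarrow> q i \<in> forms m (n - 1)"
      "\<And>i. i < d \<Longrightarrow> \<not> 1 \<le> n \<Longrightarrow> q i = 0"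
      "hom_component n p = p0 + (\<Sum>i<d. linear_form m a i * q i)"
      by (rule H_component[OF linear_tuple_linear_form]) (rule that)
    have "p0 \<in> adjoin m {0} {..<v} f" using pq(1) I_eq_adjoin by simp
    then obtain p1 r where pr: "p1 \<in> {0}" "p1 \<in> forms m n"
      "\<And>j. j \<in> {..<v} \<Longrightarrow> e j \<le> n \<Longrightarrow> r j \<in> forms m (n - e j)"
      "\<And>j. j \<in> {..<v} \<Longrightarrow> \<not> e j \<le> n \<Longrightarrow> r j = 0"
      "hom_component n p0 = p1 + (\<Sum>j<v. f j * r j)"
    proof (rule adjoin_component[where n = n and e = e, OF homogeneous_ideal_zero, rotated])
      show "f j \<in> forms m (e j)" if "j \<in> {..<v}" for j using f_forms that by simp
    qed (rule that)
    have "linear_form m a i * q i \<in> mpol.span ?E" if i: "i < d" for i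
    proof (cases "1 \<le> n")
      case True
      have "linear_form m a i * q i \<in> mpol.span ((\<lambda>h. linear_form m a i * mon h) ` monomials m (n - 1))"
        by (rule mult_form_span[OF pq(3)[OF i True]])
      also have "\<dots> \<subseteq> mpol.span ?E"
        unfolding generic_elements_eval using i True by (intro mpol.span_mono) auto
      finally show ?thesis .
    qed (use pq(4)[OF i] mpol.span_zero in auto)
    moreover have "f j * r j \<in> mpol.span ?E" if j: "j < v" for j
    proof (cases "e j \<le> n")
      case True
      have "f j * r j \<in> mpol.span ((\<lambda>h. f j * mon h) ` monomials m (n - e j))"
        using j by (intro mult_form_span pr(3) True) simp
      also have "\<dots> \<subseteq> mpol.span ?E"
        unfolding generic_elements_eval using j True by (intro mpol.span_mono) auto
      finally show ?thesis .
    qed (use pr(4)[of j] j mpol.span_zero in auto)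
    moreover have "p = (\<Sum>j<v. f j * r j) + (\<Sum>i<d. linear_form m a i * q i)"
      using pq(5) pr(1,5) hom_component_of_form[OF p, of n] hom_component_of_form[OF pq(2), of n] by simp
    ultimately show "p \<in> mpol.span ?E"
      by (auto intro!: mpol.span_add mpol.span_sum)
  qed
qed

text \<open>The polynomials vanishing at \<open>a\<close> form an ideal, so only the generating
  minors matter, and evaluation commutes with determinants as a ring homomorphism. The rank
  criterion \<open>spanning_iff_minor\<close> does the rest.\<close>

lemma minors_ideal_vanishes_iff:
  "(\<forall>p\<in>minors_ideal m d v f e n. mpol_eval a p = 0) \<longleftrightarrow> \<not> forms m n \<subseteq> H_at a"
proof -
  let ?es = "generic_elements m d v f e n"
  let ?M = "coeff_matrix m n ?es"
  let ?N = "card (monomials m n)"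
  let ?mins = "minors ?N ?M"
  interpret ev: comm_ring_hom "mpol_eval a" by (rule comm_ring_hom_mpol_eval)
  have J: "minors_ideal m d v f e n = genideal (mpol_ring U) ?mins"
    unfolding minors_ideal_def generic_matrix_eq card_monomials[OF m_pos] ..
  have mc: "?mins \<subseteq> carrier (mpol_ring U)"
    using minors_carrier[of ?N m d v f e n] unfolding generic_matrix_eq .
  have "(\<forall>p\<in>minors_ideal m d v f e n. mpol_eval a p = 0) \<longleftrightarrow> (\<forall>p\<in>?mins. mpol_eval a p = 0)"
  proof
    assume "\<forall>p\<in>?mins. mpol_eval a p = 0"
    then have "minors_ideal m d v f e n \<subseteq> {p \<in> carrier (mpol_ring U). \<forall>b\<in>{a}. mpol_eval b p = 0}"
      unfolding J using mc by (intro genideal_mpol_ring(3)[OF mc ideal_vanishing]) auto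
    then show "\<forall>p\<in>minors_ideal m d v f e n. mpol_eval a p = 0" by blast
  qed (use genideal_mpol_ring(2)[OF mc] J in blast)
  also have "\<dots> \<longleftrightarrow> \<not> forms m n \<subseteq> mpol.span (set (map (eval_coeffs a) ?es))"
  proof -
    have sub: "set (map (eval_coeffs a) ?es) \<subseteq> forms m n"
    proof
      fix p assume "p \<in> set (map (eval_coeffs a) ?es)"
      then consider i g where "1 \<le> n" "g \<in> monomials m (n - 1)" "p = linear_form m a i * mon g"
        | j h where "j < v" "e j \<le> n" "h \<in> monomials m (n - e j)" "p = f j * mon h"
        unfolding generic_elements_eval by blast
      then show "p \<in> forms m n"
      proof cases
        case 1
        then show ?thesis using forms_mult[OF linear_form_forms mono_forms[OF 1(2)]] by simp
      next
        case 2
        then show ?thesis using forms_mult[OF f_forms[OF 2(1)] mono_forms[OF 2(3)]] by simp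
      qed
    qed
    have dims: "dim_row ?M = length ?es" "dim_col ?M = ?N"
      by (simp_all add: coeff_matrix_def Let_def)
    have full: "T = {..<?N}" if "T \<subseteq> {..<?N}" "card T = ?N" for T
      using that by (intro card_subset_eq) auto
    have ev: "mpol_eval a (det (submatrix ?M S T)) =
        det (submatrix (coeff_matrix m n (map (eval_coeffs a) ?es)) S T)" for S T
      by (simp add: submatrix_map_mat flip: map_coeff_matrix)
    have "(\<exists>p\<in>?mins. mpol_eval a p \<noteq> 0) \<longleftrightarrow> (\<exists>S \<subseteq> {..<length ?es}. card S = ?N \<and>
        det (submatrix (coeff_matrix m n (map (eval_coeffs a) ?es)) S {..<?N}) \<noteq> 0)"
    proof
      assume "\<exists>p\<in>?mins. mpol_eval a p \<noteq> 0"
      then obtain S T where ST: "S \<subseteq> {..<length ?es}" "T \<subseteq> {..<?N}" "card S = ?N" "card T = ?N"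
        "mpol_eval a (det (submatrix ?M S T)) \<noteq> 0"
        unfolding minors_def dims by blast
      with full[OF ST(2,4)] show "\<exists>S \<subseteq> {..<length ?es}. card S = ?N \<and>
        det (submatrix (coeff_matrix m n (map (eval_coeffs a) ?es)) S {..<?N}) \<noteq> 0"
        unfolding ev by blast
    next
      assume "\<exists>S \<subseteq> {..<length ?es}. card S = ?N \<and>
        det (submatrix (coeff_matrix m n (map (eval_coeffs a) ?es)) S {..<?N}) \<noteq> 0"
      then obtain S where S: "S \<subseteq> {..<length ?es}" "card S = ?N"
        "mpol_eval a (det (submatrix ?M S {..<?N})) \<noteq> 0"
        unfolding ev by blast
      have "det (submatrix ?M S {..<?N}) \<in> ?mins"
        unfolding minors_def dims using S(1,2) by (intro CollectI exI[of _ S] exI[of _ "{..<?N}"]) simp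
      with S(3) show "\<exists>p\<in>?mins. mpol_eval a p \<noteq> 0" by blast
    qed
    then show ?thesis unfolding spanning_iff_minor[OF sub] length_map by blast
  qed
  finally show ?thesis unfolding spanning_iff_subset_H .
qed

lemma variety_eq: "V n = {P \<in> proj_space U. \<forall>a\<in>P. \<not> forms m n \<subseteq> H_at a}"
  unfolding variety_def proj_zeros_def using minors_ideal_vanishes_iff by auto

lemma variety_Suc_subset: "V (n + 1) \<subseteq> V n"
proof -
  have "forms m (n + 1) \<subseteq> H_at a" if "forms m n \<subseteq> H_at a" for a
    using forms_subset_Suc[OF ideal_H[OF linear_tuple_linear_form] that] by simp
  then show ?thesis unfolding variety_eq by blast
qed

text \<open>A projective point is a set of proportional vectors, and the condition defining the
  varieties has to agree on all of them.\<close>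

lemma H_at_scale:
  assumes "c \<noteq> 0"
  shows "H_at (\<lambda>x. c * a x) = H_at a"
proof -
  have sub: "H_at (\<lambda>x. c * a x) \<subseteq> H_at a" for c a
  proof (rule adjoin_minimal[OF ideal_H[OF linear_tuple_linear_form] I_subset_H])
    fix i assume i: "i \<in> {..<d}"
    have "linear_form m (\<lambda>x. c * a x) i = cst c * linear_form m a i"
      by (simp add: linear_form_def sum_distrib_left mult_single flip: mult.assoc)
    then show "linear_form m (\<lambda>x. c * a x) i \<in> H_at a"
      using adjoin_superset(2)[OF ideal_I _ i, of "linear_form m a"]
      by (simp add: idealD(4)[OF ideal_H[OF linear_tuple_linear_form]])
  qed
  have "H_at (\<lambda>x. inverse c * (c * a x)) \<subseteq> H_at (\<lambda>x. c * a x)" by (rule sub)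
  also have "(\<lambda>x. inverse c * (c * a x)) = a" using assms by (simp flip: mult.assoc)
  finally show ?thesis using sub by blast
qed

lemma linear_tuple_coordinates:
  assumes "linear_tuple z"
  obtains a where "\<And>x. x \<notin> U \<Longrightarrow> a x = 0" "H z = H_at a"
proof -
  define a where "a = (\<lambda>(i, j). if i < d \<and> j < m then Poly_Mapping.lookup (z i) (Poly_Mapping.single j 1) else 0)"
  have "z i = linear_form m a i" if "i < d" for i
  proof -
    have "z i \<in> forms m 1" using assms that by (simp add: linear_tuple_def)
    from linear_form_expand[OF this] show ?thesis using that by (simp add: linear_form_def a_def)
  qed
  then have "H z = H_at a" by (simp add: adjoin_def)
  moreover have "a x = 0" if "x \<notin> U" for x using that by (cases x) (auto simp: a_def u_indices_def)
  ultimately show thesis using that by blast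
qed

lemma variety_jump_iff:
  "V (n + 1) \<noteq> V n \<longleftrightarrow> (\<exists>z. linear_tuple z \<and> forms m (n + 1) \<subseteq> H z \<and> \<not> forms m n \<subseteq> H z)"
proof
  assume "V (n + 1) \<noteq> V n"
  then obtain P where "P \<in> V n" "P \<notin> V (n + 1)" using variety_Suc_subset by blast
  then obtain a where "forms m (n + 1) \<subseteq> H_at a" "\<not> forms m n \<subseteq> H_at a" unfolding variety_eq by blast
  with linear_tuple_linear_form
  show "\<exists>z. linear_tuple z \<and> forms m (n + 1) \<subseteq> H z \<and> \<not> forms m n \<subseteq> H z" by blast
next
  assume "\<exists>z. linear_tuple z \<and> forms m (n + 1) \<subseteq> H z \<and> \<not> forms m n \<subseteq> H z"
  then obtain z where z: "linear_tuple z" "forms m (n + 1) \<subseteq> H z" "\<not> forms m n \<subseteq> H z" by blast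
  obtain a where a: "\<And>x. x \<notin> U \<Longrightarrow> a x = 0" and H_at: "H z = H_at a"
    by (rule linear_tuple_coordinates[OF z(1)]) (rule that)
  \<comment> \<open>The zero vector represents no projective point. It would make \<open>I\<close>
    itself contain all forms of some degree, a reduction generated by no forms, against
    \<open>d \<ge> 1\<close>.\<close>
  have "\<exists>x. a x \<noteq> 0"
  proof (rule ccontr)
    assume "\<not> (\<exists>x. a x \<noteq> 0)"
    then have "H_at a \<subseteq> I"
      using idealD(2)[OF ideal_I] by (intro adjoin_minimal[OF ideal_I]) (auto simp: linear_form_def)
    then have "forms m (n + 1) \<subseteq> adjoin m I {} (\<lambda>_::nat. 0)"
      using z(2) H_at adjoin_superset(1)[OF ideal_I] by blast
    from reduction_generators_ge[OF _ _ this] dimension(2) show False by simp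
  qed
  let ?P = "{(\<lambda>x. c * a x) | c. c \<noteq> 0}"
  have "?P \<in> proj_space U"
    unfolding proj_space_def using a \<open>\<exists>x. a x \<noteq> 0\<close> by (intro CollectI exI[of _ a] conjI refl) auto
  moreover have "\<forall>b\<in>?P. H_at b = H z" using H_at_scale H_at by auto
  ultimately have "?P \<in> V n" unfolding variety_eq using z(3) by auto
  moreover have "?P \<notin> V (n + 1)"
  proof -
    have "a \<in> ?P" by (intro CollectI exI[of _ 1]) simp
    then show ?thesis unfolding variety_eq using z(2) H_at by auto
  qed
  ultimately show "V (n + 1) \<noteq> V n" by blast
qed

text \<open>The varieties decrease, so the ideals \<open>K n\<close> of polynomials vanishing on
  them ascend and the noetherian property applies. Since \<open>V n\<close> is also the zero locus
  of \<open>K n\<close>, a change of variety forces a change of \<open>K n\<close>.\<close>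

lemma finite_variety_jumps: "finite {n. V (n + 1) \<noteq> V n}"
proof -
  define K where "K n = {p \<in> carrier (mpol_ring U). \<forall>a\<in>\<Union>(V n). mpol_eval a p = 0}" for n
  have zeros: "V n = proj_zeros U (K n)" for n
  proof
    show "V n \<subseteq> proj_zeros U (K n)"
      unfolding proj_zeros_def K_def using variety_eq by auto
    have mc: "minors ((n + m - 1) choose (m - 1)) (generic_matrix m d v f e n) \<subseteq> carrier (mpol_ring U)"
      by (rule minors_carrier)
    have "minors_ideal m d v f e n \<subseteq> K n"
      using idealD(1)[OF genideal_mpol_ring(1)[OF mc]]
      unfolding K_def variety_def proj_zeros_def minors_ideal_def by blast
    then show "proj_zeros U (K n) \<subseteq> V n"
      unfolding variety_def proj_zeros_def by blast
  qed
  have "finite {n. K n \<noteq> K (Suc n)}"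
  proof (rule finite_jumps_of_ideals)
    show "finite U" by (simp add: u_indices_def)
    show "ideal (K n) (mpol_ring U)" for n unfolding K_def by (rule ideal_vanishing)
    show "K n \<subseteq> K (Suc n)" for n
      using variety_Suc_subset[of n] unfolding K_def by auto
  qed
  then show ?thesis
    by (rule rev_finite_subset) (use zeros in auto)
qed

lemma minimal_reduction_numbers_eq_jumps:
  "minimal_reduction_numbers (R Quot I) (quot_piece m I) = {n. V (n + 1) \<noteq> V n}"
  unfolding minimal_reduction_numbers_eq variety_jump_iff ..

end

text \<open>Finiteness and nonemptiness accompany the claim because
  \<open>big_reduction_number\<close> is a \<open>Max\<close>, whose value is meaningful only for a
  finite nonempty set.\<close>

theorem corollary2p3:
  fixes m d v :: nat
    and I :: "(nat, 'k::field) mpol set"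
    and f :: "nat \<Rightarrow> (nat, 'k) mpol" and e :: "nat \<Rightarrow> nat"
  assumes "infinite (UNIV :: 'k set)"
    and "homogeneous_ideal m I"
    and "I \<noteq> carrier (poly_ring m)"
    and "\<And>j. j < v \<Longrightarrow> f j \<in> forms m (e j)"
    and "I = genideal (poly_ring m) (f ` {..<v})"
    and "krull_dim (poly_ring m Quot I) = enat d"
    and "d \<ge> 1"
  shows "finite (minimal_reduction_numbers (poly_ring m Quot I) (quot_piece m I)) \<and>
    minimal_reduction_numbers (poly_ring m Quot I) (quot_piece m I) \<noteq> {} \<and>
    (let br = big_reduction_number (poly_ring m Quot I) (quot_piece m I);
         V = variety m d v f e
     in V (br + 1) \<noteq> V br \<and> (\<forall>n. V (n + 1) \<noteq> V n \<longrightarrow> n \<le> br))"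
proof -
  interpret graded_presentation m d I v f e
    using assms unfolding poly_ring_def by unfold_locales
  let ?E = "{n. V (n + 1) \<noteq> V n}"
  have eq: "minimal_reduction_numbers (poly_ring m Quot I) (quot_piece m I) = ?E"
    unfolding poly_ring_def by (rule minimal_reduction_numbers_eq_jumps)
  have ne: "?E \<noteq> {}"
    using minimal_reduction_numbers_nonempty unfolding minimal_reduction_numbers_eq_jumps .
  have "Max ?E \<in> ?E" using finite_variety_jumps ne by (rule Max_in)
  moreover have "n \<le> Max ?E" if "V (n + 1) \<noteq> V n" for n
    using Max_ge[OF finite_variety_jumps, of n] that by simp
  ultimately show ?thesis
    unfolding eq big_reduction_number_def Let_def using finite_variety_jumps ne by simp
qed

end
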